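(* Let $X$ be a compact, connected, locally path connected topological space and let $f : X \to \mathbb{R}$ be a continuous function. Then $\mathrm{Alg}(T_f) = H_0(X,f)$, i.e. the $H_0$-barcode of the superlevel filtration of $f$ is the barcode produced from the $\mathbb{R}$-tree $T_f$ by the procedure $\mathrm{Alg}$.
   Context: Superlevel filtration: $X_r := \{x \in X : f(x) \ge r\}$, $r\in\mathbb{R}$. $H_0(X,f)$ denotes the $H_0$-barcode (persistence module $r \mapsto H_0(X_r)$, with maps $H_0(X_r)\to H_0(X_s)$ for $r \ge s$ induced by inclusion) of this filtration; homology is Čech homology with coefficients in a field $k$. The tree $T_f$: for $x,y\in X$ put $d_f(x,y) := f(x)+f(y) - 2\sup_{\gamma : x\mapsto y}\inf_{t\in[0,1]} f(\gamma(t))$, the supremum being over continuous paths $\gamma:[0,1]\to X$ from $x$ to $y$. This is a pseudo-distance on $X$; $T_f := X/\{d_f=0\}$ with the induced distance $d_f$ is a compact $\mathbb{R}$-tree. The function $f$ descends to $T_f$; the root $O$ of $T_f$ is the point where $f$ attains its minimum, and $\ell(\tau) := \inf_X f + d_f(O,\tau)$ (so that $\ell(\tau) = f(\tau)$). The procedure $\mathrm{Alg}$ for a finite rooted tree $T$ with height function $\ell$: start with the forest $\mathcal{F}=T$ and the empty barcode. While $\mathcal{F}\ne\varnothing$: choose a longest path $\gamma$ in $\mathcal{F}$ going from a root $\alpha$ of (a component of) $\mathcal{F}$ to a leaf $\beta$ (the root of a component being its point of lowest height). At the first step add a bar which is born at parameter $\ell(\beta)$ and never dies as the superlevel parameter decreases;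 at every later step add a bar born at $\ell(\beta)$ and dying at $\ell(\alpha)$, as the superlevel parameter decreases. Then replace $\mathcal{F}$ by $\overline{\mathcal{F}\setminus \mathrm{Im}(\gamma)}$. The output is the direct sum of the corresponding interval modules over $k$. For an infinite compact rooted tree $(T,d,O)$: let $h(\tau) := \sup_{\eta} d(O,\eta) - d(O,\tau)$, where $\eta$ ranges over the connected component containing $\tau$ of $\{\eta \in T: d(O,\eta)\ge d(O,\tau)\}$, and let $T^{\varepsilon} := \{\tau\in T : h(\tau)\ge \varepsilon\}$ (a finite tree for every $\varepsilon>0$). For a sequence $\varepsilon_n \downarrow 0$, the inclusions $T^{\varepsilon_n}\hookrightarrow T^{\varepsilon_{n+1}}$ induce maps $\mathrm{Alg}(T^{\varepsilon_n})\to \mathrm{Alg}(T^{\varepsilon_{n+1}})$ (each bar is contained in exactly one bar of the next module with the same lower endpoint), and $\mathrm{Alg}(T) := \varinjlim \mathrm{Alg}(T^{\varepsilon_n})$. *)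

theory Defs
  imports "HOL-Analysis.Analysis" "HOL-Algebra.Module" "HOL-Algebra.AbelCoset"
begin

section \<open>Vector spaces and persistence modules\<close>

text \<open>
  The field of coefficients is the type \<open>'k::field\<close>. Vector spaces are records of type
  \<^type>\<open>module\<close>; the fields \<open>mult\<close> and \<open>one\<close>, which have no meaning for a module, are left
  \<open>undefined\<close>.
\<close>

definition linear_maps :: "('k, 'v) module \<Rightarrow> ('k, 'w) module \<Rightarrow> ('v \<Rightarrow> 'w) set" where
  "linear_maps M N =
     {g. g \<in> carrier M \<rightarrow> carrier N \<and>
         (\<forall>x\<in>carrier M. \<forall>y\<in>carrier M. g (x \<oplus>\<^bsub>M\<^esub> y) = g x \<oplus>\<^bsub>N\<^esub> g y) \<and>
         (\<forall>a. \<forall>x\<in>carrier M. g (a \<odot>\<^bsub>M\<^esub> x) = a \<odot>\<^bsub>N\<^esub> g x)}"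

definition free_module :: "'s set \<Rightarrow> ('k::field, 's \<Rightarrow> 'k) module" where
  "free_module S =
     \<lparr>carrier = {c. finite {s. c s \<noteq> 0} \<and> {s. c s \<noteq> 0} \<subseteq> S},
      mult = undefined, one = undefined,
      zero = (\<lambda>s. 0), add = (\<lambda>c c' s. c s + c' s), smult = (\<lambda>a c s. a * c s)\<rparr>"

text \<open>The linear extension of a map \<open>p\<close> of basis elements.\<close>

definition pushforward :: "('s \<Rightarrow> 't) \<Rightarrow> ('s \<Rightarrow> 'k::field) \<Rightarrow> 't \<Rightarrow> 'k" where
  "pushforward p c = (\<lambda>t. \<Sum>s | c s \<noteq> 0 \<and> p s = t. c s)"

definition quotient_module :: "('k, 'v) module \<Rightarrow> 'v set \<Rightarrow> ('k, 'v set) module" where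
  "quotient_module M N =
     \<lparr>carrier = a_rcosets\<^bsub>M\<^esub> N,
      mult = undefined, one = undefined,
      zero = N, add = set_add M, smult = (\<lambda>a h. \<Union>x\<in>h. N +>\<^bsub>M\<^esub> (a \<odot>\<^bsub>M\<^esub> x))\<rparr>"

text \<open>
  Persistence modules for a superlevel filtration: the map \<open>pm_map V r s\<close> goes from
  \<open>pm_space V r\<close> to \<open>pm_space V s\<close> and is meaningful for \<open>r \<ge> s\<close> only.
\<close>

record ('k, 'v) persmod =
  pm_space :: "real \<Rightarrow> ('k, 'v) module"
  pm_map :: "real \<Rightarrow> real \<Rightarrow> 'v \<Rightarrow> 'v"

text \<open>
  Equality of barcodes. A morphism of the observable category of Chazal, Crawley-Boevey and
  de Silva is a compatible family of linear maps \<open>V\<^sub>r \<rightarrow> W\<^sub>s\<close> indexed by the pairs \<open>r > s\<close>; the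
  identity of \<open>V\<close> is the family of the structure maps of \<open>V\<close>, and the composition of two
  families, evaluated at \<open>r > t\<close>, passes through any intermediate \<open>s\<close>. For q-tame persistence
  modules, isomorphism in this category is the same as having the same barcode, where a bar is
  given by its birth and death and it is not recorded whether these are attained. A strict
  isomorphism cannot be asked for here: a direct limit of bars with attained births whose births
  increase strictly is a bar whose birth is not attained, whereas the homology classes of a
  closed superlevel set at a maximum are already present at that level.
\<close>

definition obs_morphisms ::
    "('k, 'v) persmod \<Rightarrow> ('k, 'w) persmod \<Rightarrow> (real \<Rightarrow> real \<Rightarrow> 'v \<Rightarrow> 'w) set" where
  "obs_morphisms V W =
     {\<phi>. (\<forall>r s. s < r \<longrightarrow> \<phi> r s \<in> linear_maps (pm_space V r) (pm_space W s)) \<and>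
          (\<forall>r' r s s'. s' \<le> s \<and> s < r \<and> r \<le> r' \<longrightarrow>
             (\<forall>x\<in>carrier (pm_space V r'). pm_map W s s' (\<phi> r s (pm_map V r' r x)) = \<phi> r' s' x))}"

definition same_barcode :: "('k, 'v) persmod \<Rightarrow> ('k, 'w) persmod \<Rightarrow> bool" where
  "same_barcode V W \<longleftrightarrow>
     (\<exists>\<phi>\<in>obs_morphisms V W. \<exists>\<psi>\<in>obs_morphisms W V.
        \<forall>r s t. t < s \<and> s < r \<longrightarrow>
          (\<forall>x\<in>carrier (pm_space V r). \<psi> s t (\<phi> r s x) = pm_map V r t x) \<and>
          (\<forall>y\<in>carrier (pm_space W r). \<phi> s t (\<psi> r s y) = pm_map W r t y))"


section \<open>Direct sums of interval modules\<close>

text \<open>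
  The bar \<open>(a, b)\<close> is born at \<open>b\<close> and dies at \<open>a\<close> as the parameter decreases; \<open>a = -\<infinity>\<close> if it
  never dies.
\<close>

type_synonym bar = "ereal \<times> real"

definition bar_interval :: "bar \<Rightarrow> real set" where
  "bar_interval B = {r. fst B < ereal r \<and> r \<le> snd B}"

definition alive :: "bar list \<Rightarrow> real \<Rightarrow> nat set" where
  "alive bs r = {i. i < length bs \<and> r \<in> bar_interval (bs ! i)}"

definition bars_module :: "bar list \<Rightarrow> ('k::field, nat \<Rightarrow> 'k) persmod" where
  "bars_module bs =
     \<lparr>pm_space = (\<lambda>r. free_module (alive bs r)),
      pm_map = (\<lambda>r s c i. if i \<in> alive bs s then c i else 0)\<rparr>"


section \<open>Direct limits of sequences\<close>

definition transition :: "(nat \<Rightarrow> 'v \<Rightarrow> 'v) \<Rightarrow> nat \<Rightarrow> nat \<Rightarrow> 'v \<Rightarrow> 'v" where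
  "transition \<phi> m n = fold \<phi> [m..<n]"

definition germ ::
    "(nat \<Rightarrow> ('k, 'v) module) \<Rightarrow> (nat \<Rightarrow> 'v \<Rightarrow> 'v) \<Rightarrow> nat \<Rightarrow> 'v \<Rightarrow> (nat \<times> 'v) set" where
  "germ M \<phi> m x =
     {(n, y). y \<in> carrier (M n) \<and>
        (\<exists>p. m \<le> p \<and> n \<le> p \<and> transition \<phi> m p x = transition \<phi> n p y)}"

definition direct_limit ::
    "(nat \<Rightarrow> ('k, 'v) module) \<Rightarrow> (nat \<Rightarrow> 'v \<Rightarrow> 'v) \<Rightarrow> ('k, (nat \<times> 'v) set) module" where
  "direct_limit M \<phi> =
     \<lparr>carrier = {germ M \<phi> n x | n x. x \<in> carrier (M n)},
      mult = undefined, one = undefined,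
      zero = germ M \<phi> 0 \<zero>\<^bsub>M 0\<^esub>,
      add = (\<lambda>A B. \<Union>(m, x)\<in>A. \<Union>(n, y)\<in>B.
               germ M \<phi> (max m n)
                 (transition \<phi> m (max m n) x \<oplus>\<^bsub>M (max m n)\<^esub> transition \<phi> n (max m n) y)),
      smult = (\<lambda>a A. \<Union>(n, x)\<in>A. germ M \<phi> n (a \<odot>\<^bsub>M n\<^esub> x))\<rparr>"

definition direct_limit_persmod ::
    "(nat \<Rightarrow> ('k, 'v) persmod) \<Rightarrow> (nat \<Rightarrow> real \<Rightarrow> 'v \<Rightarrow> 'v) \<Rightarrow> ('k, (nat \<times> 'v) set) persmod" where
  "direct_limit_persmod V \<phi> =
     \<lparr>pm_space = (\<lambda>r. direct_limit (\<lambda>n. pm_space (V n) r) (\<lambda>n. \<phi> n r)),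
      pm_map = (\<lambda>r s A. \<Union>(n, x)\<in>A.
                  germ (\<lambda>n. pm_space (V n) s) (\<lambda>n. \<phi> n s) n (pm_map (V n) r s x))\<rparr>"


section \<open>Cech homology in degree 0\<close>

text \<open>
  The vertices of the nerve of \<open>U\<close> are the nonempty members of \<open>U\<close>, and \<open>(u, v)\<close> is an (ordered,
  possibly degenerate) edge if \<open>u\<close> and \<open>v\<close> meet.
\<close>

definition nerve_chains0 :: "'a set set \<Rightarrow> ('k::field, 'a set \<Rightarrow> 'k) module" where
  "nerve_chains0 U = free_module {u \<in> U. u \<noteq> {}}"

definition nerve_chains1 :: "'a set set \<Rightarrow> ('k::field, 'a set \<times> 'a set \<Rightarrow> 'k) module" where
  "nerve_chains1 U = free_module {(u, v). u \<in> U \<and> v \<in> U \<and> u \<inter> v \<noteq> {}}"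

definition nerve_boundary :: "('a set \<times> 'a set \<Rightarrow> 'k::field) \<Rightarrow> 'a set \<Rightarrow> 'k" where
  "nerve_boundary c = (\<lambda>w. pushforward snd c w - pushforward fst c w)"

definition nerve_H0 :: "'a set set \<Rightarrow> ('k::field, ('a set \<Rightarrow> 'k) set) module" where
  "nerve_H0 U = quotient_module (nerve_chains0 U) (nerve_boundary ` carrier (nerve_chains1 U))"

text \<open>
  If every member of \<open>V\<close> is contained in a member of \<open>U\<close>, any choice of such members is a
  simplicial map of the nerves, and all choices induce the same map in homology.
\<close>

definition nerve_map ::
    "'a set set \<Rightarrow> 'a set set \<Rightarrow> ('a set \<Rightarrow> 'k::field) set \<Rightarrow> ('a set \<Rightarrow> 'k) set" where
  "nerve_map V U h =
     (\<Union>c\<in>h. (nerve_boundary ` carrier (nerve_chains1 U))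
        +>\<^bsub>nerve_chains0 U\<^esub> pushforward (\<lambda>v. SOME u. u \<in> U \<and> v \<subseteq> u) c)"

definition open_covers :: "'a topology \<Rightarrow> 'a set set set" where
  "open_covers Y = {U. (\<forall>u\<in>U. openin Y u) \<and> \<Union>U = topspace Y}"

definition refines :: "'a set set \<Rightarrow> 'a set set \<Rightarrow> bool" where
  "refines V U \<longleftrightarrow> (\<forall>v\<in>V. \<exists>u\<in>U. v \<subseteq> u)"

definition cech_H0 ::
    "'a topology \<Rightarrow> ('k::field, 'a set set \<Rightarrow> ('a set \<Rightarrow> 'k) set) module" where
  "cech_H0 Y =
     \<lparr>carrier = {x. x \<in> (\<Pi>\<^sub>E U\<in>open_covers Y. carrier (nerve_H0 U)) \<and>
                   (\<forall>U\<in>open_covers Y. \<forall>V\<in>open_covers Y. refines V U \<longrightarrow> nerve_map V U (x V) = x U)},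
      mult = undefined, one = undefined,
      zero = (\<lambda>U\<in>open_covers Y. \<zero>\<^bsub>nerve_H0 U\<^esub>),
      add = (\<lambda>x y. \<lambda>U\<in>open_covers Y. x U \<oplus>\<^bsub>nerve_H0 U\<^esub> y U),
      smult = (\<lambda>a x. \<lambda>U\<in>open_covers Y. a \<odot>\<^bsub>nerve_H0 U\<^esub> x U)\<rparr>"

text \<open>The map induced by the inclusion of a subspace \<open>Y\<close> of \<open>Z\<close>.\<close>

definition cech_H0_inclusion ::
    "'a topology \<Rightarrow> 'a topology \<Rightarrow> ('a set set \<Rightarrow> ('a set \<Rightarrow> 'k::field) set)
      \<Rightarrow> ('a set set \<Rightarrow> ('a set \<Rightarrow> 'k) set)" where
  "cech_H0_inclusion Y Z x =
     (\<lambda>U\<in>open_covers Z.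
        let U' = (\<lambda>u. topspace Y \<inter> u) ` U in nerve_map U' U (x U'))"

definition superlevel :: "'a topology \<Rightarrow> ('a \<Rightarrow> real) \<Rightarrow> real \<Rightarrow> 'a topology" where
  "superlevel X f r = subtopology X {x \<in> topspace X. r \<le> f x}"

definition H0_superlevel ::
    "'a topology \<Rightarrow> ('a \<Rightarrow> real)
      \<Rightarrow> ('k::field, 'a set set \<Rightarrow> ('a set \<Rightarrow> 'k) set) persmod" where
  "H0_superlevel X f =
     \<lparr>pm_space = (\<lambda>r. cech_H0 (superlevel X f r)),
      pm_map = (\<lambda>r s. cech_H0_inclusion (superlevel X f r) (superlevel X f s))\<rparr>"


section \<open>The tree of a function\<close>

definition path_pseudodist :: "'a topology \<Rightarrow> ('a \<Rightarrow> real) \<Rightarrow> 'a \<Rightarrow> 'a \<Rightarrow> real" where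
  "path_pseudodist X f x y =
     f x + f y - 2 * (SUP \<gamma> \<in> {\<gamma>. pathin X \<gamma> \<and> \<gamma> 0 = x \<and> \<gamma> 1 = y}. INF t\<in>{0..1}. f (\<gamma> t))"

definition tree_points :: "'a topology \<Rightarrow> ('a \<Rightarrow> real) \<Rightarrow> 'a set set" where
  "tree_points X f =
     topspace X // {(x, y). x \<in> topspace X \<and> y \<in> topspace X \<and> path_pseudodist X f x y = 0}"

definition tree_dist :: "'a topology \<Rightarrow> ('a \<Rightarrow> real) \<Rightarrow> 'a set \<Rightarrow> 'a set \<Rightarrow> real" where
  "tree_dist X f \<sigma> \<tau> =
     (if \<sigma> \<in> tree_points X f \<and> \<tau> \<in> tree_points X f
      then path_pseudodist X f (SOME x. x \<in> \<sigma>) (SOME y. y \<in> \<tau>) else 0)"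

definition tree_root :: "'a topology \<Rightarrow> ('a \<Rightarrow> real) \<Rightarrow> 'a set" where
  "tree_root X f =
     (THE \<tau>. \<tau> \<in> tree_points X f \<and> (\<forall>x\<in>\<tau>. f x = (INF y\<in>topspace X. f y)))"

definition tree_height :: "'a topology \<Rightarrow> ('a \<Rightarrow> real) \<Rightarrow> 'a set \<Rightarrow> real" where
  "tree_height X f \<tau> = (INF y\<in>topspace X. f y) + tree_dist X f (tree_root X f) \<tau>"


section \<open>The procedure Alg\<close>

text \<open>In an \<open>\<real>\<close>-tree, the geodesic between two points is the image of the unique arc joining them.\<close>

definition geodesic :: "'b set \<Rightarrow> ('b \<Rightarrow> 'b \<Rightarrow> real) \<Rightarrow> 'b \<Rightarrow> 'b \<Rightarrow> 'b set" where
  "geodesic T d x y = {z \<in> T. d x z + d z y = d x y}"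

definition is_leaf :: "'b set \<Rightarrow> ('b \<Rightarrow> 'b \<Rightarrow> real) \<Rightarrow> 'b set \<Rightarrow> 'b \<Rightarrow> 'b \<Rightarrow> bool" where
  "is_leaf T d C \<alpha> \<beta> \<longleftrightarrow> \<beta> \<in> C \<and> (\<forall>\<eta>\<in>C. \<beta> \<in> geodesic T d \<alpha> \<eta> \<longrightarrow> \<eta> = \<beta>)"

text \<open>A compact rooted \<open>\<real>\<close>-tree is a finite tree if and only if it has finitely many leaves.\<close>

definition finite_tree :: "'b set \<Rightarrow> ('b \<Rightarrow> 'b \<Rightarrow> real) \<Rightarrow> 'b \<Rightarrow> bool" where
  "finite_tree T d O' \<longleftrightarrow> finite {\<beta>. is_leaf T d T O' \<beta>}"

definition root_to_leaf ::
    "'b set \<Rightarrow> ('b \<Rightarrow> 'b \<Rightarrow> real) \<Rightarrow> ('b \<Rightarrow> real) \<Rightarrow> 'b set \<Rightarrow> 'b \<Rightarrow> 'b \<Rightarrow> bool" where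
  "root_to_leaf T d l F \<alpha> \<beta> \<longleftrightarrow>
     (\<exists>C\<in>connected_components_of (subtopology (Metric_space.mtopology T d) F).
        \<alpha> \<in> C \<and> (\<forall>\<eta>\<in>C. l \<alpha> \<le> l \<eta>) \<and> is_leaf T d C \<alpha> \<beta>)"

definition longest_root_to_leaf ::
    "'b set \<Rightarrow> ('b \<Rightarrow> 'b \<Rightarrow> real) \<Rightarrow> ('b \<Rightarrow> real) \<Rightarrow> 'b set \<Rightarrow> 'b \<Rightarrow> 'b \<Rightarrow> bool" where
  "longest_root_to_leaf T d l F \<alpha> \<beta> \<longleftrightarrow>
     root_to_leaf T d l F \<alpha> \<beta> \<and> (\<forall>\<alpha>' \<beta>'. root_to_leaf T d l F \<alpha>' \<beta>' \<longrightarrow> d \<alpha>' \<beta>' \<le> d \<alpha> \<beta>)"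

text \<open>
  \<open>alg_run T d l F ps\<close>: starting from the forest \<open>F\<close>, the loop can choose successively the paths
  with the endpoints \<open>(\<alpha>, \<beta>)\<close> listed in \<open>ps\<close>, and then terminates.
\<close>

inductive alg_run ::
    "'b set \<Rightarrow> ('b \<Rightarrow> 'b \<Rightarrow> real) \<Rightarrow> ('b \<Rightarrow> real) \<Rightarrow> 'b set \<Rightarrow> ('b \<times> 'b) list \<Rightarrow> bool"
  for T d l where
  stop: "alg_run T d l {} []"
| step: "longest_root_to_leaf T d l F \<alpha> \<beta> \<Longrightarrow>
         alg_run T d l (Metric_space.mtopology T d closure_of (F - geodesic T d \<alpha> \<beta>)) ps \<Longrightarrow>
         alg_run T d l F ((\<alpha>, \<beta>) # ps)"

definition bars_of_run :: "('b \<Rightarrow> real) \<Rightarrow> ('b \<times> 'b) list \<Rightarrow> bar list" where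
  "bars_of_run l ps =
     (case ps of [] \<Rightarrow> []
      | (\<alpha>, \<beta>) # qs \<Rightarrow> (-\<infinity>, l \<beta>) # map (\<lambda>(\<alpha>, \<beta>). (ereal (l \<alpha>), l \<beta>)) qs)"

text \<open>
  The longest path may not be unique, so Alg is a relation: \<open>bs\<close> is the list of bars of some run.
\<close>

definition alg_finite ::
    "'b set \<Rightarrow> ('b \<Rightarrow> 'b \<Rightarrow> real) \<Rightarrow> ('b \<Rightarrow> real) \<Rightarrow> bar list \<Rightarrow> bool" where
  "alg_finite T d l bs \<longleftrightarrow> (\<exists>ps. alg_run T d l T ps \<and> bs = bars_of_run l ps)"

definition height_above :: "'b set \<Rightarrow> ('b \<Rightarrow> 'b \<Rightarrow> real) \<Rightarrow> 'b \<Rightarrow> 'b \<Rightarrow> real" where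
  "height_above T d O' \<tau> =
     (SUP \<eta> \<in> connected_component_of_set
                (subtopology (Metric_space.mtopology T d) {\<eta> \<in> T. d O' \<tau> \<le> d O' \<eta>}) \<tau>. d O' \<eta>)
     - d O' \<tau>"

definition trimmed_tree :: "'b set \<Rightarrow> ('b \<Rightarrow> 'b \<Rightarrow> real) \<Rightarrow> 'b \<Rightarrow> real \<Rightarrow> 'b set" where
  "trimmed_tree T d O' \<epsilon> = {\<tau> \<in> T. \<epsilon> \<le> height_above T d O' \<tau>}"

text \<open>
  A matching of bars: distinct bars go to distinct bars with the same lower endpoint that contain
  them. It induces a map of the direct sums of interval modules, namely the pushforward.
\<close>

definition bar_matching :: "bar list \<Rightarrow> bar list \<Rightarrow> (nat \<Rightarrow> nat) \<Rightarrow> bool" where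
  "bar_matching bs bs' \<sigma> \<longleftrightarrow>
     inj_on \<sigma> {..<length bs} \<and>
     (\<forall>i<length bs. \<sigma> i < length bs' \<and> fst (bs' ! \<sigma> i) = fst (bs ! i) \<and>
        bar_interval (bs ! i) \<subseteq> bar_interval (bs' ! \<sigma> i))"

definition alg_system ::
    "'b set \<Rightarrow> ('b \<Rightarrow> 'b \<Rightarrow> real) \<Rightarrow> 'b \<Rightarrow> ('b \<Rightarrow> real) \<Rightarrow> (nat \<Rightarrow> real)
      \<Rightarrow> (nat \<Rightarrow> bar list) \<Rightarrow> (nat \<Rightarrow> nat \<Rightarrow> nat) \<Rightarrow> bool" where
  "alg_system T d O' l \<epsilon> bs \<sigma> \<longleftrightarrow>
     (\<forall>n. alg_finite (trimmed_tree T d O' (\<epsilon> n)) d l (bs n) \<and> bar_matching (bs n) (bs (Suc n)) (\<sigma> n))"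

definition alg_limit ::
    "(nat \<Rightarrow> bar list) \<Rightarrow> (nat \<Rightarrow> nat \<Rightarrow> nat) \<Rightarrow> ('k::field, (nat \<times> (nat \<Rightarrow> 'k)) set) persmod" where
  "alg_limit bs \<sigma> = direct_limit_persmod (\<lambda>n. bars_module (bs n)) (\<lambda>n r. pushforward (\<sigma> n))"

end

theory Submission
  imports Defs
begin

text \<open>
  Write \<open>g x y\<close> for the supremum over all paths from \<open>x\<close> to \<open>y\<close> of the minimum of \<open>f\<close> on the path;
  \<open>g\<close> satisfies the ultrametric inequality and \<open>g x x = f x\<close>. The path components of \<open>{f > s}\<close> are
  the clusters \<open>{y. g x y > s}\<close>, and the Cech homology of the closed superlevel sets agrees in the
  observable category with the free module on the clusters: a class at level \<open>r\<close> is evaluated on the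
  cover by the clusters at a level \<open>s < r\<close>. Since every cluster has an eldest point (a maximum of \<open>f\<close>,
  ties being broken by a well-order), sending a cluster to the sum of the eldest points of all the
  clusters containing it is a unitriangular isomorphism onto a direct sum of interval modules.

  On the side of the tree, a run of Alg is an enumeration of the leaves, and the bar of a leaf
  \<open>\<beta>\<close> dies at the largest value of \<open>g \<beta> b\<close> over the leaves \<open>b\<close> enumerated before. Choosing the
  longest path makes the highest leaf of each cluster the first one to be enumerated.
  Hence both decompositions have, for all \<open>s < r\<close>, as many bars that are born above \<open>r\<close> and die at or below
  \<open>s\<close> as there are clusters at level \<open>s\<close> reaching above \<open>r\<close>. These finite numbers determine the
  multiplicity of each bar. For \<open>T\<^sup>\<epsilon>\<close> all births move down by \<open>\<epsilon>\<close>; this gives the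
  matchings, and it makes the numbers for the direct limit equal to those of \<open>T\<close>, whatever
  matchings are used.
\<close>

section \<open>Interval modules and their multiplicities\<close>

text \<open>Counting is forced by the lack of canonical choices: longest paths may tie, so the runs
  on the trees \<open>T\<^sup>\<epsilon>\<close> are not unique, and the matchings between them are
  arbitrary. Counts of clusters do not see these choices. A gap s < r is kept throughout because a
  level may carry infinitely many clusters, while compactness leaves only finitely many that reach a
  fixed amount higher. The space and its tree are treated through the same axioms for
  \<open>g\<close>: on the space distinct points may be at distance 0, on the tree they may not, and
  the quotient map preserves \<open>g\<close>, so it matches the clusters of the two. The distance l
  x + l y - 2 g x y makes \<open>g\<close> a Gromov product; the geometry of the tree is derived
  from the ultrametric inequality and the existence of points at every intermediate height. Whole
  chains of eldest points are taken because the eldest point of a cluster alone is not natural: when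
  two clusters merge, the class of the younger one survives as the class of the elder, whereas the
  bar of its eldest point ends.\<close>

definition delta :: "'s \<Rightarrow> 'k::field \<Rightarrow> 's \<Rightarrow> 'k" where
  "delta a k = (\<lambda>s. if s = a then k else 0)"

lemma free_module_simps [simp]:
  "c \<in> carrier (free_module S) \<longleftrightarrow> finite {s. c s \<noteq> 0} \<and> {s. c s \<noteq> 0} \<subseteq> S"
  "c \<oplus>\<^bsub>free_module S\<^esub> c' = (\<lambda>s. c s + c' s)"
  "a \<odot>\<^bsub>free_module S\<^esub> c = (\<lambda>s. a * c s)"
  "\<zero>\<^bsub>free_module S\<^esub> = (\<lambda>s. 0)"
  by (auto simp: free_module_def)

lemma finite_support_add:
  fixes c c' :: "'s \<Rightarrow> 'k::field"
  assumes "finite {s. c s \<noteq> 0}" "finite {s. c' s \<noteq> 0}"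
  shows "finite {s. c s + c' s \<noteq> 0}"
  by (rule finite_subset[OF _ finite_UnI[OF assms]]) auto

lemma finite_support_smult:
  fixes c :: "'s \<Rightarrow> 'k::field"
  assumes "finite {s. c s \<noteq> 0}"
  shows "finite {s. a * c s \<noteq> 0}"
  by (rule finite_subset[OF _ assms]) auto

lemma finite_support_restrict:
  fixes c :: "'s \<Rightarrow> 'k::field"
  assumes "finite {s. c s \<noteq> 0}"
  shows "finite {s. (P s \<longrightarrow> c s \<noteq> 0) \<and> P s}"
  by (rule finite_subset[OF _ assms]) auto

lemma finite_support_delta [simp]: "finite {s. delta a k s \<noteq> 0}"
  by (rule finite_subset[of _ "{a}"]) (auto simp: delta_def)

lemma free_module_closed:
  "c \<in> carrier (free_module S) \<Longrightarrow> c' \<in> carrier (free_module S) \<Longrightarrow>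
     c \<oplus>\<^bsub>free_module S\<^esub> c' \<in> carrier (free_module S)"
  "c \<in> carrier (free_module S) \<Longrightarrow> a \<odot>\<^bsub>free_module S\<^esub> c \<in> carrier (free_module S)"
proof -
  assume "c \<in> carrier (free_module S)" "c' \<in> carrier (free_module S)"
  then show "c \<oplus>\<^bsub>free_module S\<^esub> c' \<in> carrier (free_module S)"
    using finite_support_add[of c c'] by (simp, force)
qed (use finite_support_smult[of c] in \<open>simp, force\<close>)

lemma delta_in_free_module: "a \<in> S \<Longrightarrow> delta a k \<in> carrier (free_module S)"
  by (auto simp: delta_def)

text \<open>Induction on the support, one point being switched off at a time. Linear identities
  below are reduced by this rule to a single basis vector.\<close>

lemma free_module_induct [consumes 1, case_names zero add]:
  assumes c: "c \<in> carrier (free_module S)"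
    and z: "P (\<lambda>s. 0)"
    and step: "\<And>c a k. c \<in> carrier (free_module S) \<Longrightarrow> a \<in> S \<Longrightarrow> P c \<Longrightarrow> P (\<lambda>s. c s + delta a k s)"
  shows "P c"
proof -
  have fin: "finite {s. c s \<noteq> 0}" and sub: "{s. c s \<noteq> 0} \<subseteq> S" using c by auto
  have "\<forall>c. {s. c s \<noteq> 0} = A \<longrightarrow> A \<subseteq> S \<longrightarrow> P c" if "finite A" for A
    using that
  proof (induction A)
    case empty
    show ?case
    proof (intro allI impI)
      fix c :: "'a \<Rightarrow> 'b" assume "{s. c s \<noteq> 0} = {}"
      then have "c = (\<lambda>s. 0)" by auto
      then show "P c" using z by simp
    qed
  next
    case (insert a A)
    show ?case
    proof (intro allI impI)
      fix c :: "'a \<Rightarrow> 'b" assume h: "{s. c s \<noteq> 0} = insert a A" "insert a A \<subseteq> S"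
      define c' where "c' = c(a := 0)"
      have s': "{s. c' s \<noteq> 0} = A" using h insert.hyps by (auto simp: c'_def)
      then have "P c'" using insert.IH h by auto
      then have "P (\<lambda>s. c' s + delta a (c a) s)"
        using step[of c' a "c a"] s' h insert.hyps by auto
      moreover have "(\<lambda>s. c' s + delta a (c a) s) = c" by (auto simp: c'_def delta_def)
      ultimately show "P c" by simp
    qed
  qed
  then show ?thesis using fin sub by blast
qed

text \<open>The definition sums over the exact support, which changes under addition because
  coefficients may cancel. Summation over a fixed larger finite set turns linearity into linearity
  of finite sums.\<close>

lemma pushforward_sum:
  assumes "finite A" "{s. c s \<noteq> 0} \<subseteq> A"
  shows "pushforward p c t = (\<Sum>s\<in>A. if p s = t then c s else 0)"
proof -
  have "pushforward p c t = (\<Sum>s\<in>{s. c s \<noteq> 0 \<and> p s = t}. if p s = t then c s else 0)"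
    unfolding pushforward_def by (rule sum.cong) auto
  also have "\<dots> = (\<Sum>s\<in>A. if p s = t then c s else 0)"
    by (rule sum.mono_neutral_left) (use assms in auto)
  finally show ?thesis .
qed

lemma pushforward_add:
  fixes c c' :: "'s \<Rightarrow> 'k::field"
  assumes "finite {s. c s \<noteq> 0}" "finite {s. c' s \<noteq> 0}"
  shows "pushforward p (\<lambda>s. c s + c' s) = (\<lambda>t. pushforward p c t + pushforward p c' t)"
proof
  fix t
  let ?A = "{s. c s \<noteq> 0} \<union> {s. c' s \<noteq> 0}"
  have A: "finite ?A" using assms by auto
  show "pushforward p (\<lambda>s. c s + c' s) t = pushforward p c t + pushforward p c' t"
    by (subst (1 2 3) pushforward_sum[OF A]) (auto simp: sum.distrib[symmetric] intro!: sum.cong)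
qed

lemma pushforward_diff:
  fixes c c' :: "'s \<Rightarrow> 'k::field"
  assumes "finite {s. c s \<noteq> 0}" "finite {s. c' s \<noteq> 0}"
  shows "pushforward p (\<lambda>s. c s - c' s) = (\<lambda>t. pushforward p c t - pushforward p c' t)"
proof
  fix t
  let ?A = "{s. c s \<noteq> 0} \<union> {s. c' s \<noteq> 0}"
  have A: "finite ?A" using assms by auto
  show "pushforward p (\<lambda>s. c s - c' s) t = pushforward p c t - pushforward p c' t"
    by (subst (1 2 3) pushforward_sum[OF A]) (auto simp: sum_subtractf[symmetric] intro!: sum.cong)
qed

lemma pushforward_smult:
  fixes c :: "'s \<Rightarrow> 'k::field"
  assumes "finite {s. c s \<noteq> 0}"
  shows "pushforward p (\<lambda>s. a * c s) = (\<lambda>t. a * pushforward p c t)"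
proof
  fix t
  show "pushforward p (\<lambda>s. a * c s) t = a * pushforward p c t"
    by (subst (1 2) pushforward_sum[OF assms]) (auto simp: sum_distrib_left intro!: sum.cong)
qed

lemma pushforward_zero [simp]: "pushforward p (\<lambda>s. 0) = (\<lambda>t. 0)"
  by (simp add: pushforward_def)

lemma pushforward_delta: "pushforward p (delta a k) = delta (p a) k"
proof
  fix t show "pushforward p (delta a k) t = delta (p a) k t"
    by (subst pushforward_sum[of "{a}"]) (auto simp: delta_def)
qed

lemma pushforward_support: "{t. pushforward p c t \<noteq> 0} \<subseteq> p ` {s. c s \<noteq> 0}"
proof
  fix t assume "t \<in> {t. pushforward p c t \<noteq> 0}"
  moreover have "pushforward p c t = 0" if "{s. c s \<noteq> 0 \<and> p s = t} = {}"
    unfolding pushforward_def that by simp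
  ultimately show "t \<in> p ` {s. c s \<noteq> 0}" by blast
qed

lemma finite_support_pushforward:
  "finite {s. c s \<noteq> 0} \<Longrightarrow> finite {t. pushforward p c t \<noteq> 0}"
  by (rule finite_subset[OF pushforward_support]) auto

lemma pushforward_carrier:
  assumes "c \<in> carrier (free_module A)" "p ` A \<subseteq> B"
  shows "pushforward p c \<in> carrier (free_module B)"
  using assms finite_support_pushforward[of c p] pushforward_support[of p c] by force

lemma pushforward_cong:
  assumes "\<And>s. c s \<noteq> 0 \<Longrightarrow> p s = q s"
  shows "pushforward p c = pushforward q c"
proof -
  have "{s. c s \<noteq> 0 \<and> p s = t} = {s. c s \<noteq> 0 \<and> q s = t}" for t using assms by auto
  then show ?thesis unfolding pushforward_def by simp
qed

text \<open>Finite support matters: a sum over an infinite fibre is 0 by default, and the iterated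
  and the direct sum could disagree.\<close>

lemma pushforward_comp:
  fixes c :: "'s \<Rightarrow> 'k::field"
  assumes "finite {s. c s \<noteq> 0}"
  shows "pushforward q (pushforward p c) = pushforward (\<lambda>s. q (p s)) c"
proof -
  have "c \<in> carrier (free_module UNIV)" using assms by simp
  then show ?thesis
  proof (induction rule: free_module_induct)
    case (add c a k)
    then have f: "finite {s. c s \<noteq> 0}" by simp
    show ?case
      using add by (simp add: pushforward_add pushforward_delta finite_support_pushforward f)
  qed simp
qed

lemma pushforward_inj:
  assumes "inj_on p A" "{s. c s \<noteq> 0} \<subseteq> A" "a \<in> A"
  shows "pushforward p c (p a) = c a"
proof -
  have "{s. c s \<noteq> 0 \<and> p s = p a} = (if c a \<noteq> 0 then {a} else {})"
    using assms by (auto simp: inj_on_def)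
  then show ?thesis by (auto simp: pushforward_def split: if_splits)
qed

lemma pushforward_id [simp]: "pushforward (\<lambda>s. s) c = c"
proof
  fix t
  show "pushforward (\<lambda>s. s) c t = c t"
    using pushforward_inj[of "\<lambda>s. s" UNIV c t] by simp
qed

lemma pushforward_linear:
  assumes "p ` A \<subseteq> B"
  shows "pushforward p \<in> linear_maps (free_module A) (free_module B :: ('k::field, _) module)"
proof -
  have 1: "pushforward p \<in> carrier (free_module A) \<rightarrow> carrier (free_module B :: ('k::field, _) module)"
    using pushforward_carrier[OF _ assms] by blast
  show ?thesis
    unfolding linear_maps_def using 1 by (auto simp: pushforward_add pushforward_smult)
qed


section \<open>Persistence modules up to observable isomorphism\<close>

definition persistence_module :: "('k, 'v) persmod \<Rightarrow> bool" where
  "persistence_module V \<longleftrightarrow>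
     (\<forall>r. \<forall>x\<in>carrier (pm_space V r). \<forall>y\<in>carrier (pm_space V r).
        x \<oplus>\<^bsub>pm_space V r\<^esub> y \<in> carrier (pm_space V r)) \<and>
     (\<forall>r a. \<forall>x\<in>carrier (pm_space V r). a \<odot>\<^bsub>pm_space V r\<^esub> x \<in> carrier (pm_space V r)) \<and>
     (\<forall>r s. s \<le> r \<longrightarrow> pm_map V r s \<in> linear_maps (pm_space V r) (pm_space V s)) \<and>
     (\<forall>r. \<forall>x\<in>carrier (pm_space V r). pm_map V r r x = x) \<and>
     (\<forall>r s t. t \<le> s \<and> s \<le> r \<longrightarrow> (\<forall>x\<in>carrier (pm_space V r). pm_map V s t (pm_map V r s x) = pm_map V r t x))"

lemma persistence_moduleD:
  assumes "persistence_module V"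
  shows "x \<in> carrier (pm_space V r) \<Longrightarrow> y \<in> carrier (pm_space V r) \<Longrightarrow>
        x \<oplus>\<^bsub>pm_space V r\<^esub> y \<in> carrier (pm_space V r)"
    "x \<in> carrier (pm_space V r) \<Longrightarrow> a \<odot>\<^bsub>pm_space V r\<^esub> x \<in> carrier (pm_space V r)"
    "s \<le> r \<Longrightarrow> pm_map V r s \<in> linear_maps (pm_space V r) (pm_space V s)"
    "s \<le> r \<Longrightarrow> x \<in> carrier (pm_space V r) \<Longrightarrow> pm_map V r s x \<in> carrier (pm_space V s)"
    "x \<in> carrier (pm_space V r) \<Longrightarrow> pm_map V r r x = x"
    "t \<le> s \<Longrightarrow> s \<le> r \<Longrightarrow> x \<in> carrier (pm_space V r) \<Longrightarrow> pm_map V s t (pm_map V r s x) = pm_map V r t x"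
  using assms unfolding persistence_module_def linear_maps_def by blast+

lemma linear_mapsD:
  assumes "g \<in> linear_maps M N"
  shows "x \<in> carrier M \<Longrightarrow> g x \<in> carrier N"
    "x \<in> carrier M \<Longrightarrow> y \<in> carrier M \<Longrightarrow> g (x \<oplus>\<^bsub>M\<^esub> y) = g x \<oplus>\<^bsub>N\<^esub> g y"
    "x \<in> carrier M \<Longrightarrow> g (a \<odot>\<^bsub>M\<^esub> x) = a \<odot>\<^bsub>N\<^esub> g x"
  using assms unfolding linear_maps_def by blast+

lemma linear_maps_comp:
  "g \<in> linear_maps M N \<Longrightarrow> h \<in> linear_maps N P \<Longrightarrow> (\<lambda>x. h (g x)) \<in> linear_maps M P"
  unfolding linear_maps_def by (auto simp: Pi_iff)

lemma obs_morphismsD: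
  assumes "\<phi> \<in> obs_morphisms V W"
  shows "s < r \<Longrightarrow> \<phi> r s \<in> linear_maps (pm_space V r) (pm_space W s)"
    "s < r \<Longrightarrow> x \<in> carrier (pm_space V r) \<Longrightarrow> \<phi> r s x \<in> carrier (pm_space W s)"
    "s' \<le> s \<Longrightarrow> s < r \<Longrightarrow> r \<le> r' \<Longrightarrow> x \<in> carrier (pm_space V r') \<Longrightarrow>
       pm_map W s s' (\<phi> r s (pm_map V r' r x)) = \<phi> r' s' x"
  using assms unfolding obs_morphisms_def linear_maps_def by blast+

lemma obs_morphisms_pre:
  assumes "\<phi> \<in> obs_morphisms V W" "persistence_module V" "persistence_module W"
    and "s < r" "r \<le> r'" "x \<in> carrier (pm_space V r')"
  shows "\<phi> r s (pm_map V r' r x) = \<phi> r' s x"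
  using obs_morphismsD(3)[OF assms(1) order_refl assms(4,5,6)]
    persistence_moduleD(5)[OF assms(3)] obs_morphismsD(2)[OF assms(1,4)]
    persistence_moduleD(4)[OF assms(2) assms(5,6)] by simp

lemma obs_morphisms_post:
  assumes "\<phi> \<in> obs_morphisms V W" "persistence_module V"
    and "s' \<le> s" "s < r" "x \<in> carrier (pm_space V r)"
  shows "pm_map W s s' (\<phi> r s x) = \<phi> r s' x"
  using obs_morphismsD(3)[OF assms(1) assms(3,4) order_refl assms(5)]
    persistence_moduleD(5)[OF assms(2) assms(5)] by simp

text \<open>The midpoint is an arbitrary intermediate level. Lowering the intermediate level inserts
  a structure map of \<open>W\<close>, which \<phi> absorbs on its target side and \<psi> on its
  source side, so the composite does not depend on the level.\<close>

lemma obs_morphisms_comp: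
  assumes V: "persistence_module V" and W: "persistence_module W" and Z: "persistence_module Z"
    and p: "\<phi> \<in> obs_morphisms V W" and q: "\<psi> \<in> obs_morphisms W Z"
  defines "\<xi> \<equiv> (\<lambda>r t x. \<psi> ((r + t) / 2) t (\<phi> r ((r + t) / 2) x))"
  shows "\<xi> \<in> obs_morphisms V Z"
    and "\<And>r s t x. t < s \<Longrightarrow> s < r \<Longrightarrow> x \<in> carrier (pm_space V r) \<Longrightarrow> \<xi> r t x = \<psi> s t (\<phi> r s x)"
proof -
  have down: "\<psi> m t (\<phi> r m x) = \<psi> m' t (\<phi> r m' x)"
    if "t < m'" "m' \<le> m" "m < r" "x \<in> carrier (pm_space V r)" for t m m' r x
  proof -
    have "\<psi> m' t (\<phi> r m' x) = \<psi> m' t (pm_map W m m' (\<phi> r m x))"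
      using obs_morphisms_post[OF p V that(2,3,4)] by simp
    also have "\<dots> = \<psi> m t (\<phi> r m x)"
      using obs_morphisms_pre[OF q W Z that(1,2)] obs_morphismsD(2)[OF p that(3,4)] by simp
    finally show ?thesis by simp
  qed
  show eq: "\<xi> r t x = \<psi> s t (\<phi> r s x)"
    if "t < s" "s < r" "x \<in> carrier (pm_space V r)" for r s t x
  proof (cases "s \<le> (r + t) / 2")
    case True
    then show ?thesis unfolding \<xi>_def using that by (intro down) auto
  next
    case False
    then show ?thesis unfolding \<xi>_def using that by (intro down[symmetric]) auto
  qed
  have lin: "\<xi> r t \<in> linear_maps (pm_space V r) (pm_space Z t)" if "t < r" for r t
    unfolding \<xi>_def
    by (rule linear_maps_comp[of _ _ "pm_space W ((r + t) / 2)"])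
       (use that in \<open>auto intro!: obs_morphismsD(1)[OF p] obs_morphismsD(1)[OF q]\<close>)
  have "pm_map Z s s' (\<xi> r s (pm_map V r' r x)) = \<xi> r' s' x"
    if "s' \<le> s" "s < r" "r \<le> r'" "x \<in> carrier (pm_space V r')" for r' r s s' x
  proof -
    let ?m = "(r + s) / 2"
    have m: "s < ?m" "?m < r" "s' < ?m" "?m < r'" using that by auto
    have xr: "pm_map V r' r x \<in> carrier (pm_space V r)"
      by (rule persistence_moduleD(4)[OF V that(3,4)])
    have "pm_map Z s s' (\<xi> r s (pm_map V r' r x)) = pm_map Z s s' (\<psi> ?m s (\<phi> r' ?m x))"
      using eq[OF m(1,2) xr] obs_morphisms_pre[OF p V W m(2) that(3,4)] by simp
    also have "\<dots> = \<psi> ?m s' (\<phi> r' ?m x)"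
      by (rule obs_morphisms_post[OF q W that(1) m(1) obs_morphismsD(2)[OF p m(4) that(4)]])
    also have "\<dots> = \<xi> r' s' x" using eq[OF m(3,4) that(4)] by simp
    finally show ?thesis .
  qed
  then show "\<xi> \<in> obs_morphisms V Z"
    unfolding obs_morphisms_def using lin by blast
qed

lemma same_barcode_sym: "same_barcode V W \<Longrightarrow> same_barcode W V"
  unfolding same_barcode_def by blast

lemma same_barcode_trans:
  assumes V: "persistence_module V" and W: "persistence_module W" and Z: "persistence_module Z"
    and "same_barcode V W" "same_barcode W Z"
  shows "same_barcode V Z"
proof -
  obtain \<phi> \<psi> where p: "\<phi> \<in> obs_morphisms V W" "\<psi> \<in> obs_morphisms W V"
    and pq: "\<And>r s t x. t < s \<Longrightarrow> s < r \<Longrightarrow> x \<in> carrier (pm_space V r) \<Longrightarrow> \<psi> s t (\<phi> r s x) = pm_map V r t x"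
     "\<And>r s t x. t < s \<Longrightarrow> s < r \<Longrightarrow> x \<in> carrier (pm_space W r) \<Longrightarrow> \<phi> s t (\<psi> r s x) = pm_map W r t x"
    using assms(4) unfolding same_barcode_def by blast
  obtain \<phi>' \<psi>' where p': "\<phi>' \<in> obs_morphisms W Z" "\<psi>' \<in> obs_morphisms Z W"
    and pq': "\<And>r s t x. t < s \<Longrightarrow> s < r \<Longrightarrow> x \<in> carrier (pm_space W r) \<Longrightarrow> \<psi>' s t (\<phi>' r s x) = pm_map W r t x"
     "\<And>r s t x. t < s \<Longrightarrow> s < r \<Longrightarrow> x \<in> carrier (pm_space Z r) \<Longrightarrow> \<phi>' s t (\<psi>' r s x) = pm_map Z r t x"
    using assms(5) unfolding same_barcode_def by blast
  \<comment> \<open>One statement for both round trips; it is instantiated twice, with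
    \<open>V\<close> and \<open>Z\<close> exchanged.\<close>
  have comp_inv: "\<xi>' s t (\<xi> r s x) = pm_map V' r t x"
    if V': "persistence_module V'" and W': "persistence_module W'" and Z': "persistence_module Z'"
      and a: "\<alpha> \<in> obs_morphisms V' W'" "\<alpha>' \<in> obs_morphisms W' V'"
      and b: "\<beta> \<in> obs_morphisms W' Z'" "\<beta>' \<in> obs_morphisms Z' W'"
      and ab: "\<And>r s t x. t < s \<Longrightarrow> s < r \<Longrightarrow> x \<in> carrier (pm_space V' r) \<Longrightarrow> \<alpha>' s t (\<alpha> r s x) = pm_map V' r t x"
        "\<And>r s t x. t < s \<Longrightarrow> s < r \<Longrightarrow> x \<in> carrier (pm_space W' r) \<Longrightarrow> \<beta>' s t (\<beta> r s x) = pm_map W' r t x"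
      and chi: "\<xi> = (\<lambda>r t x. \<beta> ((r + t) / 2) t (\<alpha> r ((r + t) / 2) x))"
        "\<xi>' = (\<lambda>r t x. \<alpha>' ((r + t) / 2) t (\<beta>' r ((r + t) / 2) x))"
      and rst: "t < s" "s < r" "x \<in> carrier (pm_space V' r)"
    for V' :: "('x, 'u) persmod" and W' :: "('x, 'v) persmod" and Z' :: "('x, 'w) persmod"
      and \<alpha> \<alpha>' \<beta> \<beta>' \<xi> \<xi>' r s t x
  proof -
    \<comment> \<open>Two midpoints occur, one on each side of s. The inner pair cancels to a
      structure map of \<open>W'\<close> between them, and the outer inverse absorbs that
      map.\<close>
    let ?m = "(r + s) / 2" and ?n = "(s + t) / 2"
    have o: "?m < r" "s < ?m" "?n < s" "t < ?n" "?n < ?m" using rst by auto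
    have x1: "\<alpha> r ?m x \<in> carrier (pm_space W' ?m)"
      using obs_morphismsD(2)[OF a(1)] o rst by blast
    have "\<xi>' s t (\<xi> r s x) = \<alpha>' ?n t (\<beta>' s ?n (\<beta> ?m s (\<alpha> r ?m x)))"
      by (simp add: chi)
    also have "\<dots> = \<alpha>' ?n t (pm_map W' ?m ?n (\<alpha> r ?m x))" using ab(2) o x1 by simp
    also have "\<dots> = \<alpha>' ?m t (\<alpha> r ?m x)"
      by (rule obs_morphisms_pre[OF a(2) W' V' o(4) _ x1]) (use o in auto)
    also have "\<dots> = pm_map V' r t x" using ab(1) o rst by auto
    finally show ?thesis .
  qed
  show ?thesis
    unfolding same_barcode_def
  proof (intro bexI allI impI conjI ballI)
    show "(\<lambda>r t x. \<phi>' ((r + t) / 2) t (\<phi> r ((r + t) / 2) x)) \<in> obs_morphisms V Z"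
      by (rule obs_morphisms_comp[OF V W Z p(1) p'(1)])
    show "(\<lambda>r t x. \<psi> ((r + t) / 2) t (\<psi>' r ((r + t) / 2) x)) \<in> obs_morphisms Z V"
      by (rule obs_morphisms_comp[OF Z W V p'(2) p(2)])
  qed (auto intro!: comp_inv[OF V W Z p p' pq(1) pq'(1) refl refl]
        comp_inv[OF Z W V p'(2,1) p(2,1) pq'(2) pq(2) refl refl])
qed

text \<open>A strict isomorphism becomes an observable one by following it with structure maps. Its
  inverse is linear and natural because preimages are unique.\<close>

lemma same_barcode_strict:
  assumes V: "persistence_module V" and W: "persistence_module W"
    and lin: "\<And>r. F r \<in> linear_maps (pm_space V r) (pm_space W r)"
    and bij: "\<And>r. bij_betw (F r) (carrier (pm_space V r)) (carrier (pm_space W r))"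
    and nat: "\<And>r s x. s \<le> r \<Longrightarrow> x \<in> carrier (pm_space V r) \<Longrightarrow> F s (pm_map V r s x) = pm_map W r s (F r x)"
  shows "same_barcode V W"
proof -
  define G where "G r = inv_into (carrier (pm_space V r)) (F r)" for r
  have FG: "F r (G r y) = y" and Gc: "G r y \<in> carrier (pm_space V r)"
    if "y \<in> carrier (pm_space W r)" for r y
    using that bij[of r] unfolding G_def bij_betw_def by (auto simp: f_inv_into_f inv_into_into)
  have GF: "G r (F r x) = x" if "x \<in> carrier (pm_space V r)" for r x
    using that bij[of r] unfolding G_def bij_betw_def by (auto simp: inv_into_f_f)
  have Gu: "G r y = x" if "x \<in> carrier (pm_space V r)" "F r x = y" for r x y
    using GF that by blast
  have Glin: "G r \<in> linear_maps (pm_space W r) (pm_space V r)" for r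
    unfolding linear_maps_def
    by (auto simp: Gc FG persistence_moduleD(1,2)[OF V] linear_mapsD[OF lin] intro!: Gu)
  have Gnat: "G s (pm_map W r s y) = pm_map V r s (G r y)"
    if "s \<le> r" "y \<in> carrier (pm_space W r)" for r s y
    using that by (intro Gu) (auto simp: nat Gc FG persistence_moduleD(4)[OF V])
  have Fc: "F r x \<in> carrier (pm_space W r)" if "x \<in> carrier (pm_space V r)" for r x
    using linear_mapsD(1)[OF lin that] .
  note VD = persistence_moduleD[OF V] and WD = persistence_moduleD[OF W]
  have 1: "(\<lambda>r s x. pm_map W r s (F r x)) \<in> obs_morphisms V W"
    unfolding obs_morphisms_def
  proof (intro CollectI conjI allI impI ballI)
    fix r s :: real assume "s < r"
    then show "(\<lambda>x. pm_map W r s (F r x)) \<in> linear_maps (pm_space V r) (pm_space W s)"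
      by (intro linear_maps_comp[OF lin WD(3)]) simp
  next
    fix r' r s s' x assume h: "s' \<le> s \<and> s < r \<and> r \<le> r'" "x \<in> carrier (pm_space V r')"
    then show "pm_map W s s' (pm_map W r s (F r (pm_map V r' r x))) = pm_map W r' s' (F r' x)"
      by (simp add: nat WD Fc)
  qed
  have 2: "(\<lambda>r s x. pm_map V r s (G r x)) \<in> obs_morphisms W V"
    unfolding obs_morphisms_def
  proof (intro CollectI conjI allI impI ballI)
    fix r s :: real assume "s < r"
    then show "(\<lambda>x. pm_map V r s (G r x)) \<in> linear_maps (pm_space W r) (pm_space V s)"
      by (intro linear_maps_comp[OF Glin VD(3)]) simp
  next
    fix r' r s s' x assume h: "s' \<le> s \<and> s < r \<and> r \<le> r'" "x \<in> carrier (pm_space W r')"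
    then show "pm_map V s s' (pm_map V r s (G r (pm_map W r' r x))) = pm_map V r' s' (G r' x)"
      by (simp add: Gnat VD Gc)
  qed
  show ?thesis
    unfolding same_barcode_def
    by (rule bexI[OF _ 1], rule bexI[OF _ 2]) (auto simp: Gnat nat VD WD Gc Fc FG GF)
qed


section \<open>Interval modules with given ends\<close>

definition interval_module :: "'i set \<Rightarrow> ('i \<Rightarrow> real set) \<Rightarrow> ('k::field, 'i \<Rightarrow> 'k) persmod" where
  "interval_module I J =
     \<lparr>pm_space = (\<lambda>r. free_module {i \<in> I. r \<in> J i}),
      pm_map = (\<lambda>r s c i. if i \<in> I \<and> s \<in> J i then c i else 0)\<rparr>"

lemma interval_module_simps [simp]:
  "pm_space (interval_module I J) r = free_module {i \<in> I. r \<in> J i}"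
  "pm_map (interval_module I J) r s c = (\<lambda>i. if i \<in> I \<and> s \<in> J i then c i else 0)"
  by (auto simp: interval_module_def)

lemma bars_module_eq: "bars_module bs = interval_module {..<length bs} (\<lambda>i. bar_interval (bs ! i))"
  by (auto simp: bars_module_def interval_module_def alive_def)

text \<open>The ends of an interval without the decision whether they belong to it: the interior is
  contained in \<open>J\<close>, and \<open>J\<close> in the closure. Lifetimes of eldest points
  contain the death and omit the birth, bars of Alg do the opposite, so this is their common
  ground.\<close>

definition has_ends :: "real set \<Rightarrow> bar \<Rightarrow> bool" where
  "has_ends J B \<longleftrightarrow> (\<forall>r. fst B < ereal r \<and> r < snd B \<longrightarrow> r \<in> J) \<and>
     (\<forall>r\<in>J. fst B \<le> ereal r \<and> r \<le> snd B)"

text \<open>A level strictly between two members is interior, hence common to all intervals with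
  these ends.\<close>

lemma has_ends_between:
  assumes "has_ends J B" "has_ends J' B" "r \<in> J" "t \<in> J" "t < s" "s < r"
  shows "s \<in> J'"
proof -
  have "fst B \<le> ereal t" "r \<le> snd B" using assms unfolding has_ends_def by auto
  then have "fst B < ereal s" "s < snd B" using assms by (auto intro: le_less_trans)
  then show ?thesis using assms unfolding has_ends_def by auto
qed

lemma persistence_module_interval:
  assumes "\<And>i. i \<in> I \<Longrightarrow> has_ends (J i) (e i)"
  shows "persistence_module (interval_module I J)"
proof -
  have conv: "s \<in> J i" if "i \<in> I" "r \<in> J i" "t \<in> J i" "t \<le> s" "s \<le> r" for i r s t
    using has_ends_between[OF assms assms, OF that(1) that(1) that(2,3)] that
    by (cases "s = t"; cases "s = r") auto
  have lin: "pm_map (interval_module I J) r s \<in>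
      linear_maps (pm_space (interval_module I J) r) (pm_space (interval_module I J) s)" for r s
    unfolding linear_maps_def by (auto simp: fun_eq_iff intro: finite_support_restrict)
  show ?thesis
    unfolding persistence_module_def
  proof (intro conjI allI ballI impI)
    fix r s t and x :: "'a \<Rightarrow> 'b"
    assume h: "t \<le> s \<and> s \<le> r" "x \<in> carrier (pm_space (interval_module I J) r)"
    have "s \<in> J i" if "i \<in> I" "t \<in> J i" "x i \<noteq> 0" for i
      using conv[OF that(1), of r t s] h that by auto
    then show "pm_map (interval_module I J) s t (pm_map (interval_module I J) r s x) = pm_map (interval_module I J) r t x"
      by (auto simp: fun_eq_iff)
  qed (use free_module_closed lin in \<open>auto simp: fun_eq_iff simp del: free_module_simps\<close>, auto)
qed

text \<open>Coordinates are transported along \<pi> and truncated at the target level. Because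
  morphisms strictly lower the level, differences in the treatment of the ends are
  invisible.\<close>

lemma same_barcode_interval_modules:
  assumes bij: "bij_betw \<pi> I I'"
    and e: "\<And>i. i \<in> I \<Longrightarrow> has_ends (J i) (e i)" "\<And>i. i \<in> I \<Longrightarrow> has_ends (J' (\<pi> i)) (e i)"
  shows "same_barcode (interval_module I J :: ('k::field, _) persmod) (interval_module I' J')"
proof -
  \<comment> \<open>Formulated for an index map from target to source, so that \<pi> and its inverse
    are both instances.\<close>
  have mor: "(\<lambda>r s c j. if j \<in> B \<and> s \<in> K' j then c (\<rho> j) else 0) \<in>
      obs_morphisms (interval_module A K :: ('k, 'x \<Rightarrow> 'k) persmod) (interval_module B K')"
    if inj: "inj_on \<rho> B" and im: "\<rho> ` B = A" and b: "\<And>j. j \<in> B \<Longrightarrow> has_ends (K' j) (b j)"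
      "\<And>j. j \<in> B \<Longrightarrow> has_ends (K (\<rho> j)) (b j)"
    for \<rho> :: "'y \<Rightarrow> 'x" and A B K K' b
  proof -
    have fin: "finite {j. (j \<in> B \<and> s \<in> K' j \<longrightarrow> c (\<rho> j) \<noteq> 0) \<and> j \<in> B \<and> s \<in> K' j}" if "finite {i. c i \<noteq> 0}" for c :: "'x \<Rightarrow> 'k" and s
      by (rule inj_on_finite[of \<rho> _ "{i. c i \<noteq> 0}"]) (use that inj in \<open>auto simp: inj_on_def\<close>)
    show ?thesis
      unfolding obs_morphisms_def
    proof (intro CollectI conjI allI impI ballI)
      fix r s :: real assume "s < r"
      show "(\<lambda>c j. if j \<in> B \<and> s \<in> K' j then c (\<rho> j) else 0) \<in>
        linear_maps (pm_space (interval_module A K :: ('k, _) persmod) r) (pm_space (interval_module B K') s)"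
        unfolding linear_maps_def using fin by (auto simp: fun_eq_iff)
    next
      fix r' r s s' and x :: "'x \<Rightarrow> 'k"
      assume h: "s' \<le> s \<and> s < r \<and> r \<le> r'" and x: "x \<in> carrier (pm_space (interval_module A K) r')"
      \<comment> \<open>A coordinate alive at both extreme levels r' and s' is alive at the levels
        between them, so the intermediate truncations remove nothing that the last one
        keeps.\<close>
      have "s \<in> K' j \<and> r \<in> K (\<rho> j)" if "j \<in> B" "s' \<in> K' j" "x (\<rho> j) \<noteq> 0" for j
      proof -
        have r': "r' \<in> K (\<rho> j)" using x that by auto
        have B: "fst (b j) \<le> ereal s'" "r' \<le> snd (b j)"
          using b[OF that(1)] that r' unfolding has_ends_def by auto
        have "s \<in> K' j"
        proof (cases "s = s'")
          case False
          then have "fst (b j) < ereal s" "s < snd (b j)" using B h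
            by (auto intro: le_less_trans)
          then show ?thesis using b(1)[OF that(1)] unfolding has_ends_def by auto
        qed (use that in auto)
        moreover have "r \<in> K (\<rho> j)"
        proof (cases "r = r'")
          case False
          then have "fst (b j) < ereal r" "r < snd (b j)" using B h
            by (auto intro: le_less_trans)
          then show ?thesis using b(2)[OF that(1)] unfolding has_ends_def by auto
        qed (use r' in auto)
        ultimately show ?thesis by simp
      qed
      then show "pm_map (interval_module B K') s s' (\<lambda>j. if j \<in> B \<and> s \<in> K' j then pm_map (interval_module A K) r' r x (\<rho> j) else 0)
          = (\<lambda>j. if j \<in> B \<and> s' \<in> K' j then x (\<rho> j) else 0)"
        using im by (auto simp: fun_eq_iff)
    qed
  qed
  define \<rho> where "\<rho> = inv_into I \<pi>"
  have rb: "bij_betw \<rho> I' I" unfolding \<rho>_def by (rule bij_betw_inv_into[OF bij])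
  have r1: "\<rho> (\<pi> i) = i" if "i \<in> I" for i using bij that unfolding \<rho>_def by (auto simp: bij_betw_def)
  have r2: "\<pi> (\<rho> j) = j" if "j \<in> I'" for j using bij that unfolding \<rho>_def by (auto simp: bij_betw_def f_inv_into_f)
  have rI: "\<rho> j \<in> I" if "j \<in> I'" for j using rb that unfolding bij_betw_def by auto
  have pI: "\<pi> i \<in> I'" if "i \<in> I" for i using bij that unfolding bij_betw_def by auto
  have 1: "(\<lambda>r s c j. if j \<in> I' \<and> s \<in> J' j then c (\<rho> j) else 0) \<in>
      obs_morphisms (interval_module I J :: ('k, _) persmod) (interval_module I' J')"
  proof (rule mor[of _ _ _ _ "\<lambda>j. e (\<rho> j)"])
    show "has_ends (J' j) (e (\<rho> j))" "has_ends (J (\<rho> j)) (e (\<rho> j))" if "j \<in> I'" for j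
      using e(1)[OF rI[OF that]] e(2)[OF rI[OF that]] r2[OF that] by simp_all
  qed (use rb in \<open>auto simp: bij_betw_def\<close>)
  have 2: "(\<lambda>r s c i. if i \<in> I \<and> s \<in> J i then c (\<pi> i) else 0) \<in>
      obs_morphisms (interval_module I' J' :: ('k, _) persmod) (interval_module I J)"
    by (rule mor[of _ _ _ _ e]) (use bij e in \<open>auto simp: bij_betw_def\<close>)
  show ?thesis
    unfolding same_barcode_def
  proof (rule bexI[OF _ 1], rule bexI[OF _ 2], intro allI impI conjI ballI)
    fix r s t :: real and x :: "'a \<Rightarrow> 'k"
    assume h: "t < s \<and> s < r" and x: "x \<in> carrier (pm_space (interval_module I J) r)"
    have "s \<in> J' (\<pi> i)" if "i \<in> I" "t \<in> J i" "x i \<noteq> 0" for i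
      using has_ends_between[OF e(1)[OF that(1)] e(2)[OF that(1)], of r t s] h x that by auto
    then show "(\<lambda>i. if i \<in> I \<and> t \<in> J i then (if \<pi> i \<in> I' \<and> s \<in> J' (\<pi> i) then x (\<rho> (\<pi> i)) else 0) else 0)
       = pm_map (interval_module I J) r t x"
      by (auto simp: fun_eq_iff r1 pI)
  next
    fix r s t :: real and y :: "'b \<Rightarrow> 'k"
    assume h: "t < s \<and> s < r" and y: "y \<in> carrier (pm_space (interval_module I' J') r)"
    have "s \<in> J (\<rho> j)" if "j \<in> I'" "t \<in> J' j" "y j \<noteq> 0" for j
      using has_ends_between[OF e(2)[OF rI[OF that(1)]] e(1)[OF rI[OF that(1)]], of r t s] h y that by (auto simp: r2)
    then show "(\<lambda>j. if j \<in> I' \<and> t \<in> J' j then (if \<rho> j \<in> I \<and> s \<in> J (\<rho> j) then y (\<pi> (\<rho> j)) else 0) else 0)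
       = pm_map (interval_module I' J') r t y"
      by (auto simp: fun_eq_iff r2 rI)
  qed
qed


text \<open>Its cardinality plays the part of a persistent Betti number. The inequality is weak at
  the death and strict at the birth, in accordance with the clusters \<open>{y. s < g x y}\<close>
  that contain a point higher than r.\<close>

definition long_bars :: "'i set \<Rightarrow> ('i \<Rightarrow> bar) \<Rightarrow> real \<Rightarrow> real \<Rightarrow> 'i set" where
  "long_bars I e s r = {i \<in> I. fst (e i) \<le> ereal s \<and> r < snd (e i)}"

text \<open>Only finitely many deaths are relevant, so some interval (s, u) contains none of them; a
  count at s then separates the deaths at u from the smaller ones.\<close>

lemma ereal_gap:
  fixes A :: "ereal set"
  assumes "finite A"
  shows "\<exists>s. s < u \<and> (\<forall>x\<in>A. x < ereal u \<longrightarrow> x \<le> ereal s)"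
  using assms(1)
proof (induction A)
  case empty
  show ?case by (rule exI[of _ "u - 1"]) simp
next
  case (insert x A)
  then obtain s where s: "s < u" "\<And>x. x\<in>A \<Longrightarrow> x < ereal u \<Longrightarrow> x \<le> ereal s" by blast
  show ?case
  proof (cases "x < ereal u")
    case True
    then obtain s' where s': "x < ereal s'" "s' < u" using ereal_dense2[of x "ereal u"] by auto
    have "max s s' < u" using s(1) s' by simp
    moreover have "x \<le> ereal (max s s')" using s' by (cases x) (auto simp: le_max_iff_disj)
    moreover have "y \<le> ereal (max s s')" if "y \<in> A" "y < ereal u" for y
      using s(2)[OF that] by (cases y) (auto simp: le_max_iff_disj)
    ultimately show ?thesis by blast
  next
    case False
    then show ?thesis using s by blast
  qed
qed

text \<open>The same separation for bars that never die: below all the finite deaths only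
  -\<infinity> is left.\<close>

lemma ereal_gap_bot:
  fixes A :: "ereal set" and u :: real
  assumes "finite A"
  shows "\<exists>s < u. \<forall>x\<in>A. x \<le> ereal s \<longrightarrow> x = -\<infinity>"
  using assms(1)
proof (induction A)
  case empty
  show ?case by (rule exI[of _ "u - 1"]) simp
next
  case (insert x A)
  then obtain s where s: "s < u" "\<And>x. x\<in>A \<Longrightarrow> x \<le> ereal s \<Longrightarrow> x = -\<infinity>" by blast
  show ?case
  proof (cases "x = -\<infinity>")
    case True
    then show ?thesis using s by blast
  next
    case False
    then obtain s' where s': "ereal s' < x" using ereal_dense2[of "-\<infinity>" x] by auto
    have "\<not> x \<le> ereal (min s s')" using s' by (cases x) (auto simp: le_max_iff_disj)
    moreover have "y = -\<infinity>" if "y \<in> A" "y \<le> ereal (min s s')" for y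
      using s(2)[OF that(1)] that(2) by (cases y) auto
    moreover have "min s s' < u" using s(1) by simp
    ultimately show ?thesis by blast
  qed
qed
text \<open>A second difference: raising r1 to b isolates the births equal to b, since none lies
  strictly between, and lowering s1 to s isolates the deaths equal to s1.\<close>

lemma long_bars_fibre:
  assumes "s < s1" "r1 < b"
    and b: "\<And>i. i \<in> long_bars I e s1 r1 \<Longrightarrow> b \<le> snd (e i)"
    and a: "\<And>i. i \<in> long_bars I e s1 r1 \<Longrightarrow> fst (e i) < ereal s1 \<Longrightarrow> fst (e i) \<le> ereal s"
  shows "{i \<in> I. e i = (ereal s1, b)} =
    (long_bars I e s1 r1 - long_bars I e s1 b) - (long_bars I e s r1 - long_bars I e s b)"
proof (intro equalityI subsetI)
  fix i assume "i \<in> {i \<in> I. e i = (ereal s1, b)}"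
  then show "i \<in> (long_bars I e s1 r1 - long_bars I e s1 b) - (long_bars I e s r1 - long_bars I e s b)"
    using assms(1,2) by (auto simp: long_bars_def)
next
  fix i assume i: "i \<in> (long_bars I e s1 r1 - long_bars I e s1 b) - (long_bars I e s r1 - long_bars I e s b)"
  then have iL: "i \<in> long_bars I e s1 r1" by simp
  have "snd (e i) = b" using i b[OF iL] by (force simp: long_bars_def)
  moreover have "\<not> fst (e i) < ereal s1"
  proof
    assume "fst (e i) < ereal s1"
    then show False using a[OF iL] i \<open>snd (e i) = b\<close> assms(2) by (auto simp: long_bars_def)
  qed
  ultimately show "i \<in> {i \<in> I. e i = (ereal s1, b)}" using i by (cases "e i") (auto simp: long_bars_def)
qed

lemma long_bars_fibre_bot:
  assumes "r1 < b"
    and b: "\<And>i. i \<in> long_bars I e s r1 \<Longrightarrow> b \<le> snd (e i)"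
    and a: "\<And>i. i \<in> long_bars I e s r1 \<Longrightarrow> fst (e i) = -\<infinity>"
  shows "{i \<in> I. e i = (-\<infinity>, b)} = long_bars I e s r1 - long_bars I e s b"
proof (intro equalityI subsetI)
  fix i assume "i \<in> {i \<in> I. e i = (-\<infinity>, b)}"
  then show "i \<in> long_bars I e s r1 - long_bars I e s b" using assms(1) by (auto simp: long_bars_def)
next
  fix i assume i: "i \<in> long_bars I e s r1 - long_bars I e s b"
  then have iL: "i \<in> long_bars I e s r1" by simp
  have "snd (e i) = b" using i b[OF iL] by (force simp: long_bars_def)
  then show "i \<in> {i \<in> I. e i = (-\<infinity>, b)}" using i a[OF iL] by (cases "e i") (auto simp: long_bars_def)
qed

text \<open>Multiplicities are finite differences of the counts. Counts with s < r see exactly the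
  nondegenerate bars, and the levels are chosen relative to the finitely many ends of both families
  at once, so that one choice serves both.\<close>

lemma card_fibre_eq:
  fixes e :: "'i \<Rightarrow> bar" and e' :: "'j \<Rightarrow> bar"
  assumes N: "\<And>s r. s < r \<Longrightarrow> finite (long_bars I e s r) \<and> finite (long_bars I' e' s r) \<and>
                card (long_bars I e s r) = card (long_bars I' e' s r)"
    and ab: "a < ereal b"
  shows "finite {i \<in> I. e i = (a, b)} \<and> finite {i \<in> I'. e' i = (a, b)} \<and>
         card {i \<in> I. e i = (a, b)} = card {i \<in> I'. e' i = (a, b)}"
proof -
  \<comment> \<open>For a bar that never dies, s1 is just some level below b, used to make the set
    of relevant ends finite.\<close>
  obtain s1 where s1: "s1 < b" "a \<noteq> -\<infinity> \<Longrightarrow> a = ereal s1"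
  proof (cases a)
    case (real x) show ?thesis by (rule that[of x]) (use real ab in simp_all)
  next
    case PInf then show ?thesis using ab by auto
  next
    case MInf show ?thesis by (rule that[of "b - 1"]) (use MInf in simp_all)
  qed
  obtain r0 where r0: "s1 < r0" "r0 < b" using dense[OF s1(1)] by auto
  let ?L = "long_bars I e" and ?L' = "long_bars I' e'"
  \<comment> \<open>All ends that can interfere. The set is finite although the index sets may be
    infinite, since \<open>long_bars\<close> is finite at s1 < r0.\<close>
  define E where "E = e ` ?L s1 r0 \<union> e' ` ?L' s1 r0"
  have fE: "finite E" using N[OF r0(1)] by (simp add: E_def)
  \<comment> \<open>The last birth below b, or r0 if there is none: no relevant birth lies strictly
    between r1 and b.\<close>
  define r1 where "r1 = Max (insert r0 {x \<in> snd ` E. x < b})"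
  have fin: "finite (insert r0 {x \<in> snd ` E. x < b})" using fE by simp
  have r1: "r0 \<le> r1" "r1 < b" using fin r0 unfolding r1_def by auto
  have gap: "b \<le> snd B" if "B \<in> E" "r1 < snd B" for B
  proof (rule ccontr)
    assume "\<not> b \<le> snd B"
    then have "snd B \<le> r1" unfolding r1_def using that(1) fin by (intro Max_ge) auto
    then show False using that(2) by simp
  qed
  have inE: "i \<in> ?L s r1 \<Longrightarrow> e i \<in> E \<and> b \<le> snd (e i)" "j \<in> ?L' s r1 \<Longrightarrow> e' j \<in> E \<and> b \<le> snd (e' j)"
    if "s \<le> s1" for i j s
  proof -
    have "?L s r1 \<subseteq> ?L s1 r0" "?L' s r1 \<subseteq> ?L' s1 r0"
      using that r1 by (auto simp: long_bars_def intro: order_trans[of _ "ereal s"])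
    then show "i \<in> ?L s r1 \<Longrightarrow> e i \<in> E \<and> b \<le> snd (e i)" "j \<in> ?L' s r1 \<Longrightarrow> e' j \<in> E \<and> b \<le> snd (e' j)"
      using gap[of "e i"] gap[of "e' j"] by (auto simp: E_def long_bars_def)
  qed
  have fA: "finite (fst ` E)" using fE by simp
  have sub: "?L t b \<subseteq> ?L t r1" "?L' t b \<subseteq> ?L' t r1" for t using r1 by (auto simp: long_bars_def)
  show ?thesis
  proof (cases "a = -\<infinity>")
    case True
    obtain s where s: "s < s1" "\<forall>x\<in>fst ` E. x \<le> ereal s \<longrightarrow> x = -\<infinity>" using ereal_gap_bot[OF fA, of s1] by auto
    have bot: "i \<in> ?L s r1 \<Longrightarrow> fst (e i) = -\<infinity>" "j \<in> ?L' s r1 \<Longrightarrow> fst (e' j) = -\<infinity>" for i j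
      using inE[of s] s by (auto simp: long_bars_def)
    have 1: "{i \<in> I. e i = (a, b)} = ?L s r1 - ?L s b"
      unfolding True by (rule long_bars_fibre_bot[OF r1(2) _ bot(1)]) (use inE(1)[of s] s(1) in auto)
    have 2: "{i \<in> I'. e' i = (a, b)} = ?L' s r1 - ?L' s b"
      unfolding True by (rule long_bars_fibre_bot[OF r1(2) _ bot(2)]) (use inE(2)[of s] s(1) in auto)
    have o: "s < r1" "s < b" using s r0 r1 by auto
    show ?thesis unfolding 1 2 using N[OF o(1)] N[OF o(2)] sub by (simp add: card_Diff_subset)
  next
    case False
    then have a: "a = ereal s1" using s1 by auto
    obtain s where s: "s < s1" "\<And>x. x \<in> fst ` E \<Longrightarrow> x < ereal s1 \<Longrightarrow> x \<le> ereal s"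
      using ereal_gap[OF fA, of s1] by auto
    have 1: "{i \<in> I. e i = (a, b)} = (?L s1 r1 - ?L s1 b) - (?L s r1 - ?L s b)"
      unfolding a by (rule long_bars_fibre[OF s(1) r1(2)]) (use inE(1)[of s1] s(2) in auto)
    have 2: "{i \<in> I'. e' i = (a, b)} = (?L' s1 r1 - ?L' s1 b) - (?L' s r1 - ?L' s b)"
      unfolding a by (rule long_bars_fibre[OF s(1) r1(2)]) (use inE(2)[of s1] s(2) in auto)
    have o: "s < r1" "s < b" "s1 < r1" "s1 < b" using s r0 r1 by auto
    have sub2: "?L s r1 - ?L s b \<subseteq> ?L s1 r1 - ?L s1 b" "?L' s r1 - ?L' s b \<subseteq> ?L' s1 r1 - ?L' s1 b"
      using s(1) by (auto simp: long_bars_def intro: order_trans[of _ "ereal s"])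
    show ?thesis unfolding 1 2
      using N[OF o(1)] N[OF o(2)] N[OF o(3)] N[OF o(4)] sub sub2 by (simp add: card_Diff_subset finite_subset)
  qed
qed

text \<open>Fibres of equal finite size are in bijection, and the bijections are glued along the
  values of \<open>e\<close>; injectivity of \<open>t\<close> keeps different fibres apart.\<close>

lemma inj_of_card_fibres:
  assumes "\<And>i. i \<in> I \<Longrightarrow> finite {j \<in> I. e j = e i} \<and> finite {j \<in> I'. e' j = t (e i)} \<and>
              card {j \<in> I. e j = e i} = card {j \<in> I'. e' j = t (e i)}"
    and t: "inj_on t (e ` I)"
  shows "\<exists>\<pi>. inj_on \<pi> I \<and> \<pi> ` I = {j \<in> I'. e' j \<in> t ` e ` I} \<and> (\<forall>i\<in>I. e' (\<pi> i) = t (e i))"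
proof -
  have "\<forall>v\<in>e ` I. \<exists>h. bij_betw h {j \<in> I. e j = v} {j \<in> I'. e' j = t v}"
    using assms(1) finite_same_card_bij by blast
  then obtain h where h: "\<And>v. v \<in> e ` I \<Longrightarrow> bij_betw (h v) {j \<in> I. e j = v} {j \<in> I'. e' j = t v}"
    by metis
  define \<pi> where "\<pi> i = h (e i) i" for i
  have p: "\<pi> i \<in> I'" "e' (\<pi> i) = t (e i)" if "i \<in> I" for i
    using h[of "e i"] that unfolding \<pi>_def bij_betw_def by auto
  have "inj_on \<pi> I"
  proof (rule inj_onI)
    fix i j assume ij: "i \<in> I" "j \<in> I" "\<pi> i = \<pi> j"
    then have "t (e i) = t (e j)" using p by metis
    then have eq: "e i = e j" using t ij by (auto dest: inj_onD)
    have "inj_on (h (e i)) {j \<in> I. e j = e i}" using h[of "e i"] ij by (auto simp: bij_betw_def)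
    then show "i = j" using ij eq unfolding \<pi>_def inj_on_def by auto
  qed
  moreover have "\<pi> ` I = {j \<in> I'. e' j \<in> t ` e ` I}"
  proof (intro subset_antisym subsetI)
    fix j assume "j \<in> {j \<in> I'. e' j \<in> t ` e ` I}"
    then obtain i where i: "i \<in> I" "j \<in> I'" "e' j = t (e i)" by auto
    then have "j \<in> h (e i) ` {j \<in> I. e j = e i}" using h[of "e i"] by (auto simp: bij_betw_def)
    then obtain k where "k \<in> I" "e k = e i" "j = h (e i) k" by blast
    then have "j = \<pi> k" "k \<in> I" unfolding \<pi>_def by simp_all
    then show "j \<in> \<pi> ` I" by blast
  qed (use p in auto)
  ultimately show ?thesis using p by blast
qed

text \<open>Gluing gives an injection. It is onto because a value of \<open>e'\<close>, having
  positive multiplicity there, has the same multiplicity for \<open>e\<close>.\<close>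

lemma bij_of_long_bars:
  fixes e :: "'i \<Rightarrow> bar" and e' :: "'j \<Rightarrow> bar"
  assumes N: "\<And>s r. s < r \<Longrightarrow> finite (long_bars I e s r) \<and> finite (long_bars I' e' s r) \<and>
                card (long_bars I e s r) = card (long_bars I' e' s r)"
    and e: "\<And>i. i \<in> I \<Longrightarrow> fst (e i) < ereal (snd (e i))" "\<And>i. i \<in> I' \<Longrightarrow> fst (e' i) < ereal (snd (e' i))"
  shows "\<exists>\<pi>. bij_betw \<pi> I I' \<and> (\<forall>i\<in>I. e' (\<pi> i) = e i)"
proof -
  have fib: "finite {j \<in> I. e j = v} \<and> finite {j \<in> I'. e' j = v} \<and>
     card {j \<in> I. e j = v} = card {j \<in> I'. e' j = v}" if "fst v < ereal (snd v)" for v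
    using card_fibre_eq[of I e I' e' "fst v" "snd v", OF N that] by simp
  have "\<exists>\<pi>. inj_on \<pi> I \<and> \<pi> ` I = {j \<in> I'. e' j \<in> id ` e ` I} \<and> (\<forall>i\<in>I. e' (\<pi> i) = id (e i))"
    by (rule inj_of_card_fibres) (use fib e in auto)
  moreover have "e' j \<in> e ` I" if "j \<in> I'" for j
  proof -
    have "{i \<in> I'. e' i = e' j} \<noteq> {}" using that by auto
    then have "card {i \<in> I. e i = e' j} \<noteq> 0" using fib[OF e(2)[OF that]] by auto
    then show ?thesis by (metis (mono_tags, lifting) Collect_empty_eq card.empty image_eqI)
  qed
  ultimately have "\<exists>\<pi>. inj_on \<pi> I \<and> \<pi> ` I = I' \<and> (\<forall>i\<in>I. e' (\<pi> i) = e i)"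
    by (auto simp: Collect_conj_eq Int_absorb2 subset_iff cong: conj_cong)
  then show ?thesis unfolding bij_betw_def by blast
qed

lemma interval_module_same_barcode:
  fixes e :: "'i \<Rightarrow> bar" and e' :: "'j \<Rightarrow> bar"
  assumes "\<And>s r. s < r \<Longrightarrow> finite (long_bars I e s r) \<and> finite (long_bars I' e' s r) \<and>
                card (long_bars I e s r) = card (long_bars I' e' s r)"
    and "\<And>i. i \<in> I \<Longrightarrow> fst (e i) < ereal (snd (e i))" "\<And>i. i \<in> I' \<Longrightarrow> fst (e' i) < ereal (snd (e' i))"
    and J: "\<And>i. i \<in> I \<Longrightarrow> has_ends (J i) (e i)" "\<And>i. i \<in> I' \<Longrightarrow> has_ends (J' i) (e' i)"
  shows "same_barcode (interval_module I J :: ('k::field, _) persmod) (interval_module I' J')"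
proof -
  obtain \<pi> where p: "bij_betw \<pi> I I'" "\<forall>i\<in>I. e' (\<pi> i) = e i"
    using bij_of_long_bars[OF assms(1-3)] by blast
  have "has_ends (J' (\<pi> i)) (e i)" if "i \<in> I" for i
    using J(2)[of "\<pi> i"] p that by (auto simp: bij_betw_def)
  then show ?thesis using same_barcode_interval_modules[of \<pi> I I' J e J'] p(1) J(1) by blast
qed


section \<open>Direct limits of bars\<close>

text \<open>The operations of a direct limit are unions of germs, for which the laws are awkward to
  check directly; they are carried over from a known module along a natural linear
  surjection.\<close>

lemma persistence_module_transfer:
  assumes V: "persistence_module V"
    and lin: "\<And>r. G r \<in> linear_maps (pm_space V r) (pm_space W r)"
    and surj: "\<And>r. G r ` carrier (pm_space V r) = carrier (pm_space W r)"
    and nat: "\<And>r s x. s \<le> r \<Longrightarrow> x \<in> carrier (pm_space V r) \<Longrightarrow> pm_map W r s (G r x) = G s (pm_map V r s x)"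
  shows "persistence_module W"
proof -
  note VD = persistence_moduleD[OF V]
  have ex: "\<exists>u\<in>carrier (pm_space V r). x = G r u" if "x \<in> carrier (pm_space W r)" for x r
    using that surj[of r] by auto
  have add: "G r u \<oplus>\<^bsub>pm_space W r\<^esub> G r v = G r (u \<oplus>\<^bsub>pm_space V r\<^esub> v)"
    if "u \<in> carrier (pm_space V r)" "v \<in> carrier (pm_space V r)" for u v r
    using linear_mapsD(2)[OF lin that] by simp
  have sm: "a \<odot>\<^bsub>pm_space W r\<^esub> G r u = G r (a \<odot>\<^bsub>pm_space V r\<^esub> u)"
    if "u \<in> carrier (pm_space V r)" for u a r
    using linear_mapsD(3)[OF lin that] by simp
  have Gc: "G r u \<in> carrier (pm_space W r)" if "u \<in> carrier (pm_space V r)" for u r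
    using linear_mapsD(1)[OF lin that] .
  have lW: "pm_map W r s \<in> linear_maps (pm_space W r) (pm_space W s)" if "s \<le> r" for r s
    unfolding linear_maps_def
  proof (intro CollectI conjI ballI allI funcsetI)
    fix x assume "x \<in> carrier (pm_space W r)"
    then show "pm_map W r s x \<in> carrier (pm_space W s)"
      using ex[of x r] nat[OF that] Gc VD(4)[OF that] by auto
  next
    fix x y assume "x \<in> carrier (pm_space W r)" "y \<in> carrier (pm_space W r)"
    then obtain u v where u: "u \<in> carrier (pm_space V r)" "x = G r u" "v \<in> carrier (pm_space V r)" "y = G r v"
      using ex by metis
    then show "pm_map W r s (x \<oplus>\<^bsub>pm_space W r\<^esub> y) = pm_map W r s x \<oplus>\<^bsub>pm_space W s\<^esub> pm_map W r s y"
      by (simp add: add nat that VD(1,4) linear_mapsD(2)[OF VD(3)[OF that]])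
  next
    fix a x assume "x \<in> carrier (pm_space W r)"
    then obtain u where u: "u \<in> carrier (pm_space V r)" "x = G r u" using ex by metis
    then show "pm_map W r s (a \<odot>\<^bsub>pm_space W r\<^esub> x) = a \<odot>\<^bsub>pm_space W s\<^esub> pm_map W r s x"
      by (simp add: sm nat that VD(2,4) linear_mapsD(3)[OF VD(3)[OF that]])
  qed
  show ?thesis
    unfolding persistence_module_def
  proof (intro conjI allI ballI impI)
    fix r x y assume "x \<in> carrier (pm_space W r)" "y \<in> carrier (pm_space W r)"
    then show "x \<oplus>\<^bsub>pm_space W r\<^esub> y \<in> carrier (pm_space W r)"
      using ex[of x r] ex[of y r] by (auto simp: add Gc VD)
  next
    fix r a x assume "x \<in> carrier (pm_space W r)"
    then show "a \<odot>\<^bsub>pm_space W r\<^esub> x \<in> carrier (pm_space W r)"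
      using ex[of x r] by (auto simp: sm Gc VD)
  next
    fix r x assume "x \<in> carrier (pm_space W r)"
    then show "pm_map W r r x = x" using ex[of x r] by (auto simp: nat VD)
  next
    fix r s t x assume "t \<le> s \<and> s \<le> r" "x \<in> carrier (pm_space W r)"
    then show "pm_map W s t (pm_map W r s x) = pm_map W r t x"
      using ex[of x r] by (auto simp: nat VD)
  qed (rule lW)
qed

lemma transition_same [simp]: "transition \<phi> m m x = x"
  by (simp add: transition_def)

lemma transition_Suc: "m \<le> n \<Longrightarrow> transition \<phi> m (Suc n) x = \<phi> n (transition \<phi> m n x)"
  by (simp add: transition_def)

lemma transition_trans:
  assumes "m \<le> n" "n \<le> p"
  shows "transition \<phi> n p (transition \<phi> m n x) = transition \<phi> m p x"
  using assms(2,1) by (induction p rule: dec_induct) (simp_all add: transition_Suc)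

lemma transition_pushforward:
  fixes c :: "'s \<Rightarrow> 'k::field"
  assumes "m \<le> n" "finite {s. c s \<noteq> 0}"
  shows "transition (\<lambda>n. pushforward (\<sigma> n)) m n c = pushforward (transition \<sigma> m n) c"
  using assms(1)
  by (induction n rule: dec_induct) (simp_all add: transition_Suc pushforward_comp assms(2))

text \<open>The bound \<open>M\<close> makes the birth of a thread, which is a supremum of births, a
  real number.\<close>

locale bar_system =
  fixes bs :: "nat \<Rightarrow> bar list" and \<sigma> :: "nat \<Rightarrow> nat \<Rightarrow> nat" and M :: real
  assumes matching: "\<And>n. bar_matching (bs n) (bs (Suc n)) (\<sigma> n)"
    and bounded: "\<And>n i. i < length (bs n) \<Longrightarrow> snd (bs n ! i) \<le> M"
    and nondegenerate: "\<And>n i. i < length (bs n) \<Longrightarrow> fst (bs n ! i) < ereal (snd (bs n ! i))"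
begin

abbreviation "step \<equiv> transition \<sigma>"

lemma step_props:
  assumes "m \<le> n"
  shows "inj_on (step m n) {..<length (bs m)}"
    and "i < length (bs m) \<Longrightarrow> step m n i < length (bs n) \<and> fst (bs n ! step m n i) = fst (bs m ! i) \<and>
           bar_interval (bs m ! i) \<subseteq> bar_interval (bs n ! step m n i)"
proof -
  have "inj_on (step m n) {..<length (bs m)} \<and>
    (\<forall>i<length (bs m). step m n i < length (bs n) \<and> fst (bs n ! step m n i) = fst (bs m ! i) \<and>
           bar_interval (bs m ! i) \<subseteq> bar_interval (bs n ! step m n i))"
    using assms
  proof (induction n rule: dec_induct)
    case base
    then show ?case by (auto simp: inj_on_def)
  next
    case (step n)
    have "inj_on (\<sigma> n) {..<length (bs n)}" using matching[of n] by (simp add: bar_matching_def)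
    then have inj: "inj_on (transition \<sigma> m (Suc n)) {..<length (bs m)}"
      using step by (auto simp: inj_on_def transition_Suc)
    have nxt: "\<sigma> n j < length (bs (Suc n)) \<and> fst (bs (Suc n) ! \<sigma> n j) = fst (bs n ! j) \<and>
        bar_interval (bs n ! j) \<subseteq> bar_interval (bs (Suc n) ! \<sigma> n j)" if "j < length (bs n)" for j
      using matching[of n] that by (simp add: bar_matching_def)
    show ?case
    proof (intro conjI allI impI inj)
      fix i assume i: "i < length (bs m)"
      let ?j = "transition \<sigma> m n i"
      have j: "?j < length (bs n)" "fst (bs n ! ?j) = fst (bs m ! i)"
        "bar_interval (bs m ! i) \<subseteq> bar_interval (bs n ! ?j)" using step.IH i by auto
      have S: "transition \<sigma> m (Suc n) i = \<sigma> n ?j" using step.hyps by (simp add: transition_Suc)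
      show "transition \<sigma> m (Suc n) i < length (bs (Suc n))"
        "fst (bs (Suc n) ! transition \<sigma> m (Suc n) i) = fst (bs m ! i)"
        "bar_interval (bs m ! i) \<subseteq> bar_interval (bs (Suc n) ! transition \<sigma> m (Suc n) i)"
        unfolding S using nxt[OF j(1)] j by auto
    qed
  qed
  then show "inj_on (step m n) {..<length (bs m)}"
   "i < length (bs m) \<Longrightarrow> step m n i < length (bs n) \<and> fst (bs n ! step m n i) = fst (bs m ! i) \<and>
           bar_interval (bs m ! i) \<subseteq> bar_interval (bs n ! step m n i)" by auto
qed

text \<open>The birth of a nondegenerate bar belongs to \<open>bar_interval\<close>, so the
  inclusion of intervals can be tested at the birth.\<close>

lemma step_snd:
  assumes "m \<le> n" "i < length (bs m)"
  shows "snd (bs m ! i) \<le> snd (bs n ! step m n i)"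
proof -
  have "snd (bs m ! i) \<in> bar_interval (bs m ! i)"
    using nondegenerate[OF assms(2)] by (simp add: bar_interval_def)
  then have "snd (bs m ! i) \<in> bar_interval (bs n ! step m n i)" using step_props(2)[OF assms] by blast
  then show ?thesis by (simp add: bar_interval_def)
qed

text \<open>The class of (n, i) in the direct limit of the index sets of the bars.\<close>

definition thread :: "nat \<Rightarrow> nat \<Rightarrow> (nat \<times> nat) set" where
  "thread n i = {(m, j). j < length (bs m) \<and> (\<exists>p. m \<le> p \<and> n \<le> p \<and> step n p i = step m p j)}"

definition threads :: "(nat \<times> nat) set set" where
  "threads = {thread n i | n i. i < length (bs n)}"

definition thread_interval :: "(nat \<times> nat) set \<Rightarrow> real set" where
  "thread_interval \<theta> = (\<Union>(n, i)\<in>\<theta>. bar_interval (bs n ! i))"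

text \<open>All deaths along a thread coincide, so the first supremum is over one value; the births
  increase to the second supremum, which need not be attained.\<close>

definition thread_bar :: "(nat \<times> nat) set \<Rightarrow> bar" where
  "thread_bar \<theta> = ((SUP (n, i)\<in>\<theta>. fst (bs n ! i)), (SUP (n, i)\<in>\<theta>. snd (bs n ! i)))"

lemma step_later:
  assumes "step n p i = step m p j" "n \<le> p" "m \<le> p" "p \<le> q"
  shows "step n q i = step m q j"
  using assms transition_trans[of n p q \<sigma> i] transition_trans[of m p q \<sigma> j] by simp

lemma thread_self: "i < length (bs n) \<Longrightarrow> (n, i) \<in> thread n i"
  unfolding thread_def by auto

lemma thread_eqI:
  assumes "step n p i = step m p j" "n \<le> p" "m \<le> p"
  shows "thread n i = thread m j"
proof -
  have sub: "thread n i \<subseteq> thread m j" if "step n p i = step m p j" "n \<le> p" "m \<le> p" for n m i j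
  proof
    fix x assume "x \<in> thread n i"
    then obtain l k q where x: "x = (l, k)" "k < length (bs l)" "l \<le> q" "n \<le> q" "step n q i = step l q k"
      by (auto simp: thread_def)
    have "step n (max p q) i = step l (max p q) k" using step_later[OF x(5) x(4,3)] by simp
    moreover have "step n (max p q) i = step m (max p q) j" using step_later[OF that] by simp
    ultimately show "x \<in> thread m j" using x that unfolding thread_def
      by (auto intro!: exI[of _ "max p q"])
  qed
  show ?thesis using sub[OF assms] sub[OF assms(1)[symmetric] assms(3,2)] by blast
qed

lemma thread_mem: "(m, j) \<in> thread n i \<Longrightarrow> thread m j = thread n i"
proof -
  assume "(m, j) \<in> thread n i"
  then obtain p where "m \<le> p" "n \<le> p" "step n p i = step m p j" by (auto simp: thread_def)
  then show "thread m j = thread n i" using thread_eqI[of n p i m j] by simp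
qed

lemma thread_mem_length: "(m, j) \<in> thread n i \<Longrightarrow> j < length (bs m)"
  by (auto simp: thread_def)

lemma thread_step: "m \<le> n \<Longrightarrow> thread n (step m n i) = thread m i"
  by (rule thread_eqI[of _ n]) auto

text \<open>Matchings are injective, so bars of one stage never become identified later.\<close>

lemma inj_thread: "inj_on (thread n) {..<length (bs n)}"
proof (rule inj_onI)
  fix i j assume ij: "i \<in> {..<length (bs n)}" "j \<in> {..<length (bs n)}" "thread n i = thread n j"
  then have "(n, i) \<in> thread n j" using thread_self[of i n] by auto
  then obtain p where "n \<le> p" "step n p j = step n p i" by (auto simp: thread_def)
  then show "i = j" using step_props(1)[of n p] ij by (auto simp: inj_on_def)
qed

lemma thread_fst: "(m, j) \<in> thread n i \<Longrightarrow> i < length (bs n) \<Longrightarrow> fst (bs m ! j) = fst (bs n ! i)"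
proof -
  assume "(m, j) \<in> thread n i" and i: "i < length (bs n)"
  then obtain p where p: "m \<le> p" "n \<le> p" "step n p i = step m p j" "j < length (bs m)"
    by (auto simp: thread_def)
  show ?thesis using step_props(2)[OF p(1,4)] step_props(2)[OF p(2) i] p(3) by simp
qed

lemma thread_bar_fst: "i < length (bs n) \<Longrightarrow> fst (thread_bar (thread n i)) = fst (bs n ! i)"
proof -
  assume i: "i < length (bs n)"
  have "(\<lambda>(m, j). fst (bs m ! j)) ` thread n i = {fst (bs n ! i)}"
  proof (intro equalityI subsetI)
    fix a assume "a \<in> (\<lambda>(m, j). fst (bs m ! j)) ` thread n i"
    then show "a \<in> {fst (bs n ! i)}" using thread_fst[OF _ i] by auto
  next
    fix a assume "a \<in> {fst (bs n ! i)}"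
    then show "a \<in> (\<lambda>(m, j). fst (bs m ! j)) ` thread n i"
      using thread_self[OF i] by (auto intro: rev_image_eqI)
  qed
  then show ?thesis by (simp add: thread_bar_def)
qed

lemma thread_bar_less:
  assumes "i < length (bs n)"
  shows "r < snd (thread_bar (thread n i)) \<longleftrightarrow> (\<exists>(m, j)\<in>thread n i. r < snd (bs m ! j))"
proof -
  have "bdd_above ((\<lambda>(m, j). snd (bs m ! j)) ` thread n i)"
    using bounded[OF thread_mem_length] by (auto intro!: bdd_aboveI[of _ M])
  then show ?thesis
    using less_cSUP_iff[of "thread n i" "\<lambda>(m, j). snd (bs m ! j)" r] thread_self[OF assms]
    by (auto simp: thread_bar_def case_prod_unfold)
qed

lemma thread_bar_ge:
  assumes "(m, j) \<in> thread n i"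
  shows "snd (bs m ! j) \<le> snd (thread_bar (thread n i))"
proof -
  have "bdd_above ((\<lambda>(m, j). snd (bs m ! j)) ` thread n i)"
    using bounded[OF thread_mem_length] by (auto intro!: bdd_aboveI[of _ M])
  then show ?thesis using cSUP_upper[OF assms, of "\<lambda>(m, j). snd (bs m ! j)"] by (auto simp: thread_bar_def)
qed

lemma thread_has_ends:
  assumes "\<theta> \<in> threads"
  shows "has_ends (thread_interval \<theta>) (thread_bar \<theta>)" "fst (thread_bar \<theta>) < ereal (snd (thread_bar \<theta>))"
proof -
  obtain n i where t: "\<theta> = thread n i" and i: "i < length (bs n)" using assms by (auto simp: threads_def)
  show "has_ends (thread_interval \<theta>) (thread_bar \<theta>)"
    unfolding has_ends_def
  proof (intro conjI allI ballI impI)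
    fix r assume r: "fst (thread_bar \<theta>) < ereal r \<and> r < snd (thread_bar \<theta>)"
    then obtain m j where "(m, j) \<in> \<theta>" "r < snd (bs m ! j)" using thread_bar_less[OF i] t by auto
    then show "r \<in> thread_interval \<theta>"
      using r thread_bar_fst[OF i] thread_fst[OF _ i] t
      by (auto simp: thread_interval_def bar_interval_def intro!: bexI[of _ "(m, j)"])
  next
    fix r assume "r \<in> thread_interval \<theta>"
    then obtain m j where mj: "(m, j) \<in> \<theta>" "r \<in> bar_interval (bs m ! j)" by (auto simp: thread_interval_def)
    then show "fst (thread_bar \<theta>) \<le> ereal r" 
      using thread_bar_fst[OF i] thread_fst[OF _ i] t by (auto simp: bar_interval_def)
    show "r \<le> snd (thread_bar \<theta>)" 
      using thread_bar_ge[of m j n i] mj t by (auto simp: bar_interval_def)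
  qed
  show "fst (thread_bar \<theta>) < ereal (snd (thread_bar \<theta>))"
    using thread_bar_fst[OF i] t nondegenerate[OF i] thread_bar_ge[OF thread_self[OF i]]
    by (metis ereal_less_eq(3) less_le_trans)
qed

text \<open>The death is fixed along a thread, so its members differ only at their births, and below
  a level at which the bar is alive they all agree. This makes truncation commute with the passage
  to the limit.\<close>

lemma thread_interval_down:
  assumes "i < length (bs n)" "r \<in> bar_interval (bs n ! i)" "s \<le> r"
  shows "s \<in> thread_interval (thread n i) \<longleftrightarrow> s \<in> bar_interval (bs n ! i)"
proof
  assume "s \<in> thread_interval (thread n i)"
  then obtain m j where "(m, j) \<in> thread n i" "s \<in> bar_interval (bs m ! j)"
    by (auto simp: thread_interval_def)
  then show "s \<in> bar_interval (bs n ! i)"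
    using thread_fst[OF _ assms(1)] assms by (auto simp: bar_interval_def)
next
  assume "s \<in> bar_interval (bs n ! i)"
  then show "s \<in> thread_interval (thread n i)"
    unfolding thread_interval_def using thread_self[OF assms(1)] by (auto intro: rev_bexI)
qed

text \<open>The threads that are long at stage n form an increasing sequence of finite sets, which
  an eventually constant cardinality makes eventually constant. The strict inequality at the birth
  lets a single member witness that its thread is long.\<close>

lemma long_bars_threads:
  assumes K: "\<And>n. n0 \<le> n \<Longrightarrow> card (long_bars {..<length (bs n)} (\<lambda>i. bs n ! i) s r) = K"
  shows "finite (long_bars threads thread_bar s r) \<and> card (long_bars threads thread_bar s r) = K"
proof -
  define S where "S n = thread n ` long_bars {..<length (bs n)} (\<lambda>i. bs n ! i) s r" for n
  have fin: "finite (S n)" for n unfolding S_def long_bars_def by auto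
  have card: "card (S n) = K" if "n0 \<le> n" for n
    unfolding S_def using K[OF that]
    by (subst card_image) (auto intro: inj_on_subset[OF inj_thread] simp: long_bars_def)
  have mono: "S m \<subseteq> S n" if "m \<le> n" for m n
  proof
    fix \<theta> assume "\<theta> \<in> S m"
    then obtain i where i: "i < length (bs m)" "\<theta> = thread m i" "fst (bs m ! i) \<le> ereal s" "r < snd (bs m ! i)"
      by (auto simp: S_def long_bars_def)
    then have "step m n i \<in> long_bars {..<length (bs n)} (\<lambda>i. bs n ! i) s r"
      using step_props(2)[OF that i(1)] step_snd[OF that i(1)] by (auto simp: long_bars_def)
    then show "\<theta> \<in> S n" unfolding S_def using thread_step[OF that, of i] i by (metis imageI)
  qed
  have const: "S n \<subseteq> S n0" for n
  proof (cases "n \<le> n0")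
    case False
    then have "S n0 = S n" using card_subset_eq[OF fin mono] card by simp
    then show ?thesis by simp
  qed (rule mono)
  have "long_bars threads thread_bar s r = (\<Union>n. S n)"
  proof (intro subset_antisym subsetI)
    fix \<theta> assume t: "\<theta> \<in> long_bars threads thread_bar s r"
    then obtain n i where i: "\<theta> = thread n i" "i < length (bs n)" by (auto simp: long_bars_def threads_def)
    then obtain m j where mj: "(m, j) \<in> thread n i" "r < snd (bs m ! j)" "fst (bs n ! i) \<le> ereal s"
      using t thread_bar_less[OF i(2), of r] thread_bar_fst[OF i(2)] by (auto simp: long_bars_def)
    then have "j \<in> long_bars {..<length (bs m)} (\<lambda>i. bs m ! i) s r"
      using thread_fst[OF mj(1) i(2)] thread_mem_length[OF mj(1)] by (simp add: long_bars_def)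
    then show "\<theta> \<in> (\<Union>n. S n)" unfolding S_def using thread_mem[OF mj(1)] i by blast
  next
    fix \<theta> assume "\<theta> \<in> (\<Union>n. S n)"
    then obtain n i where i: "\<theta> = thread n i" "i < length (bs n)" "fst (bs n ! i) \<le> ereal s" "r < snd (bs n ! i)"
      by (auto simp: S_def long_bars_def)
    then have "r < snd (thread_bar \<theta>)" using thread_bar_less[OF i(2), of r] thread_self[OF i(2)] by auto
    then show "\<theta> \<in> long_bars threads thread_bar s r"
      using thread_bar_fst[OF i(2)] i by (auto simp: long_bars_def threads_def)
  qed
  also have "\<dots> = S n0" using const by auto
  finally show ?thesis using fin card by simp
qed


text \<open>The element of the direct limit that corresponds to a finitely supported function on
  threads: all representatives with that pushforward.\<close>

definition limit_class :: "real \<Rightarrow> ((nat \<times> nat) set \<Rightarrow> 'k::field) \<Rightarrow> (nat \<times> (nat \<Rightarrow> 'k)) set" where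
  "limit_class r c = {(n, y). y \<in> carrier (free_module (alive (bs n) r)) \<and> pushforward (thread n) y = c}"

lemma step_alive: "m \<le> n \<Longrightarrow> step m n ` alive (bs m) r \<subseteq> alive (bs n) r"
  using step_props(2)[of m n] by (auto simp: alive_def)

lemma pushforward_step_carrier:
  assumes "m \<le> n" "x \<in> carrier (free_module (alive (bs m) r))"
  shows "pushforward (step m n) x \<in> carrier (free_module (alive (bs n) r))"
  by (rule pushforward_carrier[OF assms(2) step_alive[OF assms(1)]])

lemma pushforward_thread_step:
  fixes x :: "nat \<Rightarrow> 'k::field"
  assumes "m \<le> n" "x \<in> carrier (free_module (alive (bs m) r))"
  shows "pushforward (thread n) (pushforward (step m n) x) = pushforward (thread m) x"
  using assms thread_step[OF assms(1)] by (simp add: pushforward_comp)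

lemma pushforward_thread_inj:
  fixes x y :: "nat \<Rightarrow> 'k::field"
  assumes "x \<in> carrier (free_module (alive (bs n) r))" "y \<in> carrier (free_module (alive (bs n) r))"
    and eq: "pushforward (thread n) x = pushforward (thread n) y"
  shows "x = y"
proof
  fix i
  have s: "{s. x s \<noteq> 0} \<subseteq> {..<length (bs n)}" "{s. y s \<noteq> 0} \<subseteq> {..<length (bs n)}"
    using assms by (auto simp: alive_def)
  show "x i = y i"
  proof (cases "i < length (bs n)")
    case True
    then show ?thesis
      using pushforward_inj[OF inj_thread s(1), of i] pushforward_inj[OF inj_thread s(2), of i] eq by simp
  next
    case False
    then have "x i = 0" "y i = 0" using s by auto
    then show ?thesis by simp
  qed
qed

text \<open>By injectivity of \<open>thread\<close>, two elements become equal at a later stage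
  exactly if they have the same image on threads; the maximum of their stages is already late
  enough.\<close>

lemma germ_eq:
  fixes x :: "nat \<Rightarrow> 'k::field"
  assumes x: "x \<in> carrier (free_module (alive (bs m) r))"
  shows "germ (\<lambda>n. free_module (alive (bs n) r)) (\<lambda>n. pushforward (\<sigma> n)) m x
           = limit_class r (pushforward (thread m) x)"
proof -
  have "(\<exists>p. m \<le> p \<and> n \<le> p \<and> transition (\<lambda>n. pushforward (\<sigma> n)) m p x = transition (\<lambda>n. pushforward (\<sigma> n)) n p y)
      \<longleftrightarrow> pushforward (thread n) y = pushforward (thread m) x" (is "?L \<longleftrightarrow> ?R")
    if y: "y \<in> carrier (free_module (alive (bs n) r))" for n and y :: "nat \<Rightarrow> 'k"
  proof
    assume ?L
    then obtain p where p: "m \<le> p" "n \<le> p"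
      "transition (\<lambda>n. pushforward (\<sigma> n)) m p x = transition (\<lambda>n. pushforward (\<sigma> n)) n p y" by auto
    then have "pushforward (step m p) x = pushforward (step n p) y"
      using x y by (simp add: transition_pushforward)
    then show ?R using pushforward_thread_step[OF p(1) x] pushforward_thread_step[OF p(2) y] by simp
  next
    assume ?R
    let ?p = "max m n"
    have "pushforward (step m ?p) x = pushforward (step n ?p) y"
      by (rule pushforward_thread_inj[of _ ?p r])
         (use pushforward_step_carrier[OF _ x, of ?p] pushforward_step_carrier[OF _ y, of ?p] \<open>?R\<close>
            pushforward_thread_step[OF _ x, of ?p] pushforward_thread_step[OF _ y, of ?p] in \<open>auto simp del: free_module_simps\<close>)
    then show ?L using x y by (intro exI[of _ ?p]) (simp add: transition_pushforward)
  qed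
  then show ?thesis unfolding germ_def limit_class_def by blast
qed

text \<open>Finitely many threads alive at r have members alive at r at one common stage.\<close>

lemma limit_class_surj:
  fixes c :: "(nat \<times> nat) set \<Rightarrow> 'k::field"
  assumes "c \<in> carrier (free_module {\<theta> \<in> threads. r \<in> thread_interval \<theta>})"
  shows "\<exists>n x. x \<in> carrier (free_module (alive (bs n) r)) \<and> pushforward (thread n) x = c"
  using assms
proof (induction rule: free_module_induct)
  case zero
  show ?case by (rule exI[of _ 0], rule exI[of _ "\<lambda>_. 0"]) simp
next
  case (add c \<theta> k)
  then obtain n x where x: "x \<in> carrier (free_module (alive (bs n) r))" "pushforward (thread n) x = c" by blast
  obtain m j where mj: "(m, j) \<in> \<theta>" "r \<in> bar_interval (bs m ! j)"
    using add by (auto simp: thread_interval_def)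
  then have j: "\<theta> = thread m j" "j < length (bs m)" using add thread_mem thread_mem_length
    by (auto simp: threads_def)
  let ?p = "max m n"
  let ?x = "pushforward (step n ?p) x" and ?d = "delta (step m ?p j) k :: nat \<Rightarrow> 'k"
  have x': "?x \<in> carrier (free_module (alive (bs ?p) r))" by (rule pushforward_step_carrier[OF _ x(1)]) simp
  have d: "?d \<in> carrier (free_module (alive (bs ?p) r))"
    by (rule delta_in_free_module) (use step_alive[of m ?p r] mj j in \<open>auto simp: alive_def\<close>)
  have "pushforward (thread ?p) (\<lambda>i. ?x i + ?d i) = (\<lambda>t. c t + delta \<theta> k t)"
    using x' d pushforward_thread_step[OF _ x(1), of ?p] x(2) thread_step[of m ?p j] j
    by (simp add: pushforward_add pushforward_delta)
  moreover have "(\<lambda>i. ?x i + ?d i) \<in> carrier (free_module (alive (bs ?p) r))"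
    using free_module_closed(1)[OF x' d] by (simp only: free_module_simps(2))
  ultimately show ?case by blast
qed

lemma pushforward_thread_carrier:
  assumes "x \<in> carrier (free_module (alive (bs n) r))"
  shows "pushforward (thread n) x \<in> carrier (free_module {\<theta> \<in> threads. r \<in> thread_interval \<theta>})"
  by (rule pushforward_carrier[OF assms])
     (use thread_self in \<open>auto simp: alive_def threads_def thread_interval_def intro: rev_bexI\<close>)

text \<open>\<open>limit_class\<close> is a strict isomorphism. Each operation of the limit is a
  union over representatives whose terms are all the same class, and there is at least one
  representative.\<close>

theorem alg_limit_same_barcode:
  defines "V \<equiv> (interval_module threads thread_interval :: ('k::field, _) persmod)"
  defines "W \<equiv> (alg_limit bs \<sigma> :: ('k, _) persmod)"
  shows "persistence_module W" "same_barcode V W"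
proof -
  have V: "persistence_module V"
    unfolding V_def by (rule persistence_module_interval[OF thread_has_ends(1)])
  let ?M = "\<lambda>r n. free_module (alive (bs n) r) :: ('k, nat \<Rightarrow> 'k) module"
  let ?D = "\<lambda>r. direct_limit (?M r) (\<lambda>n. pushforward (\<sigma> n))"
  have Ws: "pm_space W r = ?D r" for r
    by (simp add: W_def alg_limit_def direct_limit_persmod_def bars_module_def)
  have Wm: "pm_map W r s A = (\<Union>(n, x)\<in>A. germ (?M s) (\<lambda>n. pushforward (\<sigma> n)) n (\<lambda>i. if i \<in> alive (bs n) s then x i else 0))" for r s A
    by (simp add: W_def alg_limit_def direct_limit_persmod_def bars_module_def)
  have ne: "limit_class r c \<noteq> {}" if "c \<in> carrier (pm_space V r)" for c :: "_ \<Rightarrow> 'k" and r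
    using limit_class_surj[of c r] that unfolding V_def limit_class_def by auto
  have carr: "limit_class r ` carrier (pm_space V r) = carrier (pm_space W r)" for r
  proof (intro subset_antisym subsetI)
    fix A assume "A \<in> limit_class r ` carrier (pm_space V r)"
    then obtain c where c: "c \<in> carrier (pm_space V r)" "A = limit_class r c" by auto
    then obtain n x where "x \<in> carrier (?M r n)" "pushforward (thread n) x = c"
      using limit_class_surj[of c r] by (auto simp: V_def)
    then show "A \<in> carrier (pm_space W r)"
      unfolding Ws direct_limit_def using germ_eq[of x n r] c by auto
  next
    fix A assume "A \<in> carrier (pm_space W r)"
    then obtain n x where "x \<in> carrier (?M r n)" "A = germ (?M r) (\<lambda>n. pushforward (\<sigma> n)) n x"
      unfolding Ws direct_limit_def by auto
    then show "A \<in> limit_class r ` carrier (pm_space V r)"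
      using germ_eq[of x n r] pushforward_thread_carrier[of x n r] by (simp add: V_def del: free_module_simps)
  qed
  have lin: "limit_class r \<in> linear_maps (pm_space V r) (pm_space W r)" for r
    unfolding linear_maps_def
  proof (intro CollectI conjI ballI allI)
    show "limit_class r \<in> carrier (pm_space V r) \<rightarrow> carrier (pm_space W r)" using carr by blast
  next
    fix c d :: "_ \<Rightarrow> 'k" assume cd: "c \<in> carrier (pm_space V r)" "d \<in> carrier (pm_space V r)"
    have "germ (?M r) (\<lambda>n. pushforward (\<sigma> n)) (max m n)
             (transition (\<lambda>n. pushforward (\<sigma> n)) m (max m n) x \<oplus>\<^bsub>?M r (max m n)\<^esub>
              transition (\<lambda>n. pushforward (\<sigma> n)) n (max m n) y) = limit_class r (\<lambda>s. c s + d s)"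
      if xy: "(m, x) \<in> limit_class r c" "(n, y) \<in> limit_class r d" for m n x y
    proof -
      let ?p = "max m n"
      have x: "x \<in> carrier (?M r m)" "pushforward (thread m) x = c"
       and y: "y \<in> carrier (?M r n)" "pushforward (thread n) y = d" using xy by (auto simp: limit_class_def)
      have x': "pushforward (step m ?p) x \<in> carrier (?M r ?p)" by (rule pushforward_step_carrier[OF _ x(1)]) simp
      have y': "pushforward (step n ?p) y \<in> carrier (?M r ?p)" by (rule pushforward_step_carrier[OF _ y(1)]) simp
      have eq: "pushforward (thread ?p) (\<lambda>s. pushforward (step m ?p) x s + pushforward (step n ?p) y s) = (\<lambda>s. c s + d s)"
        using x' y' pushforward_thread_step[OF _ x(1), of ?p] pushforward_thread_step[OF _ y(1), of ?p] x(2) y(2)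
        by (simp add: pushforward_add)
      have "transition (\<lambda>n. pushforward (\<sigma> n)) m ?p x \<oplus>\<^bsub>?M r ?p\<^esub>
              transition (\<lambda>n. pushforward (\<sigma> n)) n ?p y = (\<lambda>s. pushforward (step m ?p) x s + pushforward (step n ?p) y s)"
        using x(1) y(1) by (simp add: transition_pushforward)
      then show ?thesis using germ_eq[OF free_module_closed(1)[OF x' y']] eq by simp
    qed
    then have eq: "(\<Union>(m, x)\<in>limit_class r c. \<Union>(n, y)\<in>limit_class r d.
               germ (?M r) (\<lambda>n. pushforward (\<sigma> n)) (max m n)
             (transition (\<lambda>n. pushforward (\<sigma> n)) m (max m n) x \<oplus>\<^bsub>?M r (max m n)\<^esub>
              transition (\<lambda>n. pushforward (\<sigma> n)) n (max m n) y)) =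
          (\<Union>(m, x)\<in>limit_class r c. \<Union>(n, y)\<in>limit_class r d. limit_class r (\<lambda>s. c s + d s))"
      by (intro SUP_cong refl) auto
    show "limit_class r (c \<oplus>\<^bsub>pm_space V r\<^esub> d) = limit_class r c \<oplus>\<^bsub>pm_space W r\<^esub> limit_class r d"
      using ne[OF cd(1)] ne[OF cd(2)] eq unfolding Ws by (simp add: direct_limit_def V_def case_prod_unfold)
  next
    fix a and c :: "_ \<Rightarrow> 'k" assume c: "c \<in> carrier (pm_space V r)"
    have "germ (?M r) (\<lambda>n. pushforward (\<sigma> n)) n (a \<odot>\<^bsub>?M r n\<^esub> x) = limit_class r (\<lambda>s. a * c s)"
      if "(n, x) \<in> limit_class r c" for n x
    proof -
      have x: "x \<in> carrier (?M r n)" "pushforward (thread n) x = c" using that by (auto simp: limit_class_def)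
      then show ?thesis using germ_eq[OF free_module_closed(2)[OF x(1), of a]] by (simp add: pushforward_smult)
    qed
    then have eq: "(\<Union>(n, x)\<in>limit_class r c. germ (?M r) (\<lambda>n. pushforward (\<sigma> n)) n (a \<odot>\<^bsub>?M r n\<^esub> x)) =
        (\<Union>(n, x)\<in>limit_class r c. limit_class r (\<lambda>s. a * c s))"
      by (intro SUP_cong refl) auto
    show "limit_class r (a \<odot>\<^bsub>pm_space V r\<^esub> c) = a \<odot>\<^bsub>pm_space W r\<^esub> limit_class r c"
      using ne[OF c] eq unfolding Ws by (simp add: direct_limit_def V_def case_prod_unfold)
  qed
  have nat: "pm_map W r s (limit_class r c) = limit_class s (pm_map V r s c)"
    if "s \<le> r" and c: "c \<in> carrier (pm_space V r)" for r s and c :: "_ \<Rightarrow> 'k"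
  proof -
    have "germ (?M s) (\<lambda>n. pushforward (\<sigma> n)) n (\<lambda>i. if i \<in> alive (bs n) s then x i else 0)
        = limit_class s (pm_map V r s c)" if nx: "(n, x) \<in> limit_class r c" for n x
    proof -
      have x: "x \<in> carrier (?M r n)" "pushforward (thread n) x = c" using nx by (auto simp: limit_class_def)
      let ?x = "\<lambda>i. if i \<in> alive (bs n) s then x i else 0"
      have x': "?x \<in> carrier (?M s n)" using x(1) by (auto intro: finite_support_restrict)
      \<comment> \<open>Truncation is compared coordinate by coordinate: a nonzero coordinate is
        alive at r, where \<open>thread_interval_down\<close> decides membership at s.\<close>
      have "pushforward (thread n) ?x \<theta> = (if \<theta> \<in> threads \<and> s \<in> thread_interval \<theta> then pushforward (thread n) x \<theta> else 0)" for \<theta>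
      proof (cases "\<exists>i<length (bs n). \<theta> = thread n i")
        case True
        then obtain i where i: "i < length (bs n)" "\<theta> = thread n i" by auto
        have sx: "{s. x s \<noteq> 0} \<subseteq> {..<length (bs n)}" "{s. ?x s \<noteq> 0} \<subseteq> {..<length (bs n)}"
          using x(1) x' by (auto simp: alive_def)
        have "\<theta> \<in> threads" using i by (auto simp: threads_def)
        moreover have "s \<in> thread_interval \<theta> \<longleftrightarrow> i \<in> alive (bs n) s" if "x i \<noteq> 0"
          using thread_interval_down[OF i(1) _ \<open>s \<le> r\<close>] x(1) that i by (auto simp: alive_def)
        ultimately show ?thesis
          using pushforward_inj[OF inj_thread sx(1), of i] pushforward_inj[OF inj_thread sx(2), of i] i by auto
      next
        case False
        have "pushforward (thread n) x \<theta> = 0" "pushforward (thread n) ?x \<theta> = 0"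
          using pushforward_support[of "thread n" x] pushforward_support[of "thread n" ?x] False x(1) x'
          by (auto simp: alive_def image_iff dest!: subsetD)
        then show ?thesis by simp
      qed
      then have "pushforward (thread n) ?x = pm_map V r s c" by (auto simp: V_def x(2))
      then show ?thesis using germ_eq[OF x'] by simp
    qed
    then have "pm_map W r s (limit_class r c) = (\<Union>(n, x)\<in>limit_class r c. limit_class s (pm_map V r s c))"
      unfolding Wm by (intro SUP_cong refl) auto
    then show ?thesis using ne[OF c] by (simp add: case_prod_unfold)
  qed
  show W: "persistence_module W" by (rule persistence_module_transfer[where G = limit_class, OF V lin carr nat])
  have "inj_on (limit_class r) (carrier (pm_space V r))" for r
  proof (rule inj_onI)
    fix c d :: "_ \<Rightarrow> 'k" assume h: "c \<in> carrier (pm_space V r)" "limit_class r c = limit_class r d"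
    then obtain n x where "(n, x) \<in> limit_class r c" using ne by fast
    then show "c = d" using h(2) by (auto simp: limit_class_def)
  qed
  then show "same_barcode V W"
    using same_barcode_strict[OF V W lin] carr nat by (auto simp: bij_betw_def)
qed

end


section \<open>Clusters and the elder rule\<close>

text \<open>Separates the functoriality of components from their origin; the same parts serve the
  elder rule and the comparison with Cech homology.\<close>

locale nested_parts =
  fixes P :: "real \<Rightarrow> 'a set set"
  assumes parts_nonempty: "C \<in> P s \<Longrightarrow> C \<noteq> {}"
    and parts_disjoint: "C \<in> P s \<Longrightarrow> D \<in> P s \<Longrightarrow> C \<inter> D \<noteq> {} \<Longrightarrow> C = D"
    and parts_nested: "s \<le> r \<Longrightarrow> C \<in> P r \<Longrightarrow> \<exists>D\<in>P s. C \<subseteq> D"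
begin

definition up :: "real \<Rightarrow> 'a set \<Rightarrow> 'a set" where
  "up s C = (THE D. D \<in> P s \<and> C \<subseteq> D)"

lemma up_eq:
  assumes "s \<le> r" "C \<in> P r" "D \<in> P s" "C \<inter> D \<noteq> {}"
  shows "up s C = D"
proof -
  obtain E where E: "E \<in> P s" "C \<subseteq> E" using parts_nested assms by blast
  have "E = D" using parts_disjoint[OF E(1) assms(3)] E(2) assms(4) by blast
  have uniq: "F = E" if "F \<in> P s \<and> C \<subseteq> F" for F
    by (rule parts_disjoint[OF conjunct1[OF that] E(1)]) (use that E(2) parts_nonempty[OF assms(2)] in blast)
  have "up s C = E" unfolding up_def by (rule the_equality) (use E in simp, erule uniq)
  then show ?thesis using \<open>E = D\<close> by simp
qed

lemma up_props:
  assumes "s \<le> r" "C \<in> P r"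
  shows "up s C \<in> P s" "C \<subseteq> up s C"
proof -
  obtain E where E: "E \<in> P s" "C \<subseteq> E" using parts_nested assms by blast
  have "up s C = E" using up_eq[OF assms E(1)] E(2) parts_nonempty[OF assms(2)] by blast
  then show "up s C \<in> P s" "C \<subseteq> up s C" using E by auto
qed

lemma up_self: "C \<in> P r \<Longrightarrow> up r C = C"
  using up_eq[of r r C C] parts_nonempty by auto

lemma up_up:
  assumes "t \<le> s" "s \<le> r" "C \<in> P r"
  shows "up t (up s C) = up t C"
proof -
  note 1 = up_props[OF assms(2,3)] and 2 = up_props[OF order_trans[OF assms(1,2)] assms(3)]
  show ?thesis
    by (rule up_eq[OF assms(1) 1(1) 2(1)]) (use 1 2 parts_nonempty[OF assms(3)] in blast)
qed

definition parts_module :: "('k::field, 'a set \<Rightarrow> 'k) persmod" where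
  "parts_module = \<lparr>pm_space = (\<lambda>r. free_module (P r)), pm_map = (\<lambda>r s. pushforward (up s))\<rparr>"

lemma parts_module_simps [simp]:
  "pm_space parts_module r = free_module (P r)" "pm_map parts_module r s = pushforward (up s)"
  by (simp_all add: parts_module_def)

lemma persistence_module_parts: "persistence_module (parts_module :: ('k::field, _) persmod)"
  unfolding persistence_module_def parts_module_simps
proof (intro conjI allI ballI impI)
  fix r s :: real assume "s \<le> r"
  then show "pushforward (up s) \<in> linear_maps (free_module (P r)) (free_module (P s) :: ('k, _) module)"
    using up_props by (intro pushforward_linear) auto
next
  fix r and x :: "'a set \<Rightarrow> 'k" assume "x \<in> carrier (free_module (P r))"
  then have "pushforward (up r) x = pushforward (\<lambda>C. C) x"
    by (intro pushforward_cong up_self) auto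
  then show "pushforward (up r) x = x" by simp
next
  fix r s t and x :: "'a set \<Rightarrow> 'k"
  assume h: "t \<le> s \<and> s \<le> r" and x: "x \<in> carrier (free_module (P r))"
  have "pushforward (up t) (pushforward (up s) x) = pushforward (\<lambda>C. up t (up s C)) x"
    using x by (simp add: pushforward_comp)
  also have "\<dots> = pushforward (up t) x"
    using x h by (intro pushforward_cong up_up[of _ _ r]) auto
  finally show "pushforward (up t) (pushforward (up s) x) = pushforward (up t) x" .
next
  fix r and x y :: "'a set \<Rightarrow> 'k"
  assume "x \<in> carrier (free_module (P r))" "y \<in> carrier (free_module (P r))"
  then show "x \<oplus>\<^bsub>free_module (P r)\<^esub> y \<in> carrier (free_module (P r))" by (rule free_module_closed(1))
next
  fix r a and x :: "'a set \<Rightarrow> 'k"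
  assume "x \<in> carrier (free_module (P r))"
  then show "a \<odot>\<^bsub>free_module (P r)\<^esub> x \<in> carrier (free_module (P r))" by (rule free_module_closed(2))
qed

end


text \<open>\<open>g\<close> is the Gromov product of the distance l x + l y - 2 g x y. Distinct
  points at distance 0 are allowed, so the locale applies to the space before the quotient as well
  as to the tree.\<close>

locale merge_space =
  fixes S :: "'b set" and l :: "'b \<Rightarrow> real" and g :: "'b \<Rightarrow> 'b \<Rightarrow> real"
  assumes g_self: "x \<in> S \<Longrightarrow> g x x = l x"
    and g_sym: "x \<in> S \<Longrightarrow> y \<in> S \<Longrightarrow> g x y = g y x"
    and g_le: "x \<in> S \<Longrightarrow> y \<in> S \<Longrightarrow> g x y \<le> l x"
    and g_ultra: "x \<in> S \<Longrightarrow> y \<in> S \<Longrightarrow> z \<in> S \<Longrightarrow> min (g x y) (g y z) \<le> g x z"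
begin

lemma g_trans_less: "x \<in> S \<Longrightarrow> y \<in> S \<Longrightarrow> z \<in> S \<Longrightarrow> s < g x y \<Longrightarrow> s < g y z \<Longrightarrow> s < g x z"
  using g_ultra[of x y z] by linarith

lemma g_le2: "x \<in> S \<Longrightarrow> y \<in> S \<Longrightarrow> g x y \<le> l y"
  using g_le[of y x] g_sym[of x y] by simp

text \<open>The strict inequality corresponds to open superlevel sets, whose components are open in
  a locally path connected space.\<close>

definition cls :: "real \<Rightarrow> 'b \<Rightarrow> 'b set" where
  "cls s x = {y \<in> S. s < g x y}"

lemma cls_self: "x \<in> S \<Longrightarrow> s < l x \<Longrightarrow> x \<in> cls s x"
  by (simp add: cls_def g_self)

lemma cls_eq:
  assumes "x \<in> S" "y \<in> cls s x"
  shows "cls s y = cls s x"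
proof -
  have y: "y \<in> S" "s < g x y" "s < g y x" using assms g_sym[of x y] by (auto simp: cls_def)
  show ?thesis unfolding cls_def
    using g_trans_less[OF assms(1) y(1) _ y(2)] g_trans_less[OF y(1) assms(1) _ y(3)] by blast
qed

lemma cls_mono: "s \<le> r \<Longrightarrow> cls r x \<subseteq> cls s x"
  by (auto simp: cls_def)

lemma cls_less: "x \<in> S \<Longrightarrow> y \<in> cls s x \<Longrightarrow> y \<in> S \<and> s < l y \<and> s < l x"
  using g_le[of x y] g_le2[of x y] by (auto simp: cls_def)

definition clusters :: "real \<Rightarrow> 'b set set" where
  "clusters s = cls s ` {x \<in> S. s < l x}"

definition tall_clusters :: "real \<Rightarrow> real \<Rightarrow> 'b set set" where
  "tall_clusters s r = cls s ` {x \<in> S. r < l x}"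

lemma clustersE:
  assumes "C \<in> clusters s"
  obtains x where "x \<in> S" "s < l x" "C = cls s x" "x \<in> C"
  using assms cls_self unfolding clusters_def by blast

lemma clusters_eq: "C \<in> clusters s \<Longrightarrow> x \<in> C \<Longrightarrow> C = cls s x"
  using cls_eq unfolding clusters_def by fastforce

sublocale parts: nested_parts clusters
proof
  fix C s assume "C \<in> clusters s" then show "C \<noteq> {}" by (elim clustersE) auto
next
  fix C D s assume "C \<in> clusters s" "D \<in> clusters s" "C \<inter> D \<noteq> {}"
  then show "C = D" using clusters_eq by blast
next
  fix s r C assume h: "s \<le> r" "C \<in> clusters r"
  then obtain x where x: "x \<in> S" "r < l x" "C = cls r x" by (elim clustersE)
  then show "\<exists>D\<in>clusters s. C \<subseteq> D"
    using cls_mono[OF h(1), of x] h(1) by (intro bexI[of _ "cls s x"]) (auto simp: clusters_def)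
qed

end

section \<open>Eldest points and their lifetimes\<close>

locale finite_merge_space = merge_space S l g
  for S :: "'b set" and l :: "'b \<Rightarrow> real" and g +
  assumes fin: "s < r \<Longrightarrow> finite (tall_clusters s r)"
    and top_exists: "x \<in> S \<Longrightarrow> s < l x \<Longrightarrow> \<exists>y\<in>cls s x. \<forall>z\<in>cls s x. l z \<le> l y"
begin

text \<open>A well-order and not just a linear order: a cluster may have infinitely many highest
  points, and a first one among them is required.\<close>

definition tie_break :: "('b \<times> 'b) set" where
  "tie_break = (SOME r. Well_order r \<and> Field r = UNIV)"

lemma tie_break: "Well_order tie_break" "Field tie_break = UNIV"
  using someI_ex[OF well_ordering, where 'a1 = 'b] unfolding tie_break_def by auto

definition elder :: "'b \<Rightarrow> 'b \<Rightarrow> bool" where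
  "elder x y \<longleftrightarrow> l y < l x \<or> l x = l y \<and> (x, y) \<in> tie_break"

lemma tie_break_order:
  "(x, x) \<in> tie_break"
  "(x, y) \<in> tie_break \<Longrightarrow> (y, x) \<in> tie_break \<Longrightarrow> x = y"
  "(x, y) \<in> tie_break \<Longrightarrow> (y, z) \<in> tie_break \<Longrightarrow> (x, z) \<in> tie_break"
  "(x, y) \<in> tie_break \<or> (y, x) \<in> tie_break"
proof -
  note wo = tie_break[unfolded well_order_on_def linear_order_on_def partial_order_on_def preorder_on_def]
  show refl: "(x, x) \<in> tie_break" for x using wo by (auto simp: refl_on_def)
  show "(x, y) \<in> tie_break \<Longrightarrow> (y, x) \<in> tie_break \<Longrightarrow> x = y" using wo by (auto simp: antisym_def)
  show "(x, y) \<in> tie_break \<Longrightarrow> (y, z) \<in> tie_break \<Longrightarrow> (x, z) \<in> tie_break" using wo by (auto dest: transD)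
  show "(x, y) \<in> tie_break \<or> (y, x) \<in> tie_break" using wo refl by (cases "x = y") (auto simp: total_on_def)
qed

lemma elder_order:
  "elder x x" "elder x y \<Longrightarrow> elder y x \<Longrightarrow> x = y" "elder x y \<Longrightarrow> elder y z \<Longrightarrow> elder x z"
  "elder x y \<or> elder y x"
  using tie_break_order(1)[of x] tie_break_order(2)[of x y] tie_break_order(3)[of x y z] tie_break_order(4)[of x y]
  unfolding elder_def by auto

definition eldest :: "'b set \<Rightarrow> 'b" where
  "eldest C = (THE y. y \<in> C \<and> (\<forall>z\<in>C. elder y z))"

lemma eldest_eq: "y \<in> C \<Longrightarrow> (\<And>z. z \<in> C \<Longrightarrow> elder y z) \<Longrightarrow> eldest C = y"
  unfolding eldest_def by (rule the_equality) (blast, rule elder_order(2), blast+)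

lemma eldest_props:
  assumes "C \<in> clusters s"
  shows "eldest C \<in> C" "\<And>z. z \<in> C \<Longrightarrow> elder (eldest C) z"
proof -
  obtain x where x: "x \<in> S" "s < l x" "C = cls s x" using assms by (elim clustersE)
  then obtain y0 where y0: "y0 \<in> C" "\<forall>z\<in>C. l z \<le> l y0" using top_exists by blast
  define M where "M = {y \<in> C. \<forall>z\<in>C. l z \<le> l y}"
  have "y0 \<in> M" using y0 by (simp add: M_def)
  moreover have "wf (tie_break - Id)" using tie_break(1) by (simp add: well_order_on_def)
  ultimately obtain y where y: "y \<in> M" "\<And>z. (z, y) \<in> tie_break - Id \<Longrightarrow> z \<notin> M"
    using wfE_min by metis
  have "elder y z" if "z \<in> C" for z
  proof (cases "z \<in> M")
    case True
    then have "l z = l y" using y(1) by (auto simp: M_def intro: antisym)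
    moreover have "(y, z) \<in> tie_break"
      using y(2)[of z] True tie_break_order(1)[of y] tie_break_order(4)[of y z] by blast
    ultimately show ?thesis by (simp add: elder_def)
  next
    case False
    then obtain w where "w \<in> C" "\<not> l w \<le> l z" using \<open>z \<in> C\<close> unfolding M_def by blast
    then show ?thesis using y(1) by (force simp: M_def elder_def)
  qed
  moreover have "y \<in> C" using y by (simp add: M_def)
  ultimately show "eldest C \<in> C" "\<And>z. z \<in> C \<Longrightarrow> elder (eldest C) z"
    using eldest_eq[of y C] by auto
qed

lemma eldest_subset:
  assumes "D \<in> clusters s" "C \<subseteq> D" "eldest D \<in> C"
  shows "eldest C = eldest D"
  using eldest_eq[OF assms(3)] eldest_props(2)[OF assms(1)] assms(2) by blast

lemma cls_in_clusters: "x \<in> S \<Longrightarrow> s < l x \<Longrightarrow> cls s x \<in> clusters s"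
  by (auto simp: clusters_def)

definition lifetime :: "'b \<Rightarrow> real set" where
  "lifetime i = {s. s < l i \<and> eldest (cls s i) = i}"

definition elders :: "'b set" where
  "elders = {i \<in> S. lifetime i \<noteq> {}}"

text \<open>The infimum is taken in the extended reals; it is -\<infinity> for a point that remains
  the eldest of its cluster at arbitrarily low levels.\<close>

definition elder_bar :: "'b \<Rightarrow> bar" where
  "elder_bar i = (INF s\<in>lifetime i. ereal s, l i)"

lemma eldest_lifetime:
  assumes "C \<in> clusters s"
  shows "eldest C \<in> elders" "s \<in> lifetime (eldest C)" "cls s (eldest C) = C" "eldest C \<in> S"
proof -
  have m: "eldest C \<in> C" using eldest_props[OF assms] by simp
  then show c: "cls s (eldest C) = C" using clusters_eq[OF assms] by simp
  obtain x where "x \<in> S" "C = cls s x" using assms by (elim clustersE)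
  then have "eldest C \<in> S" "s < l (eldest C)" using cls_less[of x "eldest C" s] m by auto
  then show "s \<in> lifetime (eldest C)" "eldest C \<in> elders" "eldest C \<in> S"
    using c by (auto simp: lifetime_def elders_def)
qed

lemma lifetime_up:
  assumes "i \<in> S" "s \<in> lifetime i" "s \<le> r" "r < l i"
  shows "r \<in> lifetime i"
proof -
  have s: "s < l i" "eldest (cls s i) = i" using assms by (auto simp: lifetime_def)
  have "eldest (cls r i) = eldest (cls s i)"
    by (rule eldest_subset[OF cls_in_clusters[OF assms(1) s(1)] cls_mono[OF assms(3)]])
       (use s cls_self assms in auto)
  then show ?thesis using s assms by (simp add: lifetime_def)
qed

text \<open>An eldest point t other than i would satisfy s < g i t strictly, hence would share a
  cluster with i at a slightly higher level already. So a lifetime contains its finite lower end, in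
  contrast to a bar of Alg.\<close>

lemma lifetime_closed:
  assumes i: "i \<in> S" "s < l i" and r: "\<And>r. s < r \<Longrightarrow> r < l i \<Longrightarrow> r \<in> lifetime i"
  shows "s \<in> lifetime i"
proof -
  let ?t = "eldest (cls s i)"
  have C: "cls s i \<in> clusters s" by (rule cls_in_clusters[OF i])
  have t: "?t \<in> S" "s < g i ?t" using eldest_props(1)[OF C] by (auto simp: cls_def)
  obtain r where r': "s < r" "r < min (g i ?t) (l i)" using dense[of s "min (g i ?t) (l i)"] t i by auto
  have "eldest (cls r i) = ?t"
    by (rule eldest_subset[OF C cls_mono]) (use r' t in \<open>auto simp: cls_def\<close>)
  moreover have "eldest (cls r i) = i" using r[of r] r' by (simp add: lifetime_def)
  ultimately show ?thesis using i by (simp add: lifetime_def)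
qed

lemma lifetime_iff:
  assumes i: "i \<in> elders"
  shows "fst (elder_bar i) \<le> ereal s \<and> s < l i \<longleftrightarrow> s \<in> lifetime i"
proof
  assume s: "fst (elder_bar i) \<le> ereal s \<and> s < l i"
  have iS: "i \<in> S" using i by (simp add: elders_def)
  show "s \<in> lifetime i"
  proof (rule lifetime_closed[OF iS])
    fix r assume r: "s < r" "r < l i"
    then have "(INF s\<in>lifetime i. ereal s) < ereal r" using s by (auto simp: elder_bar_def intro: le_less_trans)
    then obtain t where "t \<in> lifetime i" "t < r" by (auto simp: INF_less_iff)
    then show "r \<in> lifetime i" using lifetime_up[OF iS] r by auto
  qed (use s in simp)
next
  assume "s \<in> lifetime i"
  then show "fst (elder_bar i) \<le> ereal s \<and> s < l i"
    by (auto simp: elder_bar_def lifetime_def intro: INF_lower)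
qed

lemma elder_bar_nondegenerate: "i \<in> elders \<Longrightarrow> fst (elder_bar i) < ereal (snd (elder_bar i))"
proof -
  assume i: "i \<in> elders"
  then obtain s where "s \<in> lifetime i" by (auto simp: elders_def)
  then have "fst (elder_bar i) \<le> ereal s" "s < l i" using lifetime_iff[OF i, of s] by auto
  then show ?thesis by (auto simp: elder_bar_def intro: le_less_trans)
qed

lemma elder_bar_has_ends: "i \<in> elders \<Longrightarrow> has_ends (lifetime i) (elder_bar i)"
  unfolding has_ends_def using lifetime_iff[of i]
  by (auto simp: elder_bar_def lifetime_def intro: less_imp_le)

text \<open>Points whose lifetime contains s correspond to clusters at s through the eldest point,
  and a cluster reaches above r exactly if its eldest point does.\<close>

lemma long_elder_bars:
  assumes "s < r"
  shows "finite (long_bars elders elder_bar s r) \<and> card (long_bars elders elder_bar s r) = card (tall_clusters s r)"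
proof -
  have eq: "long_bars elders elder_bar s r = {i \<in> elders. s \<in> lifetime i \<and> r < l i}"
  proof (intro equalityI subsetI)
    fix i assume "i \<in> long_bars elders elder_bar s r"
    then show "i \<in> {i \<in> elders. s \<in> lifetime i \<and> r < l i}"
      using lifetime_iff[of i s] assms by (auto simp: long_bars_def elder_bar_def)
  next
    fix i assume "i \<in> {i \<in> elders. s \<in> lifetime i \<and> r < l i}"
    then show "i \<in> long_bars elders elder_bar s r"
      using lifetime_iff[of i s] by (auto simp: long_bars_def elder_bar_def)
  qed
  have "bij_betw (cls s) {i \<in> elders. s \<in> lifetime i \<and> r < l i} (tall_clusters s r)"
    unfolding bij_betw_def
  proof (intro conjI inj_onI equalityI subsetI)
    fix i j assume "i \<in> {i \<in> elders. s \<in> lifetime i \<and> r < l i}" "j \<in> {i \<in> elders. s \<in> lifetime i \<and> r < l i}"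
      "cls s i = cls s j"
    then have "eldest (cls s i) = i" "eldest (cls s i) = j" by (simp_all add: lifetime_def)
    then show "i = j" by simp
  next
    fix C assume "C \<in> cls s ` {i \<in> elders. s \<in> lifetime i \<and> r < l i}"
    then show "C \<in> tall_clusters s r" by (auto simp: tall_clusters_def elders_def)
  next
    fix C assume "C \<in> tall_clusters s r"
    then obtain x where x: "x \<in> S" "r < l x" "C = cls s x" by (auto simp: tall_clusters_def)
    then have C: "C \<in> clusters s" using assms by (auto simp: clusters_def)
    have "elder (eldest C) x" using eldest_props(2)[OF C] cls_self[of x s] x assms by auto
    then have "r < l (eldest C)" using x by (auto simp: elder_def)
    then show "C \<in> cls s ` {i \<in> elders. s \<in> lifetime i \<and> r < l i}"
      using eldest_lifetime[OF C] by (intro image_eqI[of _ _ "eldest C"]) auto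
  qed
  then show ?thesis unfolding eq using fin[OF assms] bij_betw_finite bij_betw_same_card by blast
qed


section \<open>The unitriangular comparison map\<close>

definition chain :: "real \<Rightarrow> 'b set \<Rightarrow> 'b set" where
  "chain r C = (\<lambda>s. eldest (parts.up s C)) ` {..r}"

lemma chain_mem:
  assumes C: "C \<in> clusters r" and "j \<in> chain r C"
  shows "j \<in> elders" "r \<in> lifetime j" "elder j (eldest C)"
proof -
  obtain s where s: "s \<le> r" "j = eldest (parts.up s C)" using assms by (auto simp: chain_def)
  note u = parts.up_props[OF s(1) C]
  show j: "j \<in> elders" using eldest_lifetime[OF u(1)] s by simp
  show e: "elder j (eldest C)" using eldest_props(2)[OF u(1)] u(2) eldest_props(1)[OF C] s by auto
  have "r < l (eldest C)" using eldest_lifetime[OF C] by (simp add: lifetime_def)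
  then have "r < l j" using e by (auto simp: elder_def)
  then show "r \<in> lifetime j"
    using lifetime_up[OF _ eldest_lifetime(2)[OF u(1)] s(1)] eldest_lifetime(4)[OF u(1)] s by simp
qed

text \<open>A level strictly between r and h turns the weak bound on the height into the strict one
  of \<open>long_bars\<close>.\<close>

lemma alive_elders_finite:
  assumes "r < h"
  shows "finite {j \<in> elders. r \<in> lifetime j \<and> h \<le> l j}"
proof -
  obtain h' where h': "r < h'" "h' < h" using dense[OF assms] by auto
  have "{j \<in> elders. r \<in> lifetime j \<and> h \<le> l j} \<subseteq> long_bars elders elder_bar r h'"
  proof
    fix j assume "j \<in> {j \<in> elders. r \<in> lifetime j \<and> h \<le> l j}"
    then show "j \<in> long_bars elders elder_bar r h'"
      using lifetime_iff[of j r] h' by (auto simp: long_bars_def elder_bar_def)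
  qed
  then show ?thesis using long_elder_bars[OF h'(1)] finite_subset by blast
qed

lemma elder_le: "elder j i \<Longrightarrow> l i \<le> l j"
  by (auto simp: elder_def)

text \<open>A chain is indexed by a continuum of levels, but its members are alive at r and at least
  as high as the eldest point of C, which is strictly above r.\<close>

lemma finite_chain: 
  assumes "C \<in> clusters r"
  shows "finite (chain r C)"
proof (rule finite_subset)
  have "r < l (eldest C)" using eldest_lifetime[OF assms] by (simp add: lifetime_def)
  then show "finite {j \<in> elders. r \<in> lifetime j \<and> l (eldest C) \<le> l j}" by (rule alive_elders_finite)
qed (use chain_mem[OF assms] elder_le in auto)

text \<open>On the way down from r to s a chain loses exactly the points that have been superseded
  by an elder one.\<close>

lemma chain_up:
  assumes C: "C \<in> clusters r" and "s \<le> r"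
  shows "chain s (parts.up s C) = {j \<in> chain r C. s \<in> lifetime j}"
proof (intro equalityI subsetI)
  fix j assume j: "j \<in> chain s (parts.up s C)"
  then obtain t where t: "t \<le> s" "j = eldest (parts.up t (parts.up s C))" by (auto simp: chain_def)
  then have "j = eldest (parts.up t C)" using parts.up_up[OF t(1) assms(2) C] by simp
  then have "j \<in> chain r C" using t assms by (auto simp: chain_def)
  then show "j \<in> {j \<in> chain r C. s \<in> lifetime j}"
    using chain_mem(2)[OF parts.up_props(1)[OF assms(2) C] j] by simp
next
  fix j assume "j \<in> {j \<in> chain r C. s \<in> lifetime j}"
  then obtain t where t: "t \<le> r" "j = eldest (parts.up t C)" "s \<in> lifetime j" by (auto simp: chain_def)
  show "j \<in> chain s (parts.up s C)"
  proof (cases "t \<le> s")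
    case True
    then show ?thesis using t parts.up_up[OF True assms(2) C] by (auto simp: chain_def image_iff intro!: bexI[of _ t])
  next
    case False
    \<comment> \<open>The point j is eldest at a level t above s and its lifetime contains s, so it
      is also the eldest point of the cluster at s that contains C.\<close>
    note u = parts.up_props[OF t(1) C] and v = parts.up_props[OF assms(2) C]
    have "j \<in> parts.up t C" using eldest_props(1)[OF u(1)] t by simp
    also have "parts.up t C \<subseteq> parts.up s (parts.up t C)" by (rule parts.up_props[OF _ u(1)]) (use False in simp)
    also have "\<dots> = parts.up s C" using parts.up_up[OF _ t(1) C] False by simp
    finally have "parts.up s C = cls s j" using clusters_eq[OF v(1)] by simp
    then have "j = eldest (parts.up s C)" using t(3) by (simp add: lifetime_def)
    then show ?thesis using parts.up_self[OF v(1)] by (auto simp: chain_def image_iff intro!: bexI[of _ s])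
  qed
qed

definition chain_map :: "real \<Rightarrow> ('b set \<Rightarrow> 'k::field) \<Rightarrow> 'b \<Rightarrow> 'k" where
  "chain_map r c i = (\<Sum>C | c C \<noteq> 0. if i \<in> chain r C then c C else 0)"

lemma chain_map_sum:
  assumes "finite A" "{C. c C \<noteq> 0} \<subseteq> A"
  shows "chain_map r c i = (\<Sum>C\<in>A. if i \<in> chain r C then c C else 0)"
  unfolding chain_map_def by (rule sum.mono_neutral_left) (use assms in auto)

lemma chain_map_add:
  fixes c c' :: "'b set \<Rightarrow> 'k::field"
  assumes "finite {s. c s \<noteq> 0}" "finite {s. c' s \<noteq> 0}"
  shows "chain_map r (\<lambda>s. c s + c' s) = (\<lambda>t. chain_map r c t + chain_map r c' t)"
proof
  fix t
  let ?A = "{s. c s \<noteq> 0} \<union> {s. c' s \<noteq> 0}"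
  have A: "finite ?A" using assms by auto
  show "chain_map r (\<lambda>s. c s + c' s) t = chain_map r c t + chain_map r c' t"
    by (subst (1 2 3) chain_map_sum[OF A]) (auto simp: sum.distrib[symmetric] intro!: sum.cong)
qed

lemma chain_map_smult:
  fixes c :: "'b set \<Rightarrow> 'k::field"
  assumes "finite {s. c s \<noteq> 0}"
  shows "chain_map r (\<lambda>s. a * c s) = (\<lambda>t. a * chain_map r c t)"
proof
  fix t
  show "chain_map r (\<lambda>s. a * c s) t = a * chain_map r c t"
    by (subst (1 2) chain_map_sum[OF assms]) (auto simp: sum_distrib_left intro!: sum.cong)
qed

lemma chain_map_delta: "chain_map r (delta C k) = (\<lambda>i. if i \<in> chain r C then k else 0)"
proof
  fix i show "chain_map r (delta C k) i = (if i \<in> chain r C then k else 0)"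
    by (subst chain_map_sum[of "{C}"]) (auto simp: delta_def)
qed

lemma chain_map_zero [simp]: "chain_map r (\<lambda>s. 0) = (\<lambda>i. 0)"
  by (auto simp: chain_map_def)

lemma chain_map_carrier:
  fixes c :: "'b set \<Rightarrow> 'k::field"
  assumes "c \<in> carrier (free_module (clusters r))"
  shows "chain_map r c \<in> carrier (free_module {i \<in> elders. r \<in> lifetime i})"
  using assms
proof (induction rule: free_module_induct)
  case (add c C k)
  have "chain_map r (delta C k) \<in> carrier (free_module {i \<in> elders. r \<in> lifetime i})"
    unfolding chain_map_delta using chain_mem[OF add(2)] finite_chain[OF add(2)]
    by (auto simp: if_distrib cong: if_cong)
  from free_module_closed(1)[OF add(3) this] show ?case using add(1) by (simp add: chain_map_add)
qed simp

text \<open>Truncation deletes the superseded points of a chain, and what remains is the chain of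
  the larger cluster.\<close>

lemma chain_map_up:
  fixes c :: "'b set \<Rightarrow> 'k::field"
  assumes "c \<in> carrier (free_module (clusters r))" "s \<le> r"
  shows "chain_map s (pushforward (parts.up s) c) = (\<lambda>i. if i \<in> elders \<and> s \<in> lifetime i then chain_map r c i else 0)"
  using assms(1)
proof (induction rule: free_module_induct)
  case (add c C k)
  have f: "finite {s. c s \<noteq> 0}" using add by simp
  have "chain_map s (pushforward (parts.up s) (delta C k)) i = 
     (if i \<in> elders \<and> s \<in> lifetime i then chain_map r (delta C k) i else 0)" for i
    unfolding pushforward_delta chain_map_delta chain_up[OF add(2) assms(2)]
    using chain_mem(1)[OF add(2)] by auto
  then show ?case using add(3) f
    by (simp add: pushforward_add chain_map_add finite_support_pushforward fun_eq_iff)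
qed auto

lemma youngest:
  assumes "finite A" "A \<noteq> {}"
  shows "\<exists>a\<in>A. \<forall>b\<in>A. elder (\<phi> b) (\<phi> a)"
  using assms
proof (induction rule: finite_ne_induct)
  case (singleton x)
  then show ?case using elder_order(1) by auto
next
  case (insert x A)
  then obtain a where a: "a \<in> A" "\<forall>b\<in>A. elder (\<phi> b) (\<phi> a)" by auto
  show ?case
  proof (cases "elder (\<phi> x) (\<phi> a)")
    case True
    then show ?thesis using a by auto
  next
    case False
    then have "elder (\<phi> a) (\<phi> x)" using elder_order(4) by blast
    then have "\<forall>b\<in>insert x A. elder (\<phi> b) (\<phi> x)" using a(2) elder_order(1,3) by blast
    then show ?thesis by blast
  qed
qed

text \<open>The map is unitriangular with respect to seniority.\<close>

lemma chain_map_inj: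
  "inj_on (chain_map r) (carrier (free_module (clusters r) :: ('k::field, _) module))"
proof (rule inj_onI, rule ccontr)
  fix c c' :: "'b set \<Rightarrow> 'k"
  assume c: "c \<in> carrier (free_module (clusters r))" "c' \<in> carrier (free_module (clusters r))"
    and eq: "chain_map r c = chain_map r c'" and ne: "c \<noteq> c'"
  define d where "d s = c s + (- 1) * c' s" for s
  have fd: "finite {s. d s \<noteq> 0}" "{s. d s \<noteq> 0} \<subseteq> clusters r"
    using free_module_closed(1)[OF c(1) free_module_closed(2)[OF c(2), of "-1"]]
    unfolding d_def by simp_all
  have "chain_map r d = (\<lambda>i. chain_map r c i + (- 1) * chain_map r c' i)"
    unfolding d_def using c chain_map_add[of c "\<lambda>s. (- 1) * c' s" r] chain_map_smult[of c' r "-1"]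
      finite_support_smult[of c' "-1"] by simp
  then have z: "chain_map r d = (\<lambda>i. 0)" using eq by simp
  have "{s. d s \<noteq> 0} \<noteq> {}" using ne unfolding d_def by (auto simp: fun_eq_iff)
  \<comment> \<open>Among the clusters with nonzero coefficient, C is the one with the youngest
    eldest point. No other chain meets this point, since besides the eldest point of its own cluster
    a chain contains only elder ones.\<close>
  then obtain C where C: "d C \<noteq> 0" "\<And>D. d D \<noteq> 0 \<Longrightarrow> elder (eldest D) (eldest C)"
    using youngest[OF fd(1), of eldest] by auto
  have CP: "C \<in> clusters r" using C fd by auto
  have own: "eldest C \<in> chain r C"
    using parts.up_self[OF CP] by (auto simp: chain_def image_iff intro!: bexI[of _ r])
  have "eldest C \<notin> chain r D" if "d D \<noteq> 0" "D \<noteq> C" for D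
  proof
    assume h: "eldest C \<in> chain r D"
    have DP: "D \<in> clusters r" using that fd by auto
    have "eldest C = eldest D" by (rule elder_order(2)[OF chain_mem(3)[OF DP h] C(2)[OF that(1)]])
    then have "C = D" using eldest_lifetime(3)[OF CP] eldest_lifetime(3)[OF DP] by metis
    then show False using that by simp
  qed
  then have "chain_map r d (eldest C) = (\<Sum>D | d D \<noteq> 0. if D = C then d D else 0)"
    unfolding chain_map_def by (intro sum.cong) (auto simp: own)
  also have "\<dots> = d C" using fd C by simp
  finally show False using z C by simp
qed

text \<open>Elimination: \<open>delta i k\<close> is the image of the cluster of i with coefficient
  k, minus the contributions of the other members of its chain. These are strictly elder than i, and
  the number of elder points alive at r is finite.\<close>

lemma chain_map_surj:
  "chain_map r ` carrier (free_module (clusters r)) = carrier (free_module {i \<in> elders. r \<in> lifetime i} :: ('k::field, _) module)"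
  (is "?I = ?R")
proof (intro equalityI subsetI)
  fix d assume "d \<in> ?I" then show "d \<in> ?R" using chain_map_carrier by blast
next
  have zero_mem: "(\<lambda>i. 0) \<in> ?I" by (rule image_eqI[of _ _ "\<lambda>s. 0"]) auto
  have comb_add: "(\<lambda>i. d i + d' i) \<in> ?I" if d: "d \<in> ?I" "d' \<in> ?I" for d d'
  proof -
    obtain c c' where c: "c \<in> carrier (free_module (clusters r))" "c' \<in> carrier (free_module (clusters r))"
      "d = chain_map r c" "d' = chain_map r c'" using d by blast
    then show ?thesis
      using free_module_closed(1)[OF c(1,2)] by (intro image_eqI[of _ _ "\<lambda>s. c s + c' s"]) (simp_all add: chain_map_add)
  qed
  have comb: "(\<lambda>i. if i \<in> A then k else 0) \<in> ?I" if "finite A" "\<And>j. j \<in> A \<Longrightarrow> delta j k \<in> ?I" for A and k :: 'k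
    using that
  proof (induction A)
    case (insert j A)
    have "(\<lambda>i. if i \<in> insert j A then k else 0) = (\<lambda>i. (if i \<in> A then k else 0) + delta j k i)"
      using insert.hyps by (auto simp: delta_def)
    then show ?case using comb_add[OF insert.IH, of "delta j k"] insert.prems by auto
  qed (simp add: zero_mem)
  have single: "delta i k \<in> ?I" if "i \<in> elders" "r \<in> lifetime i" for i and k :: 'k
    using that
  proof (induction "card {j \<in> elders. r \<in> lifetime j \<and> elder j i}" arbitrary: i k rule: less_induct)
    case less
    have i: "i \<in> S" "r < l i" "eldest (cls r i) = i" using less.prems by (auto simp: elders_def lifetime_def)
    let ?C = "cls r i"
    have C: "?C \<in> clusters r" by (rule cls_in_clusters[OF i(1,2)])
    have "finite {j \<in> elders. r \<in> lifetime j \<and> l i \<le> l j}" by (rule alive_elders_finite[OF i(2)])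
    then have fin: "finite {j \<in> elders. r \<in> lifetime j \<and> elder j i}"
      by (rule rev_finite_subset) (auto dest: elder_le)
    have "delta j (- k) \<in> ?I" if j: "j \<in> chain r ?C - {i}" for j
    proof -
      have jm: "j \<in> elders" "r \<in> lifetime j" "elder j i" using chain_mem[OF C, of j] i(3) j by auto
      have "{m \<in> elders. r \<in> lifetime m \<and> elder m j} \<subset> {m \<in> elders. r \<in> lifetime m \<and> elder m i}"
      proof
        show "{m \<in> elders. r \<in> lifetime m \<and> elder m j} \<subseteq> {m \<in> elders. r \<in> lifetime m \<and> elder m i}"
          using jm elder_order(3) by blast
        have "\<not> elder i j" using elder_order(2) jm(3) j by blast
        then show "{m \<in> elders. r \<in> lifetime m \<and> elder m j} \<noteq> {m \<in> elders. r \<in> lifetime m \<and> elder m i}"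
          using less.prems elder_order(1) by blast
      qed
      then show ?thesis using less.hyps[OF psubset_card_mono[OF fin] jm(1,2)] by blast
    qed
    then have "(\<lambda>m. if m \<in> chain r ?C - {i} then - k else 0) \<in> ?I"
      using finite_chain[OF C] by (intro comb) auto
    moreover have "chain_map r (delta ?C k) \<in> ?I" using delta_in_free_module[OF C] by blast
    ultimately have "(\<lambda>m. chain_map r (delta ?C k) m + (if m \<in> chain r ?C - {i} then - k else 0)) \<in> ?I"
      by (rule comb_add[rotated])
    moreover have "i \<in> chain r ?C"
      using parts.up_self[OF C] i(3) by (auto simp: chain_def image_iff intro!: bexI[of _ r])
    then have "(\<lambda>m. chain_map r (delta ?C k) m + (if m \<in> chain r ?C - {i} then - k else 0)) = delta i k"
      unfolding chain_map_delta by (auto simp: delta_def)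
    ultimately show ?case by simp
  qed
  fix d assume "d \<in> ?R"
  then show "d \<in> ?I"
  proof (induction rule: free_module_induct)
    case zero
    show ?case by (rule zero_mem)
  next
    case (add d i k)
    then have "delta i k \<in> ?I" by (intro single) auto
    then show ?case by (rule comb_add[OF add(3)])
  qed
qed

theorem parts_module_same_barcode:
  "same_barcode (parts.parts_module :: ('k::field, _) persmod) (interval_module elders lifetime)"
proof (rule same_barcode_strict[where F = chain_map])
  show "persistence_module (parts.parts_module :: ('k::field, _) persmod)" by (rule parts.persistence_module_parts)
  show "persistence_module (interval_module elders lifetime :: ('k::field, _) persmod)"
    by (rule persistence_module_interval[OF elder_bar_has_ends])
  show "chain_map r \<in> linear_maps (pm_space (parts.parts_module :: ('k::field, _) persmod) r) (pm_space (interval_module elders lifetime) r)" for r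
    unfolding linear_maps_def parts.parts_module_simps interval_module_simps
    using chain_map_carrier[of _ r] by (intro CollectI conjI funcsetI) (simp_all add: chain_map_add chain_map_smult)
  show "bij_betw (chain_map r) (carrier (pm_space (parts.parts_module :: ('k::field, _) persmod) r)) (carrier (pm_space (interval_module elders lifetime) r))" for r
    unfolding bij_betw_def using chain_map_inj[of r] chain_map_surj[of r] by simp
  show "chain_map s (pm_map parts.parts_module r s x) = pm_map (interval_module elders lifetime) r s (chain_map r x)"
    if "s \<le> r" "x \<in> carrier (pm_space (parts.parts_module :: ('k::field, _) persmod) r)" for r s and x :: "'b set \<Rightarrow> 'k"
    using chain_map_up[of x r s] that by simp
qed

end


section \<open>Cech homology and components\<close>

lemma UN_eq_const: "x \<in> A \<Longrightarrow> (\<And>x. x \<in> A \<Longrightarrow> F x = B) \<Longrightarrow> (\<Union>x\<in>A. F x) = B"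
  by blast

section \<open>Homology of a nerve in degree 0\<close>

definition boundaries :: "'a set set \<Rightarrow> ('a set \<Rightarrow> 'k::field) set" where
  "boundaries U = nerve_boundary ` carrier (nerve_chains1 U)"

definition homology_class :: "'a set set \<Rightarrow> ('a set \<Rightarrow> 'k::field) \<Rightarrow> ('a set \<Rightarrow> 'k) set" where
  "homology_class U c = {h. (\<lambda>s. h s - c s) \<in> boundaries U}"

lemma nerve_boundary_add:
  fixes c d :: "'a set \<times> 'a set \<Rightarrow> 'k::field"
  assumes "c \<in> carrier (nerve_chains1 U)" "d \<in> carrier (nerve_chains1 U)"
  shows "nerve_boundary (\<lambda>s. c s + d s) = (\<lambda>w. nerve_boundary c w + nerve_boundary d w)"
  using assms by (auto simp: nerve_boundary_def nerve_chains1_def pushforward_add)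

lemma nerve_boundary_smult:
  fixes c :: "'a set \<times> 'a set \<Rightarrow> 'k::field"
  assumes "c \<in> carrier (nerve_chains1 U)"
  shows "nerve_boundary (\<lambda>s. a * c s) = (\<lambda>w. a * nerve_boundary c w)"
  using assms by (auto simp: nerve_boundary_def nerve_chains1_def pushforward_smult right_diff_distrib)

lemma boundaries_zero: "(\<lambda>s. 0) \<in> boundaries U"
  unfolding boundaries_def
  by (rule image_eqI[of _ _ "\<lambda>s. 0"]) (auto simp: nerve_boundary_def nerve_chains1_def)

lemma boundaries_add:
  assumes "b \<in> boundaries U" "b' \<in> boundaries U"
  shows "(\<lambda>s. b s + b' s) \<in> boundaries U"
proof -
  obtain c c' where c: "c \<in> carrier (nerve_chains1 U)" "c' \<in> carrier (nerve_chains1 U)"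
    "b = nerve_boundary c" "b' = nerve_boundary c'" using assms by (auto simp: boundaries_def)
  have "(\<lambda>s. c s + c' s) \<in> carrier (nerve_chains1 U)"
    using free_module_closed(1)[of c _ c'] c(1,2) unfolding nerve_chains1_def free_module_simps(2) by blast
  then show ?thesis
    unfolding boundaries_def c(3,4) nerve_boundary_add[OF c(1,2), symmetric] by (rule imageI)
qed

lemma boundaries_smult:
  assumes "b \<in> boundaries U"
  shows "(\<lambda>s. a * b s) \<in> boundaries U"
proof -
  obtain c where c: "c \<in> carrier (nerve_chains1 U)" "b = nerve_boundary c" using assms by (auto simp: boundaries_def)
  have "(\<lambda>s. a * c s) \<in> carrier (nerve_chains1 U)"
    using free_module_closed(2)[of c _ a] c(1) unfolding nerve_chains1_def free_module_simps(3) by blast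
  then show ?thesis
    unfolding boundaries_def c(2) nerve_boundary_smult[OF c(1), symmetric] by (rule imageI)
qed

lemma boundaries_diff:
  assumes "b \<in> boundaries U" "b' \<in> boundaries U"
  shows "(\<lambda>s. b s - b' s) \<in> boundaries U"
  using boundaries_add[OF assms(1) boundaries_smult[OF assms(2), of "-1"]] by simp

lemma boundaries_edge:
  assumes "u \<in> U" "v \<in> U" "u \<inter> v \<noteq> {}"
  shows "(\<lambda>s. delta v k s - delta u k s) \<in> boundaries U"
proof -
  have "(\<lambda>s. delta v k s - delta u k s) = nerve_boundary (delta (u, v) k)"
    by (simp add: nerve_boundary_def pushforward_delta)
  moreover have "delta (u, v) k \<in> carrier (nerve_chains1 U)"
    unfolding nerve_chains1_def by (rule delta_in_free_module) (use assms in simp)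
  ultimately show ?thesis unfolding boundaries_def by (rule image_eqI)
qed

lemma boundaries_carrier: "boundaries U \<subseteq> carrier (nerve_chains0 U)"
proof
  fix b :: "'a set \<Rightarrow> 'b" assume "b \<in> boundaries U"
  then obtain c where c: "c \<in> carrier (free_module {(u, v). u \<in> U \<and> v \<in> U \<and> u \<inter> v \<noteq> {}})" "b = nerve_boundary c"
    by (auto simp: boundaries_def nerve_chains1_def)
  have pc: "pushforward snd c \<in> carrier (free_module {u \<in> U. u \<noteq> {}})" "pushforward fst c \<in> carrier (free_module {u \<in> U. u \<noteq> {}})"
    by (rule pushforward_carrier[OF c(1)]; auto)+
  have "(\<lambda>s. pushforward snd c s + (- 1) * pushforward fst c s) \<in> carrier (free_module {u \<in> U. u \<noteq> {}})"
    using free_module_closed(1)[OF pc(1) free_module_closed(2)[OF pc(2), of "-1"]]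
    unfolding free_module_simps(2,3) .
  then show "b \<in> carrier (nerve_chains0 U)"
    unfolding c(2) nerve_chains0_def nerve_boundary_def by (simp del: free_module_simps)
qed

lemma homology_class_coset:
  "boundaries U +>\<^bsub>nerve_chains0 U\<^esub> c = homology_class U c"
proof (intro equalityI subsetI)
  fix h assume "h \<in> boundaries U +>\<^bsub>nerve_chains0 U\<^esub> c"
  then obtain b where "b \<in> boundaries U" "h = (\<lambda>s. b s + c s)"
    by (auto simp: a_r_coset_def' nerve_chains0_def)
  then show "h \<in> homology_class U c" by (simp add: homology_class_def)
next
  fix h assume "h \<in> homology_class U c"
  then show "h \<in> boundaries U +>\<^bsub>nerve_chains0 U\<^esub> c"
    by (auto simp: a_r_coset_def' nerve_chains0_def homology_class_def intro!: bexI[of _ "\<lambda>s. h s - c s"])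
qed

lemma homology_class_self: "c \<in> homology_class U c"
  by (simp add: homology_class_def boundaries_zero)

lemma homology_class_eq_iff:
  "homology_class U c = homology_class U d \<longleftrightarrow> (\<lambda>s. c s - d s) \<in> boundaries U"
proof
  assume "homology_class U c = homology_class U d"
  then show "(\<lambda>s. c s - d s) \<in> boundaries U" using homology_class_self[of c U] by (simp add: homology_class_def)
next
  assume b: "(\<lambda>s. c s - d s) \<in> boundaries U"
  have "(\<lambda>s. h s - c s) \<in> boundaries U \<longleftrightarrow> (\<lambda>s. h s - d s) \<in> boundaries U" for h
    using boundaries_add[of "\<lambda>s. h s - c s" U, OF _ b] boundaries_diff[of "\<lambda>s. h s - d s" U, OF _ b] by auto
  then show "homology_class U c = homology_class U d" by (simp add: homology_class_def)
qed

lemma nerve_H0_carrier: "carrier (nerve_H0 U) = homology_class U ` carrier (nerve_chains0 U)"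
  unfolding nerve_H0_def quotient_module_def A_RCOSETS_def RCOSETS_def
  by (auto simp: homology_class_coset[symmetric] boundaries_def a_r_coset_def nerve_chains0_def free_module_def)

lemma nerve_H0_add:
  "homology_class U c \<oplus>\<^bsub>nerve_H0 U\<^esub> homology_class U d = homology_class U (\<lambda>s. c s + d s)"
proof -
  have "homology_class U c \<oplus>\<^bsub>nerve_H0 U\<^esub> homology_class U d =
    {(\<lambda>s. h s + k s) | h k. h \<in> homology_class U c \<and> k \<in> homology_class U d}"
    by (auto simp: nerve_H0_def quotient_module_def set_add_def' nerve_chains0_def)
  also have "\<dots> = homology_class U (\<lambda>s. c s + d s)"
  proof (intro equalityI subsetI)
    fix x assume "x \<in> {(\<lambda>s. h s + k s) | h k. h \<in> homology_class U c \<and> k \<in> homology_class U d}"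
    then obtain h k where "x = (\<lambda>s. h s + k s)" "(\<lambda>s. h s - c s) \<in> boundaries U" "(\<lambda>s. k s - d s) \<in> boundaries U"
      by (auto simp: homology_class_def)
    then show "x \<in> homology_class U (\<lambda>s. c s + d s)"
      using boundaries_add[of "\<lambda>s. h s - c s" U "\<lambda>s. k s - d s"] by (simp add: homology_class_def algebra_simps)
  next
    fix x assume x: "x \<in> homology_class U (\<lambda>s. c s + d s)"
    have "(\<lambda>s. x s - d s) \<in> homology_class U c" using x by (simp add: homology_class_def algebra_simps)
    moreover have "x = (\<lambda>s. (x s - d s) + d s)" by simp
    ultimately show "x \<in> {(\<lambda>s. h s + k s) | h k. h \<in> homology_class U c \<and> k \<in> homology_class U d}"
      using homology_class_self[of d U] by (intro CollectI exI conjI)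
  qed
  finally show ?thesis .
qed

lemma nerve_H0_smult:
  "a \<odot>\<^bsub>nerve_H0 U\<^esub> homology_class U c = homology_class U (\<lambda>s. a * c s)"
proof -
  have "a \<odot>\<^bsub>nerve_H0 U\<^esub> homology_class U c = (\<Union>x\<in>homology_class U c. homology_class U (\<lambda>s. a * x s))"
    by (simp add: nerve_H0_def quotient_module_def nerve_chains0_def flip: boundaries_def)
       (simp flip: homology_class_coset add: nerve_chains0_def)
  also have "\<dots> = homology_class U (\<lambda>s. a * c s)"
  proof (rule UN_eq_const[OF homology_class_self])
    show "homology_class U (\<lambda>s. a * x s) = homology_class U (\<lambda>s. a * c s)" if "x \<in> homology_class U c" for x
    unfolding homology_class_eq_iff
    using that boundaries_smult[of "\<lambda>s. x s - c s" U a] by (simp add: homology_class_def right_diff_distrib)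
  qed
  finally show ?thesis .
qed

lemma nerve_H0_closed:
  fixes A B :: "('a set \<Rightarrow> 'k::field) set"
  assumes "A \<in> carrier (nerve_H0 U)"
  shows "B \<in> carrier (nerve_H0 U) \<Longrightarrow> A \<oplus>\<^bsub>nerve_H0 U\<^esub> B \<in> carrier (nerve_H0 U)"
    "a \<odot>\<^bsub>nerve_H0 U\<^esub> A \<in> carrier (nerve_H0 U)"
proof -
  obtain c where c: "c \<in> carrier (nerve_chains0 U)" "A = homology_class U c"
    using assms by (auto simp: nerve_H0_carrier)
  show "A \<oplus>\<^bsub>nerve_H0 U\<^esub> B \<in> carrier (nerve_H0 U)" if "B \<in> carrier (nerve_H0 U)"
  proof -
    obtain d where d: "d \<in> carrier (nerve_chains0 U)" "B = homology_class U d"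
      using \<open>B \<in> carrier (nerve_H0 U)\<close> by (auto simp: nerve_H0_carrier)
    have "(\<lambda>s. c s + d s) \<in> carrier (nerve_chains0 U)"
      using free_module_closed(1)[of c _ d] c(1) d(1) unfolding nerve_chains0_def free_module_simps(2) by blast
    then show ?thesis unfolding c(2) d(2) nerve_H0_add nerve_H0_carrier by (rule imageI)
  qed
  have "(\<lambda>s. a * c s) \<in> carrier (nerve_chains0 U)"
    using free_module_closed(2)[of c _ a] c(1) unfolding nerve_chains0_def free_module_simps(3) by blast
  then show "a \<odot>\<^bsub>nerve_H0 U\<^esub> A \<in> carrier (nerve_H0 U)"
    unfolding c(2) nerve_H0_smult nerve_H0_carrier by (rule imageI)
qed

definition member_above :: "'a set set \<Rightarrow> 'a set \<Rightarrow> 'a set" where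
  "member_above U v = (SOME u. u \<in> U \<and> v \<subseteq> u)"

lemma member_above:
  assumes "refines V U" "v \<in> V"
  shows "member_above U v \<in> U" "v \<subseteq> member_above U v"
  using someI_ex[of "\<lambda>u. u \<in> U \<and> v \<subseteq> u"] assms unfolding refines_def member_above_def by blast+

text \<open>Stands in for contiguity of simplicial maps: in degree 0 it is enough that the two
  images of each vertex are homologous.\<close>

lemma pushforward_homologous:
  fixes c :: "'s \<Rightarrow> 'k::field"
  assumes c: "c \<in> carrier (free_module A)"
    and h: "\<And>a k. a \<in> A \<Longrightarrow> (\<lambda>s. delta (p a) k s - delta (q a) k s) \<in> (boundaries U :: ('a set \<Rightarrow> 'k) set)"
  shows "homology_class U (pushforward p c) = homology_class U (pushforward q c)"
  unfolding homology_class_eq_iff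
  using c
proof (induction rule: free_module_induct)
  case zero
  show ?case by (simp add: boundaries_zero)
next
  case (add c a k)
  have "finite {s. c s \<noteq> 0}" using add by simp
  then have "(\<lambda>s. pushforward p (\<lambda>s. c s + delta a k s) s - pushforward q (\<lambda>s. c s + delta a k s) s) =
     (\<lambda>s. (pushforward p c s - pushforward q c s) + (delta (p a) k s - delta (q a) k s))"
    by (simp add: pushforward_add pushforward_delta algebra_simps)
  then show ?case using boundaries_add[OF add(3) h[OF add(2), of k]] by simp
qed

text \<open>Members that meet are contained in members that meet, so the choice of larger members
  maps edges to edges.\<close>

lemma pushforward_boundary:
  fixes b :: "'a set \<Rightarrow> 'k::field"
  assumes ref: "refines V U" and b: "b \<in> boundaries V"
  shows "pushforward (member_above U) b \<in> boundaries U"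
proof -
  obtain e where e: "e \<in> carrier (nerve_chains1 V)" "b = nerve_boundary e" using b by (auto simp: boundaries_def)
  let ?p = "\<lambda>(u, v). (member_above U u, member_above U v)"
  have fe: "finite {s. e s \<noteq> 0}" using e by (simp add: nerve_chains1_def)
  have "pushforward ?p e \<in> carrier (nerve_chains1 U)"
    unfolding nerve_chains1_def
  proof (rule pushforward_carrier)
    show "e \<in> carrier (free_module {(u, v). u \<in> V \<and> v \<in> V \<and> u \<inter> v \<noteq> {}})" using e by (simp add: nerve_chains1_def)
    show "?p ` {(u, v). u \<in> V \<and> v \<in> V \<and> u \<inter> v \<noteq> {}} \<subseteq> {(u, v). u \<in> U \<and> v \<in> U \<and> u \<inter> v \<noteq> {}}"
      using member_above[OF ref] by fast
  qed
  moreover have "pushforward (member_above U) b = nerve_boundary (pushforward ?p e)"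
    unfolding e(2) nerve_boundary_def
    using fe by (simp add: pushforward_diff finite_support_pushforward pushforward_comp case_prod_unfold)
  ultimately show ?thesis by (simp add: boundaries_def)
qed

lemma boundaries_finite: "b \<in> boundaries U \<Longrightarrow> finite {s. b s \<noteq> 0}"
  using boundaries_carrier[of U] by (auto simp: nerve_chains0_def)

text \<open>The union in \<open>nerve_map\<close> runs over the representatives of a class; they
  differ by boundaries, so all its terms agree.\<close>

lemma nerve_map_class:
  fixes c :: "'a set \<Rightarrow> 'k::field"
  assumes ref: "refines V U" and c: "c \<in> carrier (nerve_chains0 V)"
  shows "nerve_map V U (homology_class V c) = homology_class U (pushforward (member_above U) c)"
proof -
  have eq: "homology_class U (pushforward (member_above U) d) = homology_class U (pushforward (member_above U) c)"
    if d: "d \<in> homology_class V c" for d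
  proof -
    have b: "(\<lambda>s. d s - c s) \<in> boundaries V" using d by (simp add: homology_class_def)
    have fc: "finite {s. c s \<noteq> 0}" using c by (simp add: nerve_chains0_def)
    have "finite {s. d s \<noteq> 0}"
      using finite_support_add[OF boundaries_finite[OF b] fc] by simp
    then show ?thesis
      unfolding homology_class_eq_iff using pushforward_boundary[OF ref b] fc by (simp add: pushforward_diff)
  qed
  have "nerve_map V U (homology_class V c) =
     (\<Union>d\<in>homology_class V c. homology_class U (pushforward (member_above U) d))"
    unfolding nerve_map_def boundaries_def[symmetric] homology_class_coset member_above_def ..
  then show ?thesis using UN_eq_const[OF homology_class_self eq] by simp
qed

lemma pushforward_above_carrier:
  assumes "refines V U" "c \<in> carrier (nerve_chains0 V)"
  shows "pushforward (member_above U) c \<in> carrier (nerve_chains0 U)"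
  using assms(2) unfolding nerve_chains0_def
  by (rule pushforward_carrier) (use member_above[OF assms(1)] in fast)

lemma nerve_map_linear:
  assumes ref: "refines V U"
  shows "nerve_map V U \<in> linear_maps (nerve_H0 V) (nerve_H0 U :: ('k::field, _) module)"
  unfolding linear_maps_def
proof (intro CollectI conjI funcsetI ballI allI)
  fix A :: "('a set \<Rightarrow> 'k) set" assume "A \<in> carrier (nerve_H0 V)"
  then obtain c where c: "c \<in> carrier (nerve_chains0 V)" "A = homology_class V c" by (auto simp: nerve_H0_carrier)
  then show "nerve_map V U A \<in> carrier (nerve_H0 U)"
    unfolding c(2) nerve_map_class[OF ref c(1)] nerve_H0_carrier
    by (intro imageI pushforward_above_carrier[OF ref])
next
  fix A B :: "('a set \<Rightarrow> 'k) set" assume "A \<in> carrier (nerve_H0 V)" "B \<in> carrier (nerve_H0 V)"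
  then obtain c d where c: "c \<in> carrier (nerve_chains0 V)" "A = homology_class V c"
    and d: "d \<in> carrier (nerve_chains0 V)" "B = homology_class V d" by (auto simp: nerve_H0_carrier)
  have "(\<lambda>s. c s + d s) \<in> carrier (nerve_chains0 V)"
    using free_module_closed(1)[of c _ d] c(1) d(1) unfolding nerve_chains0_def free_module_simps(2) by blast
  then show "nerve_map V U (A \<oplus>\<^bsub>nerve_H0 V\<^esub> B) = nerve_map V U A \<oplus>\<^bsub>nerve_H0 U\<^esub> nerve_map V U B"
    using c d by (simp add: nerve_H0_add nerve_map_class[OF ref] nerve_chains0_def pushforward_add)
next
  fix a and A :: "('a set \<Rightarrow> 'k) set" assume "A \<in> carrier (nerve_H0 V)"
  then obtain c where c: "c \<in> carrier (nerve_chains0 V)" "A = homology_class V c" by (auto simp: nerve_H0_carrier)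
  have "(\<lambda>s. a * c s) \<in> carrier (nerve_chains0 V)"
    using free_module_closed(2)[of c _ a] c(1) unfolding nerve_chains0_def free_module_simps(3) by blast
  then show "nerve_map V U (a \<odot>\<^bsub>nerve_H0 V\<^esub> A) = a \<odot>\<^bsub>nerve_H0 U\<^esub> nerve_map V U A"
    using c by (simp add: nerve_H0_smult nerve_map_class[OF ref] nerve_chains0_def pushforward_smult)
qed

lemma refines_trans: "refines V W \<Longrightarrow> refines W U \<Longrightarrow> refines V U"
  unfolding refines_def by (meson order_trans)

text \<open>For a vertex v, the member chosen in two steps and the one chosen at once both contain
  v, hence are joined by an edge.\<close>

lemma nerve_map_comp:
  fixes A :: "('a set \<Rightarrow> 'k::field) set"
  assumes VW: "refines V W" and WU: "refines W U" and A: "A \<in> carrier (nerve_H0 V)"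
  shows "nerve_map W U (nerve_map V W A) = nerve_map V U A"
proof -
  obtain c where c: "c \<in> carrier (nerve_chains0 V)" "A = homology_class V c" using A by (auto simp: nerve_H0_carrier)
  have VU: "refines V U" by (rule refines_trans[OF VW WU])
  have "nerve_map W U (nerve_map V W A) = homology_class U (pushforward (member_above U) (pushforward (member_above W) c))"
    unfolding c(2) nerve_map_class[OF VW c(1)] nerve_map_class[OF WU pushforward_above_carrier[OF VW c(1)]] ..
  also have "\<dots> = homology_class U (pushforward (\<lambda>v. member_above U (member_above W v)) c)"
    using c(1) by (simp add: pushforward_comp nerve_chains0_def)
  also have "\<dots> = homology_class U (pushforward (member_above U) c)"
  proof (rule pushforward_homologous)
    show "c \<in> carrier (free_module {v \<in> V. v \<noteq> {}})" using c by (simp add: nerve_chains0_def)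
    fix v and k :: 'k assume v: "v \<in> {v \<in> V. v \<noteq> {}}"
    note 1 = member_above[OF VW, of v] and 2 = member_above[OF WU, of "member_above W v"] and 3 = member_above[OF VU, of v]
    show "(\<lambda>s. delta (member_above U (member_above W v)) k s - delta (member_above U v) k s) \<in> boundaries U"
      by (rule boundaries_edge) (use 1 2 3 v in blast)+
  qed
  also have "\<dots> = nerve_map V U A" unfolding c(2) nerve_map_class[OF VU c(1)] ..
  finally show ?thesis .
qed

section \<open>Compatible families over all open covers\<close>

lemma cech_carrierD:
  assumes "x \<in> carrier (cech_H0 Y)"
  shows "U \<in> open_covers Y \<Longrightarrow> x U \<in> carrier (nerve_H0 U)"
    "U \<in> open_covers Y \<Longrightarrow> V \<in> open_covers Y \<Longrightarrow> refines V U \<Longrightarrow> nerve_map V U (x V) = x U"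
    "x \<in> extensional (open_covers Y)"
  using assms by (auto simp: cech_H0_def PiE_iff)

lemma cech_carrierI:
  assumes "\<And>U. U \<in> open_covers Y \<Longrightarrow> x U \<in> carrier (nerve_H0 U)"
    "\<And>U V. U \<in> open_covers Y \<Longrightarrow> V \<in> open_covers Y \<Longrightarrow> refines V U \<Longrightarrow> nerve_map V U (x V) = x U"
    "x \<in> extensional (open_covers Y)"
  shows "x \<in> carrier (cech_H0 Y)"
  using assms by (auto simp: cech_H0_def PiE_iff)

lemma cech_ops [simp]:
  "x \<oplus>\<^bsub>cech_H0 Y\<^esub> y = (\<lambda>U\<in>open_covers Y. x U \<oplus>\<^bsub>nerve_H0 U\<^esub> y U)"
  "a \<odot>\<^bsub>cech_H0 Y\<^esub> x = (\<lambda>U\<in>open_covers Y. a \<odot>\<^bsub>nerve_H0 U\<^esub> x U)"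
  by (simp_all add: cech_H0_def)

lemma H0_superlevel_simps [simp]:
  "pm_space (H0_superlevel X f) r = cech_H0 (superlevel X f r)"
  "pm_map (H0_superlevel X f) r s = cech_H0_inclusion (superlevel X f r) (superlevel X f s)"
  by (simp_all add: H0_superlevel_def)

lemma topspace_superlevel [simp]: "topspace (superlevel X f r) = {x \<in> topspace X. r \<le> f x}"
  by (auto simp: superlevel_def)

definition restrict_cover :: "'a topology \<Rightarrow> 'a set set \<Rightarrow> 'a set set" where
  "restrict_cover Y U = (\<lambda>u. topspace Y \<inter> u) ` U"

lemma cech_H0_inclusion_eq:
  "cech_H0_inclusion Y Z x = (\<lambda>U\<in>open_covers Z. nerve_map (restrict_cover Y U) U (x (restrict_cover Y U)))"
  by (simp add: cech_H0_inclusion_def restrict_cover_def)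

lemma restrict_coverI: "u \<in> U \<Longrightarrow> topspace Y \<inter> u \<in> restrict_cover Y U"
  by (simp add: restrict_cover_def)

lemma restrict_coverE:
  assumes "v \<in> restrict_cover Y U"
  obtains u where "u \<in> U" "v = topspace Y \<inter> u"
  using assms by (auto simp: restrict_cover_def)

lemma refinesE:
  assumes "refines V U" "v \<in> V"
  obtains u where "u \<in> U" "v \<subseteq> u"
  using assms by (auto simp: refines_def)

lemma restrict_cover_refines: "refines (restrict_cover Y U) U"
  by (auto simp: refines_def restrict_cover_def)

lemma restrict_cover_mono:
  assumes "refines V U"
  shows "refines (restrict_cover Y V) (restrict_cover Y U)"
  unfolding refines_def
proof
  fix v' assume "v' \<in> restrict_cover Y V"
  then obtain v where v: "v \<in> V" "v' = topspace Y \<inter> v" by (rule restrict_coverE)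
  obtain u where u: "u \<in> U" "v \<subseteq> u" by (rule refinesE[OF assms v(1)])
  have "v' \<subseteq> topspace Y \<inter> u" using v u by auto
  then show "\<exists>u'\<in>restrict_cover Y U. v' \<subseteq> u'" using restrict_coverI[OF u(1), of Y] by (rule rev_bexI[rotated])
qed

lemma restrict_cover_open:
  assumes "s \<le> r" "U \<in> open_covers (superlevel X f s)"
  shows "restrict_cover (superlevel X f r) U \<in> open_covers (superlevel X f r)"
proof -
  have "openin (superlevel X f r) (topspace (superlevel X f r) \<inter> u)" if u: "u \<in> U" for u
  proof -
    obtain t where t: "openin X t" "u = t \<inter> {x \<in> topspace X. s \<le> f x}"
      using assms(2) u by (auto simp: open_covers_def superlevel_def openin_subtopology)
    then show ?thesis
      unfolding topspace_superlevel unfolding superlevel_def openin_subtopology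
      using assms(1) by (intro exI[of _ t]) auto
  qed
  moreover have "\<Union> (restrict_cover (superlevel X f r) U) = topspace (superlevel X f r)"
    using assms by (force simp: open_covers_def restrict_cover_def)
  ultimately show ?thesis by (auto simp: open_covers_def restrict_cover_def)
qed

lemma restrict_cover_self: "U \<in> open_covers Y \<Longrightarrow> restrict_cover Y U = U"
  unfolding restrict_cover_def open_covers_def by (force simp: Int_absorb1 openin_subset)

lemma restrict_cover_restrict:
  "s \<le> r \<Longrightarrow> restrict_cover (superlevel X f r) (restrict_cover (superlevel X f s) U) = restrict_cover (superlevel X f r) U"
  unfolding restrict_cover_def image_image by (intro image_cong) auto

lemma refines_refl: "refines U U"
  by (auto simp: refines_def)

text \<open>The laws of composition reduce to \<open>nerve_map_comp\<close>, because restriction of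
  covers respects refinement and restricting in two steps is restricting once.\<close>

lemma persistence_module_H0:
  "persistence_module (H0_superlevel X f :: ('k::field, 'a set set \<Rightarrow> ('a set \<Rightarrow> 'k) set) persmod)"
  unfolding persistence_module_def H0_superlevel_simps
proof (intro conjI allI ballI impI)
  fix r and x y :: "'a set set \<Rightarrow> ('a set \<Rightarrow> 'k) set"
  assume x: "x \<in> carrier (cech_H0 (superlevel X f r))" and y: "y \<in> carrier (cech_H0 (superlevel X f r))"
  show "x \<oplus>\<^bsub>cech_H0 (superlevel X f r)\<^esub> y \<in> carrier (cech_H0 (superlevel X f r))"
    using cech_carrierD[OF x] cech_carrierD[OF y]
    by (intro cech_carrierI) (auto simp: nerve_H0_closed linear_mapsD(2)[OF nerve_map_linear])
next
  fix r a and x :: "'a set set \<Rightarrow> ('a set \<Rightarrow> 'k) set"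
  assume x: "x \<in> carrier (cech_H0 (superlevel X f r))"
  show "a \<odot>\<^bsub>cech_H0 (superlevel X f r)\<^esub> x \<in> carrier (cech_H0 (superlevel X f r))"
    using cech_carrierD[OF x]
    by (intro cech_carrierI) (auto simp: nerve_H0_closed linear_mapsD(3)[OF nerve_map_linear])
next
  fix r s :: real assume sr: "s \<le> r"
  let ?Y = "superlevel X f r" and ?Z = "superlevel X f s"
  show "cech_H0_inclusion ?Y ?Z \<in> linear_maps (cech_H0 ?Y) (cech_H0 ?Z :: ('k, _) module)"
    unfolding linear_maps_def
  proof (intro CollectI conjI funcsetI ballI allI)
    fix x :: "'a set set \<Rightarrow> ('a set \<Rightarrow> 'k) set" assume x: "x \<in> carrier (cech_H0 ?Y)"
    note xD = cech_carrierD[OF x]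
    show "cech_H0_inclusion ?Y ?Z x \<in> carrier (cech_H0 ?Z)"
      unfolding cech_H0_inclusion_eq
    proof (rule cech_carrierI)
      fix U V assume U: "U \<in> open_covers ?Z" and V: "V \<in> open_covers ?Z" and ref: "refines V U"
      let ?U = "restrict_cover ?Y U" and ?V = "restrict_cover ?Y V"
      note rU = restrict_cover_open[OF sr U] and rV = restrict_cover_open[OF sr V]
      \<comment> \<open>Both ways around the square of refinements from the restricted cover
        \<open>?V\<close> to \<open>U\<close> equal the direct map.\<close>
      have "nerve_map V U (nerve_map ?V V (x ?V)) = nerve_map ?V U (x ?V)"
        by (rule nerve_map_comp[OF restrict_cover_refines ref xD(1)[OF rV]])
      also have "\<dots> = nerve_map ?U U (nerve_map ?V ?U (x ?V))"
        by (rule nerve_map_comp[OF restrict_cover_mono[OF ref] restrict_cover_refines xD(1)[OF rV], symmetric])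
      also have "\<dots> = nerve_map ?U U (x ?U)" using xD(2)[OF rU rV restrict_cover_mono[OF ref]] by simp
      finally show "nerve_map V U ((\<lambda>U\<in>open_covers ?Z. nerve_map (restrict_cover ?Y U) U (x (restrict_cover ?Y U))) V) =
         (\<lambda>U\<in>open_covers ?Z. nerve_map (restrict_cover ?Y U) U (x (restrict_cover ?Y U))) U"
        using U V by simp
    next
      fix U assume U: "U \<in> open_covers ?Z"
      show "(\<lambda>U\<in>open_covers ?Z. nerve_map (restrict_cover ?Y U) U (x (restrict_cover ?Y U))) U \<in> carrier (nerve_H0 U)"
        using linear_mapsD(1)[OF nerve_map_linear[OF restrict_cover_refines] xD(1)[OF restrict_cover_open[OF sr U]]] U
        by simp
    qed simp
  next
    fix x y :: "'a set set \<Rightarrow> ('a set \<Rightarrow> 'k) set"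
    assume x: "x \<in> carrier (cech_H0 ?Y)" and y: "y \<in> carrier (cech_H0 ?Y)"
    show "cech_H0_inclusion ?Y ?Z (x \<oplus>\<^bsub>cech_H0 ?Y\<^esub> y) = cech_H0_inclusion ?Y ?Z x \<oplus>\<^bsub>cech_H0 ?Z\<^esub> cech_H0_inclusion ?Y ?Z y"
      unfolding cech_H0_inclusion_eq cech_ops
      by (intro restrict_ext)
         (simp add: restrict_cover_open[OF sr] linear_mapsD(2)[OF nerve_map_linear[OF restrict_cover_refines]]
            cech_carrierD(1)[OF x] cech_carrierD(1)[OF y])
  next
    fix a and x :: "'a set set \<Rightarrow> ('a set \<Rightarrow> 'k) set"
    assume x: "x \<in> carrier (cech_H0 ?Y)"
    show "cech_H0_inclusion ?Y ?Z (a \<odot>\<^bsub>cech_H0 ?Y\<^esub> x) = a \<odot>\<^bsub>cech_H0 ?Z\<^esub> cech_H0_inclusion ?Y ?Z x"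
      unfolding cech_H0_inclusion_eq cech_ops
      by (intro restrict_ext)
         (simp add: restrict_cover_open[OF sr] linear_mapsD(3)[OF nerve_map_linear[OF restrict_cover_refines]]
            cech_carrierD(1)[OF x])
  qed
next
  fix r and x :: "'a set set \<Rightarrow> ('a set \<Rightarrow> 'k) set"
  let ?Y = "superlevel X f r"
  assume x: "x \<in> carrier (cech_H0 ?Y)"
  note xD = cech_carrierD[OF x]
  have "(\<lambda>U\<in>open_covers ?Y. nerve_map (restrict_cover ?Y U) U (x (restrict_cover ?Y U))) = (\<lambda>U\<in>open_covers ?Y. x U)"
    by (intro restrict_ext) (simp add: restrict_cover_self xD(2)[OF _ _ refines_refl])
  then show "cech_H0_inclusion ?Y ?Y x = x"
    unfolding cech_H0_inclusion_eq using extensional_restrict[OF xD(3)] by simp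
next
  fix r s t and x :: "'a set set \<Rightarrow> ('a set \<Rightarrow> 'k) set"
  let ?Y = "superlevel X f r" and ?Z = "superlevel X f s" and ?W = "superlevel X f t"
  assume h: "t \<le> s \<and> s \<le> r" and x: "x \<in> carrier (cech_H0 ?Y)"
  show "cech_H0_inclusion ?Z ?W (cech_H0_inclusion ?Y ?Z x) = cech_H0_inclusion ?Y ?W x"
    unfolding cech_H0_inclusion_eq
  proof (intro restrict_ext)
    fix U assume U: "U \<in> open_covers ?W"
    let ?U = "restrict_cover ?Z U"
    have o: "?U \<in> open_covers ?Z" "restrict_cover ?Y U \<in> open_covers ?Y" using restrict_cover_open[OF _ U] h by auto
    have e: "restrict_cover ?Y ?U = restrict_cover ?Y U" using restrict_cover_restrict h by blast
    have "refines (restrict_cover ?Y U) ?U" using restrict_cover_refines[of ?Y ?U] e by simp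
    from nerve_map_comp[OF this restrict_cover_refines cech_carrierD(1)[OF x o(2)]]
    show "nerve_map ?U U ((\<lambda>U\<in>open_covers ?Z. nerve_map (restrict_cover ?Y U) U (x (restrict_cover ?Y U))) ?U)
       = nerve_map (restrict_cover ?Y U) U (x (restrict_cover ?Y U))"
      using o e by simp
  qed
qed


section \<open>Closed superlevel sets and the components of open ones\<close>

locale superlevel_parts = nested_parts P for P :: "real \<Rightarrow> 'a set set" +
  fixes X :: "'a topology" and f :: "'a \<Rightarrow> real"
  assumes part_open: "C \<in> P s \<Longrightarrow> openin X C"
    and part_connected: "C \<in> P s \<Longrightarrow> connectedin X C"
    and part_union: "\<Union> (P s) = {x \<in> topspace X. s < f x}"
begin

lemma up_of_subset: 
  assumes "v \<noteq> {}" "v \<subseteq> D" "D \<in> P s"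
  shows "up s v = D"
proof -
  have uniq: "F = D" if "F \<in> P s \<and> v \<subseteq> F" for F
    by (rule parts_disjoint[OF conjunct1[OF that] assms(3)]) (use that assms in blast)
  show ?thesis unfolding up_def by (rule the_equality) (use assms in simp, erule uniq)
qed

text \<open>The traces on f \<ge> r of the components of f > s; the gap s < r is what makes them a
  cover.\<close>

definition part_cover :: "real \<Rightarrow> real \<Rightarrow> 'a set set" where
  "part_cover r s = restrict_cover (superlevel X f r) (P s)"

lemma part_cover_refines: "refines (part_cover r s) (P s)"
  unfolding part_cover_def by (rule restrict_cover_refines)

lemma part_cover_open:
  assumes "s < r"
  shows "part_cover r s \<in> open_covers (superlevel X f r)"
proof -
  have "openin (superlevel X f r) (topspace (superlevel X f r) \<inter> C)" if "C \<in> P s" for C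
    unfolding topspace_superlevel unfolding superlevel_def openin_subtopology
    using part_open[OF that] by blast
  moreover have "\<Union> (part_cover r s) = topspace (superlevel X f r) \<inter> \<Union> (P s)"
    by (auto simp: part_cover_def restrict_cover_def)
  moreover have "topspace (superlevel X f r) \<inter> \<Union> (P s) = topspace (superlevel X f r)"
    unfolding part_union using assms by auto
  ultimately show ?thesis by (auto simp: open_covers_def part_cover_def restrict_cover_def)
qed

text \<open>Distinct parts are disjoint, so every edge of the nerve is a loop, and loops have zero
  boundary.\<close>

lemma part_cover_trivial: "boundaries (part_cover r s) = {\<lambda>s. 0 :: 'k::field}"
proof (intro equalityI subsetI)
  fix b :: "'a set \<Rightarrow> 'k" assume "b \<in> boundaries (part_cover r s)"
  then obtain e where e: "e \<in> carrier (nerve_chains1 (part_cover r s))" "b = nerve_boundary e"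
    by (auto simp: boundaries_def)
  have "snd s' = fst s'" if "e s' \<noteq> 0" for s'
  proof -
    have "fst s' \<in> part_cover r s \<and> snd s' \<in> part_cover r s \<and> fst s' \<inter> snd s' \<noteq> {}"
    proof -
      have "s' \<in> {(u, v). u \<in> part_cover r s \<and> v \<in> part_cover r s \<and> u \<inter> v \<noteq> {}}"
        using e(1) that unfolding nerve_chains1_def free_module_simps by blast
      then show ?thesis by (cases s') simp
    qed
    then obtain C D where CD: "C \<in> P s" "fst s' = topspace (superlevel X f r) \<inter> C"
      "D \<in> P s" "snd s' = topspace (superlevel X f r) \<inter> D" "fst s' \<inter> snd s' \<noteq> {}"
      unfolding part_cover_def by (elim conjE restrict_coverE)
    have "C = D" by (rule parts_disjoint[OF CD(1,3)]) (use CD in auto)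
    then show ?thesis using CD by simp
  qed
  then have "pushforward snd e = pushforward fst e" by (rule pushforward_cong)
  then show "b \<in> {\<lambda>s. 0}" by (simp add: e(2) nerve_boundary_def)
qed (use boundaries_zero in auto)

text \<open>\<open>the_elem\<close> is meaningful because boundaries vanish on this cover, so that
  each class is a single chain; \<open>up s\<close> passes from the trace of a part to the part
  itself.\<close>

definition to_parts :: "real \<Rightarrow> real \<Rightarrow> ('a set set \<Rightarrow> ('a set \<Rightarrow> 'k::field) set) \<Rightarrow> 'a set \<Rightarrow> 'k" where
  "to_parts r s x = pushforward (up s) (the_elem (x (part_cover r s)))"

text \<open>The value can be computed on any cover subordinate to the parts. Naturality and the
  round trips each use a cover adapted to their own situation.\<close>

lemma to_parts_eq:
  fixes x :: "'a set set \<Rightarrow> ('a set \<Rightarrow> 'k::field) set"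
  assumes sr: "s < r" and x: "x \<in> carrier (cech_H0 (superlevel X f r))"
    and V: "V \<in> open_covers (superlevel X f r)" "refines V (P s)"
    and c: "c \<in> carrier (nerve_chains0 V)" "x V = homology_class V c"
  shows "to_parts r s x = pushforward (up s) c"
proof -
  let ?W = "part_cover r s"
  have ref: "refines V ?W"
    unfolding refines_def
  proof
    fix v assume v: "v \<in> V"
    obtain C where C: "C \<in> P s" "v \<subseteq> C" by (rule refinesE[OF V(2) v])
    have "v \<subseteq> topspace (superlevel X f r)" using V(1) v unfolding open_covers_def by blast
    then have "v \<subseteq> topspace (superlevel X f r) \<inter> C" using C(2) by blast
    then show "\<exists>u\<in>?W. v \<subseteq> u"
      unfolding part_cover_def using restrict_coverI[OF C(1)] by (rule rev_bexI[rotated])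
  qed
  have "x ?W = nerve_map V ?W (x V)" using cech_carrierD(2)[OF x part_cover_open[OF sr] V(1) ref] by simp
  also have "\<dots> = homology_class ?W (pushforward (member_above ?W) c)"
    unfolding c(2) by (rule nerve_map_class[OF ref c(1)])
  also have "\<dots> = {pushforward (member_above ?W) c}"
    unfolding homology_class_def part_cover_trivial by (auto simp: fun_eq_iff)
  finally have "to_parts r s x = pushforward (up s) (pushforward (member_above ?W) c)"
    by (simp add: to_parts_def)
  also have "\<dots> = pushforward (\<lambda>v. up s (member_above ?W v)) c"
    using c(1) by (simp add: pushforward_comp nerve_chains0_def)
  \<comment> \<open>The trace chosen for v and v itself lie in the same part, which
    \<open>up s\<close> recovers from either.\<close>
  also have "\<dots> = pushforward (up s) c"
  proof (rule pushforward_cong)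
    fix v assume "c v \<noteq> 0"
    then have v: "v \<in> V" "v \<noteq> {}" using c(1) by (auto simp: nerve_chains0_def)
    note m = member_above[OF ref v(1)]
    obtain D where D: "D \<in> P s" "member_above ?W v \<subseteq> D" by (rule refinesE[OF part_cover_refines m(1)])
    have "up s (member_above ?W v) = D" by (rule up_of_subset[OF _ D(2,1)]) (use m v in blast)
    moreover have "up s v = D" by (rule up_of_subset[OF v(2) _ D(1)]) (use m D in blast)
    ultimately show "up s (member_above ?W v) = up s v" by simp
  qed
  finally show ?thesis .
qed

lemma nerve_repr:
  assumes "x \<in> carrier (cech_H0 Y)" "U \<in> open_covers Y"
  obtains c where "c \<in> carrier (nerve_chains0 U)" "x U = homology_class U c"
  using cech_carrierD(1)[OF assms] by (auto simp: nerve_H0_carrier)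

lemma pushforward_up_carrier:
  assumes "refines V (P s)" "c \<in> carrier (nerve_chains0 V)"
  shows "pushforward (up s) c \<in> carrier (free_module (P s))"
proof (rule pushforward_carrier)
  show "c \<in> carrier (free_module {v \<in> V. v \<noteq> {}})" using assms by (simp add: nerve_chains0_def)
  show "up s ` {v \<in> V. v \<noteq> {}} \<subseteq> P s"
  proof
    fix D assume "D \<in> up s ` {v \<in> V. v \<noteq> {}}"
    then obtain v where v: "v \<in> V" "v \<noteq> {}" "D = up s v" by auto
    obtain E where E: "E \<in> P s" "v \<subseteq> E" by (rule refinesE[OF assms(1) v(1)])
    then show "D \<in> P s" using up_of_subset[OF v(2) E(2,1)] v(3) by simp
  qed
qed

lemma to_parts_linear:
  assumes "s < r"
  shows "to_parts r s \<in> linear_maps (cech_H0 (superlevel X f r)) (free_module (P s) :: ('k::field, _) module)"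
  unfolding linear_maps_def
proof (intro CollectI conjI funcsetI ballI allI)
  let ?Y = "superlevel X f r" and ?W = "part_cover r s"
  note W = part_cover_open[OF assms] and eq = to_parts_eq[OF assms _ part_cover_open[OF assms] part_cover_refines]
  note H = persistence_moduleD(1,2)[OF persistence_module_H0, of _ X f r, unfolded H0_superlevel_simps]
  fix x :: "'a set set \<Rightarrow> ('a set \<Rightarrow> 'k) set" assume x: "x \<in> carrier (cech_H0 ?Y)"
  obtain c where c: "c \<in> carrier (nerve_chains0 ?W)" "x ?W = homology_class ?W c" by (rule nerve_repr[OF x W])
  show "to_parts r s x \<in> carrier (free_module (P s))"
    unfolding eq[OF x c] by (rule pushforward_up_carrier[OF part_cover_refines c(1)])
  fix a :: 'k
  have "(\<lambda>s. a * c s) \<in> carrier (nerve_chains0 ?W)"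
    using free_module_closed(2)[of c _ a] c(1) unfolding nerve_chains0_def free_module_simps(3) by blast
  from eq[OF H(2)[OF x] this, of a]
  have "to_parts r s (a \<odot>\<^bsub>cech_H0 ?Y\<^esub> x) = pushforward (up s) (\<lambda>s. a * c s)"
    using W by (simp add: c(2) nerve_H0_smult)
  then show "to_parts r s (a \<odot>\<^bsub>cech_H0 ?Y\<^esub> x) = a \<odot>\<^bsub>free_module (P s)\<^esub> to_parts r s x"
    using c(1) unfolding eq[OF x c] by (simp add: pushforward_smult nerve_chains0_def)
next
  let ?Y = "superlevel X f r" and ?W = "part_cover r s"
  note W = part_cover_open[OF assms] and eq = to_parts_eq[OF assms _ part_cover_open[OF assms] part_cover_refines]
  note H = persistence_moduleD(1,2)[OF persistence_module_H0, of _ X f r, unfolded H0_superlevel_simps]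
  fix x y :: "'a set set \<Rightarrow> ('a set \<Rightarrow> 'k) set"
  assume x: "x \<in> carrier (cech_H0 ?Y)" and y: "y \<in> carrier (cech_H0 ?Y)"
  obtain c where c: "c \<in> carrier (nerve_chains0 ?W)" "x ?W = homology_class ?W c" by (rule nerve_repr[OF x W])
  obtain d where d: "d \<in> carrier (nerve_chains0 ?W)" "y ?W = homology_class ?W d" by (rule nerve_repr[OF y W])
  have "(\<lambda>s. c s + d s) \<in> carrier (nerve_chains0 ?W)"
    using free_module_closed(1)[of c _ d] c(1) d(1) unfolding nerve_chains0_def free_module_simps(2) by blast
  from eq[OF H(1)[OF x y] this]
  have "to_parts r s (x \<oplus>\<^bsub>cech_H0 ?Y\<^esub> y) = pushforward (up s) (\<lambda>s. c s + d s)"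
    using W by (simp add: c(2) d(2) nerve_H0_add)
  then show "to_parts r s (x \<oplus>\<^bsub>cech_H0 ?Y\<^esub> y) = to_parts r s x \<oplus>\<^bsub>free_module (P s)\<^esub> to_parts r s y"
    using c(1) d(1) unfolding eq[OF x c] eq[OF y d] by (simp add: pushforward_add nerve_chains0_def)
qed

text \<open>The members homologous to u and the remaining ones have open unions, and these are
  disjoint on C because members that meet are homologous. A connected C cannot be split in this
  way.\<close>

lemma connected_homologous:
  assumes C: "connectedin X C" "C \<subseteq> topspace (superlevel X f s)"
    and U: "U \<in> open_covers (superlevel X f s)"
    and u: "u \<in> U" "u \<inter> C \<noteq> {}" and v: "v \<in> U" "v \<inter> C \<noteq> {}"
  shows "(\<lambda>t. delta u k t - delta v k t) \<in> boundaries U"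
proof -
  define A where "A = {w \<in> U. (\<lambda>t. delta u k t - delta w k t) \<in> boundaries U}"
  have uA: "u \<in> A" using u by (simp add: A_def boundaries_zero)
  have step: "w' \<in> A" if "w \<in> A" "w' \<in> U" "w \<inter> w' \<noteq> {}" for w w'
  proof -
    have "(\<lambda>t. delta w k t - delta w' k t) \<in> boundaries U"
      by (rule boundaries_edge) (use that in \<open>auto simp: A_def\<close>)
    then have "(\<lambda>t. (delta u k t - delta w k t) + (delta w k t - delta w' k t)) \<in> boundaries U"
      by (intro boundaries_add) (use that in \<open>auto simp: A_def\<close>)
    then show ?thesis using that by (simp add: A_def)
  qed
  have con: "connectedin (superlevel X f s) C"
    using C unfolding superlevel_def connectedin_subtopology by auto
  have op: "openin (superlevel X f s) (\<Union>A)" "openin (superlevel X f s) (\<Union>(U - A))"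
    using U by (auto simp: open_covers_def A_def)
  have "C \<subseteq> \<Union>U" using C U by (simp add: open_covers_def)
  then have "C \<subseteq> \<Union>A \<union> \<Union>(U - A)" by blast
  moreover have "\<Union>A \<inter> \<Union>(U - A) \<inter> C = {}" using step by blast
  moreover have "\<Union>A \<inter> C \<noteq> {}" using uA u by blast
  ultimately have "\<Union>(U - A) \<inter> C = {}" using con op unfolding connectedin by blast
  then have "v \<in> A" using v by blast
  then show ?thesis by (simp add: A_def)
qed

definition member_meeting :: "'a set set \<Rightarrow> 'a set \<Rightarrow> 'a set" where
  "member_meeting U C = (SOME u. u \<in> U \<and> u \<inter> C \<noteq> {})"

lemma part_superlevel: "C \<in> P r \<Longrightarrow> s \<le> r \<Longrightarrow> C \<subseteq> topspace (superlevel X f s)"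
  using part_union[of r] by fastforce

lemma member_meeting:
  assumes "C \<in> P r" "s \<le> r" "U \<in> open_covers (superlevel X f s)"
  shows "member_meeting U C \<in> U" "member_meeting U C \<inter> C \<noteq> {}"
proof -
  have "C \<subseteq> \<Union>U" using part_superlevel[OF assms(1,2)] assms(3) by (simp add: open_covers_def)
  then have "\<exists>u. u \<in> U \<and> u \<inter> C \<noteq> {}" using parts_nonempty[OF assms(1)] by blast
  from someI_ex[OF this] show "member_meeting U C \<in> U" "member_meeting U C \<inter> C \<noteq> {}"
    unfolding member_meeting_def by auto
qed

lemma meeting_carrier:
  assumes "c \<in> carrier (free_module (P r))" "s \<le> r" "U \<in> open_covers (superlevel X f s)"
  shows "pushforward (member_meeting U) c \<in> carrier (nerve_chains0 U)"
  unfolding nerve_chains0_def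
  by (rule pushforward_carrier[OF assms(1)]) (use member_meeting[OF _ assms(2,3)] in blast)

text \<open>On every cover a part is represented by some member meeting it; connectedness of the
  part makes the choice irrelevant up to homology.\<close>

definition from_parts :: "real \<Rightarrow> real \<Rightarrow> ('a set \<Rightarrow> 'k::field) \<Rightarrow> 'a set set \<Rightarrow> ('a set \<Rightarrow> 'k) set" where
  "from_parts r s c = (\<lambda>U\<in>open_covers (superlevel X f s). homology_class U (pushforward (member_meeting U) c))"

lemma from_parts_carrier:
  fixes c :: "'a set \<Rightarrow> 'k::field"
  assumes c: "c \<in> carrier (free_module (P r))" and sr: "s \<le> r"
  shows "from_parts r s c \<in> carrier (cech_H0 (superlevel X f s))"
proof (rule cech_carrierI)
  fix U assume U: "U \<in> open_covers (superlevel X f s)"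
  then show "from_parts r s c U \<in> carrier (nerve_H0 U)"
    using meeting_carrier[OF c sr U] by (simp add: from_parts_def nerve_H0_carrier)
next
  fix U V assume U: "U \<in> open_covers (superlevel X f s)" and V: "V \<in> open_covers (superlevel X f s)"
    and ref: "refines V U"
  have "nerve_map V U (from_parts r s c V) = homology_class U (pushforward (member_above U) (pushforward (member_meeting V) c))"
    using V by (simp add: from_parts_def nerve_map_class[OF ref meeting_carrier[OF c sr V]])
  also have "\<dots> = homology_class U (pushforward (\<lambda>C. member_above U (member_meeting V C)) c)"
    using c by (simp add: pushforward_comp)
  also have "\<dots> = homology_class U (pushforward (member_meeting U) c)"
  proof (rule pushforward_homologous[OF c])
    fix C and k :: 'k assume C: "C \<in> P r"
    note mV = member_meeting[OF C sr V] and mU = member_meeting[OF C sr U]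
    note ab = member_above[OF ref mV(1)]
    show "(\<lambda>s. delta (member_above U (member_meeting V C)) k s - delta (member_meeting U C) k s) \<in> boundaries U"
      by (rule connected_homologous[OF part_connected[OF C] part_superlevel[OF C sr] U ab(1) _ mU]) (use ab mV in blast)
  qed
  finally show "nerve_map V U (from_parts r s c V) = from_parts r s c U" using U by (simp add: from_parts_def)
qed (simp add: from_parts_def)

lemma from_parts_linear:
  assumes "s \<le> r"
  shows "from_parts r s \<in> linear_maps (free_module (P r)) (cech_H0 (superlevel X f s) :: ('k::field, _) module)"
  unfolding linear_maps_def
proof (intro CollectI conjI funcsetI ballI allI)
  fix c :: "'a set \<Rightarrow> 'k" assume c: "c \<in> carrier (free_module (P r))"
  show "from_parts r s c \<in> carrier (cech_H0 (superlevel X f s))" by (rule from_parts_carrier[OF c assms])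
  fix a show "from_parts r s (a \<odot>\<^bsub>free_module (P r)\<^esub> c) = a \<odot>\<^bsub>cech_H0 (superlevel X f s)\<^esub> from_parts r s c"
    using c unfolding from_parts_def cech_ops by (intro restrict_ext) (simp add: pushforward_smult nerve_H0_smult)
next
  fix c d :: "'a set \<Rightarrow> 'k" assume "c \<in> carrier (free_module (P r))" "d \<in> carrier (free_module (P r))"
  then show "from_parts r s (c \<oplus>\<^bsub>free_module (P r)\<^esub> d) = from_parts r s c \<oplus>\<^bsub>cech_H0 (superlevel X f s)\<^esub> from_parts r s d"
    unfolding from_parts_def cech_ops by (intro restrict_ext) (simp add: pushforward_add nerve_H0_add)
qed

text \<open>Both sides are evaluated on one cover, the restriction to the higher level of the cover
  by parts; it is subordinate to the parts at s, hence to those at s'.\<close>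

lemma to_parts_natural:
  fixes x :: "'a set set \<Rightarrow> ('a set \<Rightarrow> 'k::field) set"
  assumes o: "s' \<le> s" "s < r" "r \<le> r'" and x: "x \<in> carrier (cech_H0 (superlevel X f r'))"
  shows "pushforward (up s') (to_parts r s (cech_H0_inclusion (superlevel X f r') (superlevel X f r) x)) = to_parts r' s' x"
proof -
  let ?Y' = "superlevel X f r'" and ?Y = "superlevel X f r"
  let ?x = "cech_H0_inclusion ?Y' ?Y x"
  let ?V = "part_cover r s" and ?V' = "restrict_cover ?Y' (part_cover r s)"
  note V = part_cover_open[OF o(2)]
  note V' = restrict_cover_open[OF o(3) V]
  have ref: "refines ?V' ?V" by (rule restrict_cover_refines)
  have refP: "refines ?V' (P s)" by (rule refines_trans[OF ref part_cover_refines])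
  have refP': "refines ?V' (P s')"
    using refines_trans[OF refP] parts_nested[OF o(1)] by (auto simp: refines_def)
  obtain c where c: "c \<in> carrier (nerve_chains0 ?V')" "x ?V' = homology_class ?V' c" by (rule nerve_repr[OF x V'])
  have x': "?x \<in> carrier (cech_H0 ?Y)"
    using persistence_moduleD(4)[OF persistence_module_H0, of r r' x X f] o x by simp
  have eq: "?x ?V = homology_class ?V (pushforward (member_above ?V) c)"
    using V by (simp add: cech_H0_inclusion_eq c(2) nerve_map_class[OF ref c(1)])
  have "to_parts r s ?x = pushforward (up s) (pushforward (member_above ?V) c)"
    by (rule to_parts_eq[OF o(2) x' V part_cover_refines pushforward_above_carrier[OF ref c(1)] eq])
  then have "pushforward (up s') (to_parts r s ?x) = pushforward (\<lambda>v. up s' (up s (member_above ?V v))) c"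
    using c(1) by (simp add: pushforward_comp nerve_chains0_def finite_support_pushforward)
  also have "\<dots> = pushforward (up s') c"
  proof (rule pushforward_cong)
    fix v assume "c v \<noteq> 0"
    then have v: "v \<in> ?V'" "v \<noteq> {}" using c(1) by (auto simp: nerve_chains0_def)
    note m = member_above[OF ref v(1)]
    obtain D where D: "D \<in> P s" "member_above ?V v \<subseteq> D" by (rule refinesE[OF part_cover_refines m(1)])
    have 1: "up s (member_above ?V v) = D" by (rule up_of_subset[OF _ D(2,1)]) (use m v in blast)
    note u = up_props[OF o(1) D(1)]
    have "up s' v = up s' D" by (rule up_of_subset[OF v(2) _ u(1)]) (use m D u in blast)
    then show "up s' (up s (member_above ?V v)) = up s' v" using 1 by simp
  qed
  also have "\<dots> = to_parts r' s' x"
    by (rule to_parts_eq[OF _ x V' refP' c, symmetric]) (use o in simp)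
  finally show ?thesis .
qed

text \<open>The two chosen members both meet the larger part at level r, so they are homologous by
  connectedness.\<close>

lemma from_parts_natural:
  fixes y :: "'a set \<Rightarrow> 'k::field"
  assumes o: "s' \<le> s" "s < r" "r \<le> r'" and y: "y \<in> carrier (free_module (P r'))"
  shows "cech_H0_inclusion (superlevel X f s) (superlevel X f s') (from_parts r s (pushforward (up r) y)) = from_parts r' s' y"
proof -
  let ?Y = "superlevel X f s" and ?Z = "superlevel X f s'"
  have yr: "pushforward (up r) y \<in> carrier (free_module (P r))"
    by (rule pushforward_carrier[OF y]) (use up_props[OF o(3)] in blast)
  have sr: "s \<le> r" using o by simp
  show ?thesis
    unfolding cech_H0_inclusion_eq from_parts_def[of r' s']
  proof (intro restrict_ext)
    fix U assume U: "U \<in> open_covers ?Z"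
    let ?U = "restrict_cover ?Y U"
    note rU = restrict_cover_open[OF o(1) U] and ref = restrict_cover_refines[of ?Y U]
    have "nerve_map ?U U (from_parts r s (pushforward (up r) y) ?U) =
       homology_class U (pushforward (member_above U) (pushforward (member_meeting ?U) (pushforward (up r) y)))"
      using rU by (simp add: from_parts_def nerve_map_class[OF ref meeting_carrier[OF yr sr rU]])
    also have "\<dots> = homology_class U (pushforward (\<lambda>C. member_above U (member_meeting ?U (up r C))) y)"
      using y by (simp add: pushforward_comp finite_support_pushforward)
    also have "\<dots> = homology_class U (pushforward (member_meeting U) y)"
    proof (rule pushforward_homologous[OF y])
      fix C and k :: 'k assume C: "C \<in> P r'"
      note u = up_props[OF o(3) C]
      have s'r: "s' \<le> r" "s' \<le> r'" using o by simp_all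
      note m1 = member_meeting[OF u(1) sr rU] and m2 = member_meeting[OF C s'r(2) U]
      note ab = member_above[OF ref m1(1)]
      show "(\<lambda>s. delta (member_above U (member_meeting ?U (up r C))) k s - delta (member_meeting U C) k s) \<in> boundaries U"
        by (rule connected_homologous[OF part_connected[OF u(1)] part_superlevel[OF u(1) s'r(1)] U ab(1) _ m2(1)])
           (use ab m1 m2 u in blast)+
    qed
    finally show "nerve_map ?U U (from_parts r s (pushforward (up r) y) ?U) = homology_class U (pushforward (member_meeting U) y)" .
  qed
qed

text \<open>A trace that meets C can only be the trace of the part containing C.\<close>

lemma to_from_parts:
  fixes y :: "'a set \<Rightarrow> 'k::field"
  assumes o: "t < s" "s < r" and y: "y \<in> carrier (free_module (P r))"
  shows "to_parts s t (from_parts r s y) = pushforward (up t) y"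
proof -
  let ?W = "part_cover s t"
  have sr: "s \<le> r" using o by simp
  note W = part_cover_open[OF o(1)]
  have "from_parts r s y ?W = homology_class ?W (pushforward (member_meeting ?W) y)" using W by (simp add: from_parts_def)
  from to_parts_eq[OF o(1) from_parts_carrier[OF y sr] W part_cover_refines meeting_carrier[OF y sr W] this]
  have "to_parts s t (from_parts r s y) = pushforward (\<lambda>C. up t (member_meeting ?W C)) y"
    using y by (simp add: pushforward_comp)
  also have "\<dots> = pushforward (up t) y"
  proof (rule pushforward_cong)
    fix C assume "y C \<noteq> 0"
    then have C: "C \<in> P r" using y by auto
    note m = member_meeting[OF C sr W]
    obtain D where D: "D \<in> P t" "member_meeting ?W C \<subseteq> D" by (rule refinesE[OF part_cover_refines m(1)])
    have "up t (member_meeting ?W C) = D" by (rule up_of_subset[OF _ D(2,1)]) (use m in blast)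
    moreover have "up t C = D" by (rule up_eq[OF _ C D(1)]) (use o m D in auto)
    ultimately show "up t (member_meeting ?W C) = up t C" by simp
  qed
  finally show ?thesis .
qed

lemma from_to_parts:
  fixes x :: "'a set set \<Rightarrow> ('a set \<Rightarrow> 'k::field) set"
  assumes o: "t < s" "s < r" and x: "x \<in> carrier (cech_H0 (superlevel X f r))"
  shows "from_parts s t (to_parts r s x) = cech_H0_inclusion (superlevel X f r) (superlevel X f t) x"
  unfolding from_parts_def cech_H0_inclusion_eq
proof (intro restrict_ext)
  let ?Y = "superlevel X f r" and ?Z = "superlevel X f t"
  fix U assume U: "U \<in> open_covers ?Z"
  let ?U = "restrict_cover ?Y U"
  have tr: "t \<le> r" and ts: "t \<le> s" using o by auto
  note rU = restrict_cover_open[OF tr U] and refU = restrict_cover_refines[of ?Y U]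
  \<comment> \<open>A common refinement: its members lie in members of \<open>U\<close> and also in
    single parts at level s, so both sides can be computed from the value of x on it.\<close>
  define V where "V = {u \<inter> w | u w. u \<in> ?U \<and> w \<in> part_cover r s}"
  note W = part_cover_open[OF o(2)]
  have V: "V \<in> open_covers ?Y"
  proof -
    have "\<Union>V = \<Union>?U \<inter> \<Union>(part_cover r s)" by (auto simp: V_def)
    then show ?thesis using rU W by (auto simp: open_covers_def V_def)
  qed
  have VU: "refines V ?U" and VW: "refines V (part_cover r s)" by (auto simp: refines_def V_def)
  have VP: "refines V (P s)" by (rule refines_trans[OF VW part_cover_refines])
  obtain c where c: "c \<in> carrier (nerve_chains0 V)" "x V = homology_class V c" by (rule nerve_repr[OF x V])
  have "nerve_map ?U U (x ?U) = nerve_map ?U U (nerve_map V ?U (x V))" using cech_carrierD(2)[OF x rU V VU] by simp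
  also have "\<dots> = nerve_map V U (x V)" by (rule nerve_map_comp[OF VU refU cech_carrierD(1)[OF x V]])
  also have "\<dots> = homology_class U (pushforward (member_above U) c)"
    unfolding c(2) by (rule nerve_map_class[OF refines_trans[OF VU refU] c(1)])
  also have "\<dots> = homology_class U (pushforward (\<lambda>v. member_meeting U (up s v)) c)"
  proof (rule pushforward_homologous)
    show "c \<in> carrier (free_module {v \<in> V. v \<noteq> {}})" using c by (simp add: nerve_chains0_def)
    fix v and k :: 'k assume v: "v \<in> {v \<in> V. v \<noteq> {}}"
    then obtain D where D: "D \<in> P s" "v \<subseteq> D" using refinesE[OF VP] by blast
    have uD: "up s v = D" by (rule up_of_subset[OF _ D(2,1)]) (use v in blast)
    have vV: "v \<in> V" using v by simp
    note ab = member_above[OF refines_trans[OF VU refU] vV]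
    show "(\<lambda>s'. delta (member_above U v) k s' - delta (member_meeting U (up s v)) k s') \<in> boundaries U"
      unfolding uD
      by (rule connected_homologous[OF part_connected[OF D(1)] part_superlevel[OF D(1) ts] U ab(1) _ member_meeting[OF D(1) ts U]])
         (use ab D v in blast)
  qed
  also have "\<dots> = homology_class U (pushforward (member_meeting U) (to_parts r s x))"
    unfolding to_parts_eq[OF o(2) x V VP c] using c(1) by (simp add: pushforward_comp nerve_chains0_def)
  finally show "homology_class U (pushforward (member_meeting U) (to_parts r s x)) = nerve_map ?U U (x ?U)" by simp
qed

theorem parts_module_same_barcode_H0:
  "same_barcode (parts_module :: ('k::field, _) persmod) (H0_superlevel X f :: ('k, _) persmod)"
proof -
  have 1: "to_parts \<in> obs_morphisms (H0_superlevel X f :: ('k, _) persmod) parts_module"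
    unfolding obs_morphisms_def H0_superlevel_simps parts_module_simps
  proof (intro CollectI conjI allI impI ballI)
    fix r s :: real assume "s < r"
    then show "to_parts r s \<in> linear_maps (cech_H0 (superlevel X f r)) (free_module (P s) :: ('k, _) module)"
      by (rule to_parts_linear)
  next
    fix r' r s s' and x :: "'a set set \<Rightarrow> ('a set \<Rightarrow> 'k) set"
    assume "s' \<le> s \<and> s < r \<and> r \<le> r'" "x \<in> carrier (cech_H0 (superlevel X f r'))"
    then show "pushforward (up s') (to_parts r s (cech_H0_inclusion (superlevel X f r') (superlevel X f r) x)) = to_parts r' s' x"
      by (intro to_parts_natural) simp_all
  qed
  have 2: "from_parts \<in> obs_morphisms parts_module (H0_superlevel X f :: ('k, _) persmod)"
    unfolding obs_morphisms_def H0_superlevel_simps parts_module_simps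
  proof (intro CollectI conjI allI impI ballI)
    fix r s :: real assume "s < r"
    then show "from_parts r s \<in> linear_maps (free_module (P r)) (cech_H0 (superlevel X f s) :: ('k, _) module)"
      by (intro from_parts_linear) simp
  next
    fix r' r s s' and y :: "'a set \<Rightarrow> 'k"
    assume "s' \<le> s \<and> s < r \<and> r \<le> r'" "y \<in> carrier (free_module (P r'))"
    then show "cech_H0_inclusion (superlevel X f s) (superlevel X f s') (from_parts r s (pushforward (up r) y)) = from_parts r' s' y"
      by (intro from_parts_natural) simp_all
  qed
  show ?thesis
    unfolding same_barcode_def
    by (rule bexI[OF _ 2], rule bexI[OF _ 1])
       (simp del: free_module_simps add: from_to_parts to_from_parts)
qed

end


section \<open>The procedure Alg on a finite tree\<close>

text \<open>By finiteness the union of the other pieces is closed, so each piece is clopen as well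
  as connected.\<close>

lemma connected_components_of_finite_partition:
  assumes "finite \<C>" "\<Union>\<C> = topspace Y"
    and C: "\<And>C. C \<in> \<C> \<Longrightarrow> closedin Y C \<and> connectedin Y C \<and> C \<noteq> {}"
    and disj: "\<And>C D. C \<in> \<C> \<Longrightarrow> D \<in> \<C> \<Longrightarrow> C \<inter> D \<noteq> {} \<Longrightarrow> C = D"
  shows "connected_components_of Y = \<C>"
proof -
  have op: "openin Y C" if "C \<in> \<C>" for C
  proof -
    have "closedin Y (\<Union>(\<C> - {C}))" by (rule closedin_Union) (use assms(1) C in auto)
    moreover have "topspace Y - \<Union>(\<C> - {C}) = C"
    proof (intro equalityI subsetI)
      fix x assume "x \<in> topspace Y - \<Union>(\<C> - {C})"
      then show "x \<in> C" unfolding assms(2)[symmetric] by blast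
    next
      fix x assume x: "x \<in> C"
      then have "x \<notin> D" if "D \<in> \<C> - {C}" for D using disj[OF \<open>C \<in> \<C>\<close>, of D] that by blast
      then show "x \<in> topspace Y - \<Union>(\<C> - {C})" unfolding assms(2)[symmetric] using x \<open>C \<in> \<C>\<close> by blast
    qed
    ultimately show ?thesis using openin_diff[OF openin_topspace] by metis
  qed
  have comp: "K = C" if K: "K \<in> connected_components_of Y" and "C \<in> \<C>" "C \<inter> K \<noteq> {}" for K C
  proof
    show "K \<subseteq> C"
      using connectedin_clopen_cases[OF connectedin_connected_components_of[OF K], of C] C[OF that(2)] op[OF that(2)] that(3)
      by (auto simp: disjnt_def)
    show "C \<subseteq> K"
      by (rule connected_components_of_maximal[OF K]) (use C[OF that(2)] that(3) in \<open>auto simp: disjnt_def\<close>)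
  qed
  show ?thesis
  proof (intro equalityI subsetI)
    fix K assume K: "K \<in> connected_components_of Y"
    have "K \<noteq> {}" "K \<subseteq> \<Union>\<C>"
      using nonempty_connected_components_of[OF K] connected_components_of_subset[OF K] assms(2) by auto
    then obtain C where "C \<in> \<C>" "C \<inter> K \<noteq> {}" by blast
    then show "K \<in> \<C>" using comp[OF K] by blast
  next
    fix C assume C': "C \<in> \<C>"
    then obtain x where x: "x \<in> C" using C by blast
    then have "x \<in> \<Union>(connected_components_of Y)" using C' assms(2) Union_connected_components_of[of Y] by blast
    then obtain K where "K \<in> connected_components_of Y" "x \<in> K" by blast
    then show "C \<in> connected_components_of Y" using comp[OF _ C'] x by blast
  qed
qed

text \<open>The value 0 off \<open>T\<close> agrees with the convention of \<open>tree_dist\<close>.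
  \<open>cut_exists\<close> supplies the arcs: every point has an ancestor at each height down to
  that of the root.\<close>

locale merge_tree = merge_space T l g
  for T :: "'b set" and l :: "'b \<Rightarrow> real" and g +
  fixes d :: "'b \<Rightarrow> 'b \<Rightarrow> real" and root :: 'b
  assumes d_def: "d x y = (if x \<in> T \<and> y \<in> T then l x + l y - 2 * g x y else 0)"
    and d_zero: "x \<in> T \<Longrightarrow> y \<in> T \<Longrightarrow> l x + l y - 2 * g x y = 0 \<Longrightarrow> x = y"
    and root: "root \<in> T"
    and root_g: "x \<in> T \<Longrightarrow> g root x = l root"
    and cut_exists: "x \<in> T \<Longrightarrow> l root \<le> h \<Longrightarrow> h \<le> l x \<Longrightarrow> \<exists>y\<in>T. l y = h \<and> g x y = h"
begin

lemma root_le: "x \<in> T \<Longrightarrow> l root \<le> l x"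
  using root_g[of x] g_le2[OF root, of x] by simp

lemma g_ge_root: "x \<in> T \<Longrightarrow> y \<in> T \<Longrightarrow> l root \<le> g x y"
  using g_ultra[OF _ root, of x y] root_g[of y] root_g[of x] g_sym[OF _ root, of x] by simp

lemma d_eq: "x \<in> T \<Longrightarrow> y \<in> T \<Longrightarrow> d x y = l x + l y - 2 * g x y"
  by (simp add: d_def)

lemma Metric_space_tree: "Metric_space T d"
proof
  fix x y show "0 \<le> d x y" using g_le[of x y] g_le2[of x y] by (auto simp: d_def)
  show "d x y = d y x" by (auto simp: d_def g_sym)
next
  fix x y assume xy: "x \<in> T" "y \<in> T"
  then show "(d x y = 0) = (x = y)" using d_zero[OF xy] by (auto simp: d_def g_self)
next
  fix x y z assume xyz: "x \<in> T" "y \<in> T" "z \<in> T"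
  then show "d x z \<le> d x y + d y z"
    using g_ultra[OF xyz] g_le[OF xyz(2,3)] g_le2[OF xyz(1,2)] by (simp add: d_def)
qed

text \<open>The ancestor order: x lies on the arc from the root to y.\<close>

definition below :: "'b \<Rightarrow> 'b \<Rightarrow> bool" where
  "below x y \<longleftrightarrow> l x \<le> g x y"

lemma below_eq: "x \<in> T \<Longrightarrow> y \<in> T \<Longrightarrow> below x y \<Longrightarrow> g x y = l x"
  using g_le[of x y] by (simp add: below_def)

lemma below_refl: "x \<in> T \<Longrightarrow> below x x"
  by (simp add: below_def g_self)

lemma below_l: "x \<in> T \<Longrightarrow> y \<in> T \<Longrightarrow> below x y \<Longrightarrow> l x \<le> l y"
  using g_le2[of x y] by (simp add: below_def)

lemma below_trans: "x \<in> T \<Longrightarrow> y \<in> T \<Longrightarrow> z \<in> T \<Longrightarrow> below x y \<Longrightarrow> below y z \<Longrightarrow> below x z"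
  using g_ultra[of x y z] below_l[of x y] by (simp add: below_def)

lemma below_d: "x \<in> T \<Longrightarrow> y \<in> T \<Longrightarrow> below x y \<Longrightarrow> d x y = l y - l x"
  using below_eq[of x y] by (simp add: d_eq)

lemma below_antisym: "x \<in> T \<Longrightarrow> y \<in> T \<Longrightarrow> below x y \<Longrightarrow> l y \<le> l x \<Longrightarrow> x = y"
  using below_eq[of x y] below_l[of x y] by (intro d_zero) auto

text \<open>The ancestors of one point form a chain; this is the place where the ultrametric
  inequality gives \<open>T\<close> the shape of a tree.\<close>

lemma below_common: 
  assumes "x \<in> T" "y \<in> T" "z \<in> T" "below x z" "below y z" "l x \<le> l y"
  shows "below x y"
  using g_ultra[OF assms(1,3,2)] g_sym[OF assms(2,3)] assms(4-6) by (simp add: below_def)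

lemma root_below: "x \<in> T \<Longrightarrow> below root x"
  by (simp add: below_def root_g)

definition cut :: "'b \<Rightarrow> real \<Rightarrow> 'b" where
  "cut x h = (SOME y. y \<in> T \<and> l y = h \<and> g x y = h)"

lemma cut:
  assumes "x \<in> T" "l root \<le> h" "h \<le> l x"
  shows "cut x h \<in> T" "l (cut x h) = h" "below (cut x h) x"
proof -
  have ex: "\<exists>y. y \<in> T \<and> l y = h \<and> g x y = h" using cut_exists[OF assms] by blast
  have "cut x h \<in> T \<and> l (cut x h) = h \<and> g x (cut x h) = h"
    unfolding cut_def by (rule someI_ex[OF ex])
  then show "cut x h \<in> T" "l (cut x h) = h" "below (cut x h) x"
    using g_sym[of "cut x h" x] assms by (auto simp: below_def)
qed

lemma below_same_height:
  assumes "x \<in> T" "y \<in> T" "z \<in> T" "below x z" "below y z" "l x = l y"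
  shows "x = y"
  using below_antisym[OF assms(1,2) below_common[OF assms(1-5)]] assms(6) by simp

lemma cut_unique:
  assumes "x \<in> T" "y \<in> T" "below y x"
  shows "cut x (l y) = y"
  using cut[OF assms(1) root_le[OF assms(2)] below_l[OF assms(2,1,3)]]
    below_same_height[of "cut x (l y)" y x] assms by simp

lemma cut_below_cut:
  assumes "x \<in> T" "l root \<le> h" "h \<le> h'" "h' \<le> l x"
  shows "below (cut x h) (cut x h')"
  by (rule below_common[of _ _ x]) (use cut[of x h] cut[of x h'] assms in auto)

text \<open>Since g \<alpha> z \<le> l \<alpha> and g z \<beta> \<le> l z, the two distances can add
  up to l \<beta> - l \<alpha> only if both bounds are attained.\<close>

lemma geodesic_eq:
  assumes "S \<subseteq> T" "\<alpha> \<in> T" "\<beta> \<in> T" "below \<alpha> \<beta>"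
  shows "geodesic S d \<alpha> \<beta> = {z \<in> S. below \<alpha> z \<and> below z \<beta>}"
proof -
  have "d \<alpha> z + d z \<beta> = d \<alpha> \<beta> \<longleftrightarrow> below \<alpha> z \<and> below z \<beta>" if "z \<in> S" for z
  proof -
    have z: "z \<in> T" using that assms by auto
    show ?thesis
      using below_eq[OF assms(2,3,4)] g_le[OF assms(2) z] g_le[OF z assms(3)]
      by (auto simp: d_eq assms z below_def)
  qed
  then show ?thesis by (auto simp: geodesic_def)
qed

end

text \<open>Applies to \<open>T\<close> itself and to the nonempty trimmed trees; heights, merge
  heights and distances remain those of \<open>T\<close>.\<close>

locale lower_subtree = merge_tree T l g d root
  for T :: "'b set" and l :: "'b \<Rightarrow> real" and g d root +
  fixes S :: "'b set"
  assumes sub: "S \<subseteq> T" and root_S: "root \<in> S"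
    and lower: "x \<in> S \<Longrightarrow> y \<in> T \<Longrightarrow> below y x \<Longrightarrow> y \<in> S"
begin

sublocale MS: Metric_space S d
  by (rule Metric_space.subspace[OF Metric_space_tree sub])

lemma in_T: "x \<in> S \<Longrightarrow> x \<in> T" using sub by auto

definition branch :: "'b \<Rightarrow> real \<Rightarrow> 'b set" where
  "branch x h = {z \<in> S. below z x \<and> h \<le> l z}"

lemma cut_S: 
  assumes "x \<in> S" "l root \<le> h" "h \<le> l x"
  shows "cut x h \<in> S"
  using lower[OF assms(1)] cut[OF in_T[OF assms(1)] assms(2,3)] by simp

lemma branch_closed: 
  assumes "x \<in> S"
  shows "closedin MS.mtopology (branch x h)"
  unfolding MS.closedin_metric
proof (intro conjI allI impI)
  fix y assume y: "y \<in> S - branch x h"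
  note xT = in_T[OF assms]
  have yT: "y \<in> T" using y sub by auto
  consider "\<not> below y x" | "l y < h" using y by (auto simp: branch_def)
  then show "\<exists>r>0. disjnt (branch x h) (MS.mball y r)"
  proof cases
    case 1
    \<comment> \<open>The radius is the distance from y down to the arc from the root to x; every
      point of that arc is at least as far away.\<close>
    have "z \<notin> branch x h" if z: "z \<in> S" "d y z < l y - g y x" for z
    proof
      assume "z \<in> branch x h"
      then have b: "below z x" by (simp add: branch_def)
      have zT: "z \<in> T" using z in_T by auto
      have "g y x < g y z" using z(2) g_le2[OF yT zT] by (simp add: d_eq yT zT)
      moreover have "g y z \<le> g z x" using below_eq[OF zT xT b] g_le2[OF yT zT] by simp
      ultimately show False using g_ultra[OF yT zT xT] by simp
    qed
    then show ?thesis using 1 by (intro exI[of _ "l y - g y x"]) (auto simp: below_def disjnt_iff)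
  next
    case 2
    \<comment> \<open>The height is 1-Lipschitz for the distance.\<close>
    have "z \<notin> branch x h" if z: "z \<in> S" "d y z < h - l y" for z
    proof
      assume "z \<in> branch x h"
      then have b: "h \<le> l z" by (simp add: branch_def)
      have zT: "z \<in> T" using z in_T by auto
      show False using z(2) b g_le[OF yT zT] by (simp add: d_eq yT zT)
    qed
    then show ?thesis using 2 by (intro exI[of _ "h - l y"]) (auto simp: disjnt_iff)
  qed
qed (auto simp: branch_def)

text \<open>Taking the ancestor at a given height is an isometry from an interval onto the
  branch.\<close>

lemma branch_connected:
  assumes x: "x \<in> S" and h: "l root \<le> h" "h \<le> l x"
  shows "connectedin MS.mtopology (branch x h)"
proof -
  note xT = in_T[OF x]
  let ?I = "{h..l x}"
  have cutS: "cut x a \<in> S" "cut x a \<in> T" if "a \<in> ?I" for a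
    using cut_S[OF x, of a] cut[OF xT, of a] that h by auto
  have iso: "d (cut x a) (cut x b) = \<bar>b - a\<bar>" if "a \<in> ?I" "b \<in> ?I" for a b
  proof (cases "a \<le> b")
    case True
    then show ?thesis
      using below_d[OF cutS(2)[OF that(1)] cutS(2)[OF that(2)] cut_below_cut[OF xT _ True]] cut[OF xT, of a] cut[OF xT, of b] that h
      by auto
  next
    case False
    then have "d (cut x b) (cut x a) = \<bar>b - a\<bar>"
      using below_d[OF cutS(2)[OF that(2)] cutS(2)[OF that(1)] cut_below_cut[OF xT _ less_imp_le]] cut[OF xT, of a] cut[OF xT, of b] that h
      by auto
    then show ?thesis by (simp add: MS.commute)
  qed
  have "continuous_map (top_of_set ?I) MS.mtopology (cut x)"
    unfolding MS.continuous_map_to_metric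
  proof (intro ballI allI impI)
    fix a and \<epsilon> :: real assume a: "a \<in> topspace (top_of_set ?I)" and e: "0 < \<epsilon>"
    have "cut x b \<in> MS.mball (cut x a) \<epsilon>" if "b \<in> ?I \<inter> ball a \<epsilon>" for b
      using that a cutS iso[of a b] by (auto simp: dist_real_def)
    moreover have "openin (top_of_set ?I) (?I \<inter> ball a \<epsilon>)" by (rule openin_open_Int) simp
    ultimately show "\<exists>U. openin (top_of_set ?I) U \<and> a \<in> U \<and> (\<forall>y\<in>U. cut x y \<in> MS.mball (cut x a) \<epsilon>)"
      using a e by (intro exI[of _ "?I \<inter> ball a \<epsilon>"]) auto
  qed
  moreover have "connectedin (top_of_set ?I) ?I"
    using connected_Icc[of h "l x"] by (simp add: connectedin_subtopology)
  ultimately have "connectedin MS.mtopology (cut x ` ?I)" by (rule connectedin_continuous_map_image)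
  moreover have "cut x ` ?I = branch x h"
  proof (intro equalityI subsetI)
    fix z assume "z \<in> cut x ` ?I"
    then show "z \<in> branch x h" using cutS cut[OF xT] h by (auto simp: branch_def)
  next
    fix z assume z: "z \<in> branch x h"
    then have "cut x (l z) = z" "l z \<in> ?I"
      using cut_unique[OF xT, of z] below_l[of z x] in_T xT by (auto simp: branch_def)
    then show "z \<in> cut x ` ?I" by (metis imageI)
  qed
  ultimately show ?thesis by simp
qed

definition leaves :: "'b set" where
  "leaves = {\<beta> \<in> S. \<forall>\<eta>\<in>S. below \<beta> \<eta> \<longrightarrow> \<eta> = \<beta>}"

lemma leaf_iff: "is_leaf S d S root \<beta> \<longleftrightarrow> \<beta> \<in> leaves"
proof -
  have "\<beta> \<in> geodesic S d root \<eta> \<longleftrightarrow> below \<beta> \<eta>" if "\<beta> \<in> S" "\<eta> \<in> S" for \<eta>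
    using geodesic_eq[OF sub root in_T[OF that(2)] root_below[OF in_T[OF that(2)]]] that root_below[OF in_T[OF that(1)]]
    by auto
  then show ?thesis unfolding is_leaf_def leaves_def by auto
qed

end

section \<open>The loop as an enumeration of leaves\<close>

locale finite_subtree = lower_subtree T l g d root S
  for T :: "'b set" and l :: "'b \<Rightarrow> real" and g d root S +
  assumes finite_leaves: "finite leaves"
    and below_leaf: "x \<in> S \<Longrightarrow> \<exists>\<beta>\<in>leaves. below x \<beta>"
begin

lemma leaf_S: "\<beta> \<in> leaves \<Longrightarrow> \<beta> \<in> S" by (simp add: leaves_def)
lemma leaf_T: "\<beta> \<in> leaves \<Longrightarrow> \<beta> \<in> T" using in_T leaf_S by blast
lemma leaf_max: "\<beta> \<in> leaves \<Longrightarrow> \<eta> \<in> S \<Longrightarrow> below \<beta> \<eta> \<Longrightarrow> \<eta> = \<beta>" by (simp add: leaves_def)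

lemma leaves_g_less: "\<beta> \<in> leaves \<Longrightarrow> b \<in> leaves \<Longrightarrow> b \<noteq> \<beta> \<Longrightarrow> g \<beta> b < l \<beta>"
  using leaf_max[of \<beta> b] leaf_S[of b] by (force simp: below_def not_le[symmetric])

text \<open>The height at which the branch of \<open>\<beta>\<close> meets the union of the paths from the root to the
  points of \<open>B\<close>.\<close>

definition attach :: "'b set \<Rightarrow> 'b \<Rightarrow> real" where
  "attach B \<beta> = Max (insert (l root) (g \<beta> ` B))"

text \<open>What the loop has left after enumerating the leaves in \<open>B\<close>. It depends on
  the set \<open>B\<close> only, which lets invariants be stated without the order of
  enumeration.\<close>

definition forest :: "'b set \<Rightarrow> 'b set" where
  "forest B = {z \<in> S. \<exists>\<beta>\<in>leaves - B. below z \<beta> \<and> attach B \<beta> \<le> l z}"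

lemma finite_B: "B \<subseteq> leaves \<Longrightarrow> finite B" using finite_leaves finite_subset by blast

lemma attach_le_iff: "B \<subseteq> leaves \<Longrightarrow> attach B \<beta> \<le> h \<longleftrightarrow> l root \<le> h \<and> (\<forall>b\<in>B. g \<beta> b \<le> h)"
  unfolding attach_def using finite_B[of B] by auto

lemma attach_bounds:
  assumes "B \<subseteq> leaves" "\<beta> \<in> leaves"
  shows "l root \<le> attach B \<beta>" "attach B \<beta> \<le> l \<beta>"
proof -
  show "l root \<le> attach B \<beta>" unfolding attach_def using finite_B[OF assms(1)] by simp
  show "attach B \<beta> \<le> l \<beta>"
    unfolding attach_le_iff[OF assms(1)]
    using root_le[OF leaf_T[OF assms(2)]] g_le[OF leaf_T[OF assms(2)]] leaf_T assms(1) by blast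
qed

lemma attach_insert: "B \<subseteq> leaves \<Longrightarrow> attach (insert b B) \<beta> = max (attach B \<beta>) (g \<beta> b)"
proof -
  assume B: "B \<subseteq> leaves"
  have "insert (l root) (g \<beta> ` insert b B) = insert (g \<beta> b) (insert (l root) (g \<beta> ` B))" by auto
  moreover have "Max (insert (g \<beta> b) (insert (l root) (g \<beta> ` B))) = max (g \<beta> b) (Max (insert (l root) (g \<beta> ` B)))"
    by (rule Max_insert) (use finite_B[OF B] in auto)
  ultimately show ?thesis unfolding attach_def by (simp only: max.commute)
qed

text \<open>Nonemptiness of \<open>B\<close> excludes the tree with one point, whose only path has
  length 0. A later path always leaves the earlier ones strictly below its leaf.\<close>

lemma attach_less:
  assumes "B \<subseteq> leaves" "\<beta> \<in> leaves - B" "B \<noteq> {}"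
  shows "attach B \<beta> < l \<beta>"
proof -
  have "g \<beta> b < l \<beta>" if "b \<in> B" for b using leaves_g_less[of \<beta> b] assms that by auto
  moreover have "l root < l \<beta>"
  proof -
    obtain b where b: "b \<in> B" using assms by auto
    have "l root \<le> g \<beta> b" using g_ge_root leaf_T assms b by auto
    also have "\<dots> < l \<beta>" using leaves_g_less[of \<beta> b] assms b by auto
    finally show ?thesis .
  qed
  ultimately show ?thesis unfolding attach_def using finite_B[OF assms(1)] by simp
qed

definition attach_point :: "'b set \<Rightarrow> 'b \<Rightarrow> 'b" where
  "attach_point B \<beta> = cut \<beta> (attach B \<beta>)"

lemma attach_point:
  assumes "B \<subseteq> leaves" "\<beta> \<in> leaves"
  shows "attach_point B \<beta> \<in> T" "attach_point B \<beta> \<in> S" "l (attach_point B \<beta>) = attach B \<beta>"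
    "below (attach_point B \<beta>) \<beta>" "d (attach_point B \<beta>) \<beta> = l \<beta> - attach B \<beta>"
proof -
  note c = cut[OF leaf_T[OF assms(2)] attach_bounds[OF assms]]
  show p: "attach_point B \<beta> \<in> T" "l (attach_point B \<beta>) = attach B \<beta>" "below (attach_point B \<beta>) \<beta>"
    unfolding attach_point_def using c by auto
  show "attach_point B \<beta> \<in> S" by (rule lower[OF leaf_S[OF assms(2)] p(1,3)])
  show "d (attach_point B \<beta>) \<beta> = l \<beta> - attach B \<beta>" using below_d[OF p(1) leaf_T[OF assms(2)] p(3)] p(2) by simp
qed

text \<open>Isosceles property of ultrametrics: leaves that separate from each other at height at
  least h, and from \<open>B\<close> at height at most h, separate from each b at the same
  height.\<close>

lemma attach_eq:
  assumes B: "B \<subseteq> leaves" and \<beta>: "\<beta> \<in> leaves" "\<gamma> \<in> leaves" and h: "attach B \<beta> \<le> h" "attach B \<gamma> \<le> h" "h \<le> g \<beta> \<gamma>"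
  shows "attach B \<beta> = attach B \<gamma>"
proof -
  have "g \<beta> b = g \<gamma> b" if "b \<in> B" for b
  proof -
    have b: "b \<in> T" using that B leaf_T by auto
    have "g \<beta> b \<le> h" "g \<gamma> b \<le> h" using h that B by (auto simp: attach_le_iff)
    moreover have "g \<gamma> \<beta> = g \<beta> \<gamma>" using g_sym leaf_T \<beta> by auto
    ultimately show ?thesis
      using g_ultra[OF leaf_T[OF \<beta>(1)] leaf_T[OF \<beta>(2)] b] g_ultra[OF leaf_T[OF \<beta>(2)] leaf_T[OF \<beta>(1)] b] h(3) by linarith
  qed
  then have "g \<beta> ` B = g \<gamma> ` B" by (rule image_cong[OF refl])
  then show ?thesis by (simp add: attach_def)
qed

text \<open>If two branches share a point, their feet lie below it on one arc and at one height.
  Hence the components of the forest can be indexed by feet.\<close>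

lemma attach_point_eq:
  assumes B: "B \<subseteq> leaves" and \<beta>: "\<beta> \<in> leaves" "\<gamma> \<in> leaves"
    and z: "z \<in> S" "below z \<beta>" "below z \<gamma>" "attach B \<beta> \<le> l z" "attach B \<gamma> \<le> l z"
  shows "attach_point B \<beta> = attach_point B \<gamma>"
proof -
  note T = leaf_T[OF \<beta>(1)] leaf_T[OF \<beta>(2)] in_T[OF z(1)]
  have "l z \<le> g \<beta> \<gamma>"
    using g_ultra[OF T(1,3,2)] g_sym[OF T(1,3)] z(2,3) by (simp add: below_def)
  then have eq: "attach B \<beta> = attach B \<gamma>" by (rule attach_eq[OF B \<beta> z(4,5)])
  note p = attach_point[OF B \<beta>(1)] and q = attach_point[OF B \<beta>(2)]
  have "below (attach_point B \<beta>) z" by (rule below_common[OF p(1) T(3,1) p(4) z(2)]) (use p z in simp)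
  moreover have "below (attach_point B \<gamma>) z" by (rule below_common[OF q(1) T(3,2) q(4) z(3)]) (use q z in simp)
  ultimately show ?thesis using below_same_height[OF p(1) q(1) T(3)] p(3) q(3) eq by simp
qed

lemma branch_attach:
  assumes B: "B \<subseteq> leaves" and \<beta>: "\<beta> \<in> leaves"
  shows "geodesic S d (attach_point B \<beta>) \<beta> = branch \<beta> (attach B \<beta>)"
proof -
  note p = attach_point[OF B \<beta>]
  have "below (attach_point B \<beta>) z \<longleftrightarrow> attach B \<beta> \<le> l z" if z: "z \<in> S" "below z \<beta>" for z
    using below_l[OF p(1) in_T[OF z(1)]] below_common[OF p(1) in_T[OF z(1)] leaf_T[OF \<beta>] p(4) z(2)] p(3) by auto
  then show ?thesis
    unfolding geodesic_eq[OF sub p(1) leaf_T[OF \<beta>] p(4)] branch_def by auto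
qed

lemma forest_branches: "forest B = (\<Union>\<beta>\<in>leaves - B. branch \<beta> (attach B \<beta>))"
  by (auto simp: forest_def branch_def)

lemma forest_closed: "closedin MS.mtopology (forest B)"
  unfolding forest_branches by (rule closedin_Union) (use finite_leaves branch_closed leaf_S in auto)

definition component :: "'b set \<Rightarrow> 'b \<Rightarrow> 'b set" where
  "component B \<alpha> = (\<Union>\<beta>\<in>{\<beta> \<in> leaves - B. attach_point B \<beta> = \<alpha>}. branch \<beta> (attach B \<beta>))"

lemma branch_ends:
  assumes "B \<subseteq> leaves" "\<beta> \<in> leaves"
  shows "attach_point B \<beta> \<in> branch \<beta> (attach B \<beta>)" "\<beta> \<in> branch \<beta> (attach B \<beta>)"
  using attach_point[OF assms] attach_bounds[OF assms] below_refl[OF leaf_T[OF assms(2)]] leaf_S[OF assms(2)]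
  by (auto simp: branch_def)

text \<open>Branches with a common foot are connected through it, those with different feet are
  disjoint by \<open>attach_point_eq\<close>, and there are finitely many branches, all
  closed.\<close>

lemma forest_components:
  assumes B: "B \<subseteq> leaves"
  shows "connected_components_of (subtopology MS.mtopology (forest B)) = component B ` attach_point B ` (leaves - B)"
proof (rule connected_components_of_finite_partition)
  have fS: "forest B \<subseteq> S" by (auto simp: forest_def)
  show "\<Union> (component B ` attach_point B ` (leaves - B)) = topspace (subtopology MS.mtopology (forest B))"
    using fS by (auto simp: component_def forest_branches)
  fix C assume "C \<in> component B ` attach_point B ` (leaves - B)"
  then obtain \<gamma> where \<gamma>: "\<gamma> \<in> leaves - B" and C: "C = component B (attach_point B \<gamma>)" by auto
  let ?L = "{\<beta> \<in> leaves - B. attach_point B \<beta> = attach_point B \<gamma>}"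
  have sub: "C \<subseteq> forest B" unfolding C component_def forest_branches by auto
  have "closedin MS.mtopology C" unfolding C component_def
    by (rule closedin_Union) (use finite_leaves branch_closed leaf_S in auto)
  then have "closedin (subtopology MS.mtopology (forest B)) C"
    using sub by (simp add: closedin_closed_subtopology forest_closed)
  moreover have "connectedin MS.mtopology C" unfolding C component_def
  proof (rule connectedin_Union)
    fix K assume "K \<in> (\<lambda>\<beta>. branch \<beta> (attach B \<beta>)) ` ?L"
    then show "connectedin MS.mtopology K"
      using branch_connected[OF leaf_S attach_bounds[OF B]] by auto
  next
    have "attach_point B \<gamma> \<in> branch \<beta> (attach B \<beta>)" if "\<beta> \<in> ?L" for \<beta>
      using branch_ends(1)[OF B, of \<beta>] that by auto
    then show "\<Inter> ((\<lambda>\<beta>. branch \<beta> (attach B \<beta>)) ` ?L) \<noteq> {}" by blast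
  qed
  then have "connectedin (subtopology MS.mtopology (forest B)) C" using sub by (simp add: connectedin_subtopology)
  moreover have "C \<noteq> {}" using branch_ends[OF B, of \<gamma>] \<gamma> unfolding C component_def by blast
  ultimately show "closedin (subtopology MS.mtopology (forest B)) C \<and> connectedin (subtopology MS.mtopology (forest B)) C \<and> C \<noteq> {}"
    by blast
next
  fix C D assume "C \<in> component B ` attach_point B ` (leaves - B)" "D \<in> component B ` attach_point B ` (leaves - B)"
    "C \<inter> D \<noteq> {}"
  then obtain \<alpha> \<alpha>' z where C: "C = component B \<alpha>" "D = component B \<alpha>'" "z \<in> component B \<alpha>" "z \<in> component B \<alpha>'" by blast
  then obtain \<beta> \<gamma> where "\<beta> \<in> leaves" "\<gamma> \<in> leaves" "attach_point B \<beta> = \<alpha>" "attach_point B \<gamma> = \<alpha>'"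
    "z \<in> branch \<beta> (attach B \<beta>)" "z \<in> branch \<gamma> (attach B \<gamma>)" unfolding component_def by blast
  then show "C = D" using attach_point_eq[OF B, of \<beta> \<gamma> z] C by (auto simp: branch_def)
qed (use finite_leaves in auto)

lemma component_above:
  assumes B: "B \<subseteq> leaves" and z: "z \<in> component B \<alpha>" and \<alpha>: "\<alpha> \<in> attach_point B ` (leaves - B)"
  shows "z \<in> S" "\<alpha> \<in> T" "below \<alpha> z" "\<exists>\<beta>\<in>leaves - B. attach_point B \<beta> = \<alpha> \<and> below z \<beta> \<and> attach B \<beta> \<le> l z"
proof -
  obtain \<beta> where \<beta>: "\<beta> \<in> leaves - B" "attach_point B \<beta> = \<alpha>" "z \<in> branch \<beta> (attach B \<beta>)"
    using z by (auto simp: component_def)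
  then have \<beta>L: "\<beta> \<in> leaves" by simp
  note p = attach_point[OF B \<beta>L, unfolded \<beta>(2)]
  show zS: "z \<in> S" using \<beta> by (simp add: branch_def)
  show "\<alpha> \<in> T" by (rule p(1))
  show "below \<alpha> z" by (rule below_common[OF p(1) in_T[OF zS] leaf_T[OF \<beta>L] p(4)]) (use \<beta> p in \<open>auto simp: branch_def\<close>)
  show "\<exists>\<beta>\<in>leaves - B. attach_point B \<beta> = \<alpha> \<and> below z \<beta> \<and> attach B \<beta> \<le> l z"
    using \<beta> by (auto simp: branch_def)
qed

text \<open>The lowest point of a component is the common foot of its branches. Removing paths
  creates no new leaf, so the leaves of the components are the leaves not yet enumerated.\<close>

lemma root_to_leaf_iff:
  assumes B: "B \<subseteq> leaves"
  shows "root_to_leaf S d l (forest B) \<alpha> \<beta> \<longleftrightarrow> \<beta> \<in> leaves - B \<and> \<alpha> = attach_point B \<beta>"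
proof
  assume "root_to_leaf S d l (forest B) \<alpha> \<beta>"
  then obtain C where "C \<in> connected_components_of (subtopology MS.mtopology (forest B))"
    and C: "\<alpha> \<in> C" "\<forall>\<eta>\<in>C. l \<alpha> \<le> l \<eta>" "is_leaf S d C \<alpha> \<beta>"
    unfolding root_to_leaf_def by blast
  then obtain a where a: "a \<in> attach_point B ` (leaves - B)" "C = component B a"
    unfolding forest_components[OF B] by blast
  note ca = component_above[OF B _ a(1)]
  have aC: "a \<in> C" using a branch_ends(1)[OF B] unfolding component_def by fastforce
  have \<alpha>S: "\<alpha> \<in> S" "below a \<alpha>" "a \<in> T" using ca C(1) a(2) by auto
  \<comment> \<open>The foot is an ancestor of every point of its component, and \<alpha> is a
    lowest point.\<close>
  have "a = \<alpha>" by (rule below_antisym[OF \<alpha>S(3) in_T[OF \<alpha>S(1)] \<alpha>S(2)]) (use C(2) aC in auto)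
  have \<beta>C: "\<beta> \<in> C" using C(3) by (simp add: is_leaf_def)
  then obtain \<gamma> where \<gamma>: "\<gamma> \<in> leaves - B" "attach_point B \<gamma> = \<alpha>" "below \<beta> \<gamma>"
    using ca(4)[of \<beta>] a(2) \<open>a = \<alpha>\<close> by blast
  then have \<gamma>L: "\<gamma> \<in> leaves" by simp
  have \<gamma>C: "\<gamma> \<in> C" using branch_ends(2)[OF B \<gamma>L] \<gamma> unfolding a(2) \<open>a = \<alpha>\<close> component_def by blast
  have \<beta>S: "\<beta> \<in> S" "below \<alpha> \<beta>" using ca[of \<beta>] \<beta>C a(2) \<open>a = \<alpha>\<close> by auto
  note p = attach_point[OF B \<gamma>L, unfolded \<gamma>(2)]
  have "\<beta> \<in> geodesic S d \<alpha> \<gamma>"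
    unfolding geodesic_eq[OF sub p(1) leaf_T[OF \<gamma>L] p(4)] using \<beta>S \<gamma>(3) by simp
  then have "\<gamma> = \<beta>" using C(3) \<gamma>C by (simp add: is_leaf_def)
  then show "\<beta> \<in> leaves - B \<and> \<alpha> = attach_point B \<beta>" using \<gamma> by simp
next
  assume h: "\<beta> \<in> leaves - B \<and> \<alpha> = attach_point B \<beta>"
  then have \<beta>: "\<beta> \<in> leaves" and a: "\<alpha> \<in> attach_point B ` (leaves - B)" by auto
  let ?C = "component B \<alpha>"
  note ca = component_above[OF B _ a]
  have in_C: "\<alpha> \<in> ?C" "\<beta> \<in> ?C" using branch_ends[OF B \<beta>] h unfolding component_def by auto
  have "l \<alpha> \<le> l \<eta>" if "\<eta> \<in> ?C" for \<eta>
    using below_l[OF ca(2)[OF that] in_T[OF ca(1)[OF that]] ca(3)[OF that]] .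
  moreover have "\<eta> = \<beta>" if \<eta>: "\<eta> \<in> ?C" "\<beta> \<in> geodesic S d \<alpha> \<eta>" for \<eta>
  proof -
    have "below \<beta> \<eta>"
      using \<eta>(2) unfolding geodesic_eq[OF sub ca(2)[OF \<eta>(1)] in_T[OF ca(1)[OF \<eta>(1)]] ca(3)[OF \<eta>(1)]] by simp
    then show ?thesis by (rule leaf_max[OF \<beta> ca(1)[OF \<eta>(1)]])
  qed
  moreover have "?C \<in> connected_components_of (subtopology MS.mtopology (forest B))"
    unfolding forest_components[OF B] using a by blast
  ultimately show "root_to_leaf S d l (forest B) \<alpha> \<beta>"
    unfolding root_to_leaf_def is_leaf_def using in_C by blast
qed

lemma longest_iff:
  assumes B: "B \<subseteq> leaves"
  shows "longest_root_to_leaf S d l (forest B) \<alpha> \<beta> \<longleftrightarrow> \<beta> \<in> leaves - B \<and> \<alpha> = attach_point B \<beta> \<and>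
    (\<forall>\<gamma>\<in>leaves - B. l \<gamma> - attach B \<gamma> \<le> l \<beta> - attach B \<beta>)"
  unfolding longest_root_to_leaf_def root_to_leaf_iff[OF B]
  using attach_point(5)[OF B] by auto

text \<open>Removing the path also removes the points where remaining branches leave it; the closure
  restores these feet and nothing else.\<close>

lemma forest_step:
  assumes B: "B \<subseteq> leaves" and \<beta>: "\<beta> \<in> leaves - B"
  shows "MS.mtopology closure_of (forest B - geodesic S d (attach_point B \<beta>) \<beta>) = forest (insert \<beta> B)"
proof -
  have \<beta>L: "\<beta> \<in> leaves" and B': "insert \<beta> B \<subseteq> leaves" using \<beta> B by auto
  note \<beta>T = leaf_T[OF \<beta>L]
  have geo: "geodesic S d (attach_point B \<beta>) \<beta> = branch \<beta> (attach B \<beta>)" by (rule branch_attach[OF B \<beta>L])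
  have ge: "attach B \<gamma> \<le> attach (insert \<beta> B) \<gamma>" "g \<gamma> \<beta> \<le> attach (insert \<beta> B) \<gamma>" for \<gamma> unfolding attach_insert[OF B] by auto
  show ?thesis
    unfolding geo
  proof (rule equalityI)
    show "MS.mtopology closure_of (forest B - branch \<beta> (attach B \<beta>)) \<subseteq> forest (insert \<beta> B)"
    proof (rule closure_of_minimal[OF _ forest_closed], rule subsetI)
      fix z assume z: "z \<in> forest B - branch \<beta> (attach B \<beta>)"
      then obtain \<gamma> where \<gamma>: "\<gamma> \<in> leaves - B" "below z \<gamma>" "attach B \<gamma> \<le> l z" and zS: "z \<in> S" by (auto simp: forest_def)
      have \<gamma>T: "\<gamma> \<in> T" and zT: "z \<in> T" using leaf_T \<gamma> in_T zS by auto
      have nb: "\<not> (below z \<beta> \<and> attach B \<beta> \<le> l z)" using z zS by (auto simp: branch_def)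
      \<comment> \<open>Otherwise z lies below the point where the arcs to \<gamma> and \<beta>
        part; being above the attaching height of \<gamma> it is then above that of \<beta> too,
        hence on the removed path.\<close>
      have "g \<gamma> \<beta> \<le> l z"
      proof (rule ccontr)
        assume "\<not> g \<gamma> \<beta> \<le> l z"
        then have lt: "l z < g \<gamma> \<beta>" by simp
        have "below z \<beta>" using g_ultra[OF zT \<gamma>T \<beta>T] \<gamma>(2) lt by (simp add: below_def)
        moreover have "attach B \<beta> \<le> l z"
          unfolding attach_le_iff[OF B]
        proof (intro conjI ballI root_le[OF zT])
          fix b assume b: "b \<in> B"
          then have bT: "b \<in> T" using B leaf_T by auto
          have "g \<gamma> b \<le> l z" using \<gamma>(3) b unfolding attach_le_iff[OF B] by simp
          then show "g \<beta> b \<le> l z" using g_ultra[OF \<gamma>T \<beta>T bT] lt by linarith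
        qed
        ultimately show False using nb by simp
      qed
      moreover have "\<gamma> \<noteq> \<beta>" using nb \<gamma> by auto
      ultimately show "z \<in> forest (insert \<beta> B)"
        unfolding forest_def using \<gamma> zS by (auto simp: attach_insert[OF B] intro!: bexI[of _ \<gamma>])
    qed
    show "forest (insert \<beta> B) \<subseteq> MS.mtopology closure_of (forest B - branch \<beta> (attach B \<beta>))"
    proof
      fix z assume "z \<in> forest (insert \<beta> B)"
      then obtain \<gamma> where \<gamma>: "\<gamma> \<in> leaves - insert \<beta> B" "below z \<gamma>" "attach (insert \<beta> B) \<gamma> \<le> l z" and zS: "z \<in> S"
        by (auto simp: forest_def)
      have \<gamma>L: "\<gamma> \<in> leaves" "\<gamma> \<in> leaves - B" using \<gamma> by auto
      note \<gamma>T = leaf_T[OF \<gamma>L(1)] and zT = in_T[OF zS]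
      have lt: "attach (insert \<beta> B) \<gamma> < l \<gamma>" by (rule attach_less[OF B' \<gamma>(1)]) simp
      \<comment> \<open>Strictly above the new attaching height, the branch of \<gamma> avoids the
        arc to \<beta>.\<close>
      have inn: "cut \<gamma> h \<in> forest B - branch \<beta> (attach B \<beta>)"
        if h: "attach (insert \<beta> B) \<gamma> < h" "h \<le> l \<gamma>" for h
      proof -
        have rh: "l root \<le> h" using h attach_bounds(1)[OF B' \<gamma>L(1)] by simp
        note c = cut[OF \<gamma>T rh h(2)]
        have "cut \<gamma> h \<in> forest B"
          unfolding forest_def using lower[OF leaf_S[OF \<gamma>L(1)] c(1,3)] \<gamma>L(2) c ge(1)[of \<gamma>] h by auto
        moreover have "\<not> below (cut \<gamma> h) \<beta>"
        proof
          assume b: "below (cut \<gamma> h) \<beta>"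
          have "h \<le> g \<gamma> \<beta>"
            using g_ultra[OF \<gamma>T c(1) \<beta>T] b c(2,3) g_sym[OF \<gamma>T c(1)] by (simp add: below_def)
          then show False using h ge(2)[of \<gamma>] by simp
        qed
        ultimately show ?thesis by (simp add: branch_def)
      qed
      show "z \<in> MS.mtopology closure_of (forest B - branch \<beta> (attach B \<beta>))"
        unfolding MS.metric_closure_of
      proof (intro CollectI conjI allI impI zS)
        fix r :: real assume r: "0 < r"
        show "\<exists>y\<in>forest B - branch \<beta> (attach B \<beta>). y \<in> MS.mball z r"
        proof (cases "attach (insert \<beta> B) \<gamma> < l z")
          case True
          have "cut \<gamma> (l z) = z" by (rule cut_unique[OF \<gamma>T zT \<gamma>(2)])
          then have "z \<in> forest B - branch \<beta> (attach B \<beta>)"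
            using inn[OF True below_l[OF zT \<gamma>T \<gamma>(2)]] by simp
          then show ?thesis using r zS by (intro bexI[of _ z]) simp_all
        next
          case False
          then have eq: "l z = attach (insert \<beta> B) \<gamma>" using \<gamma>(3) by simp
          \<comment> \<open>The foot is approached from above along the branch. The minimum keeps
            the height within the branch, which is nondegenerate by \<open>lt\<close>.\<close>
          define h where "h = min (l \<gamma>) (l z + r / 2)"
          have h: "l z < h" "h \<le> l \<gamma>" "h < l z + r" using lt eq r by (auto simp: h_def)
          have rh: "l root \<le> h" using h root_le[OF zT] by simp
          note c = cut[OF \<gamma>T rh h(2)]
          have b: "below z (cut \<gamma> h)"
            by (rule below_common[OF zT c(1) \<gamma>T \<gamma>(2) c(3)]) (use c(2) h in simp)
          have "d z (cut \<gamma> h) < r" using below_d[OF zT c(1) b] c(2) h by simp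
          moreover have "cut \<gamma> h \<in> forest B - branch \<beta> (attach B \<beta>)" by (rule inn) (use eq h in auto)
          moreover have "cut \<gamma> h \<in> S" by (rule lower[OF leaf_S[OF \<gamma>L(1)] c(1,3)])
          ultimately show ?thesis using zS by (intro bexI[of _ "cut \<gamma> h"]) simp_all
        qed
      qed
    qed
  qed
qed

lemma forest_empty: "forest {} = S"
  unfolding forest_def attach_def using below_leaf root_le in_T by fastforce

lemma forest_leaves: "forest leaves = {}"
  by (auto simp: forest_def)

lemma forest_nonempty: "B \<subseteq> leaves \<Longrightarrow> \<beta> \<in> leaves - B \<Longrightarrow> \<beta> \<in> forest B"
  unfolding forest_branches using branch_ends(2)[of B \<beta>] by blast

lemma alg_run_exists:
  assumes "B \<subseteq> leaves"
  shows "\<exists>ps. alg_run S d l (forest B) ps"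
  using assms
proof (induction "card (leaves - B)" arbitrary: B rule: less_induct)
  case less
  show ?case
  proof (cases "B = leaves")
    case True
    then show ?thesis using alg_run.stop[of S d l] forest_leaves by auto
  next
    case False
    then have ne: "leaves - B \<noteq> {}" using less.prems by blast
    have fin: "finite (leaves - B)" using finite_leaves by simp
    let ?f = "\<lambda>\<gamma>. l \<gamma> - attach B \<gamma>"
    have "Max (?f ` (leaves - B)) \<in> ?f ` (leaves - B)" by (rule Max_in) (use ne fin in auto)
    then obtain \<beta> where \<beta>1: "\<beta> \<in> leaves - B" "Max (?f ` (leaves - B)) = ?f \<beta>" by (rule imageE)
    have "?f \<gamma> \<le> ?f \<beta>" if "\<gamma> \<in> leaves - B" for \<gamma>
      unfolding \<beta>1(2)[symmetric] by (rule Max_ge) (use that fin in auto)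
    note \<beta> = \<beta>1(1) this
    have "leaves - insert \<beta> B \<subset> leaves - B" using \<beta>(1) by blast
    then obtain ps where "alg_run S d l (forest (insert \<beta> B)) ps"
      using less.hyps[OF psubset_card_mono[OF fin]] \<beta>(1) less.prems by blast
    then have "alg_run S d l (forest B) ((attach_point B \<beta>, \<beta>) # ps)"
      unfolding forest_step[OF less.prems \<beta>(1), symmetric]
      by (rule alg_run.step[rotated]) (use longest_iff[OF less.prems] \<beta> in auto)
    then show ?thesis by blast
  qed
qed

text \<open>Clusters are taken in \<open>T\<close> and only their witnesses in \<open>S\<close>, so
  the counts for trimmed trees can be compared with those for \<open>T\<close>.\<close>

definition tall :: "real \<Rightarrow> real \<Rightarrow> 'b set set" where
  "tall s r = cls s ` {x \<in> S. r < l x}"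

lemma tall_leaves:
  assumes "s < r"
  shows "tall s r = cls s ` {x \<in> leaves. r < l x}"
proof (intro equalityI subsetI)
  fix C assume "C \<in> tall s r"
  then obtain x where x: "x \<in> S" "r < l x" "C = cls s x" by (auto simp: tall_def)
  obtain \<beta> where \<beta>: "\<beta> \<in> leaves" "below x \<beta>" using below_leaf[OF x(1)] by blast
  have "\<beta> \<in> cls s x" using \<beta> x assms leaf_T by (auto simp: cls_def below_def)
  then have "cls s \<beta> = C" using cls_eq[OF in_T[OF x(1)]] x by simp
  moreover have "r < l \<beta>" using below_l[OF in_T[OF x(1)] leaf_T[OF \<beta>(1)] \<beta>(2)] x by simp
  ultimately show "C \<in> cls s ` {x \<in> leaves. r < l x}" using \<beta> by blast
qed (auto simp: tall_def leaf_S)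

text \<open>The clusters whose long bar is still to be produced.\<close>

definition fresh :: "'b set \<Rightarrow> real \<Rightarrow> real \<Rightarrow> 'b set set" where
  "fresh B s r = {C \<in> tall s r. C \<inter> B = {}}"

lemma finite_tall: "s < r \<Longrightarrow> finite (tall s r)"
  using tall_leaves finite_leaves by simp

text \<open>The bar of \<beta> dies at or below s exactly if no leaf of the cluster of \<beta> at s
  has been enumerated before. An element b of \<open>B\<close> takes care of the root height, since
  l root \<le> g \<beta> b.\<close>

lemma cls_fresh_iff:
  assumes B: "B \<subseteq> leaves" "B \<noteq> {}" and \<beta>: "\<beta> \<in> leaves"
  shows "cls s \<beta> \<inter> B = {} \<longleftrightarrow> attach B \<beta> \<le> s"
proof -
  obtain b where b: "b \<in> B" using B by auto
  have "l root \<le> g \<beta> b" using g_ge_root[OF leaf_T[OF \<beta>]] leaf_T B b by blast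
  then have "(\<forall>b\<in>B. g \<beta> b \<le> s) \<longrightarrow> l root \<le> s" using b order_trans by blast
  then have "attach B \<beta> \<le> s \<longleftrightarrow> (\<forall>b\<in>B. g \<beta> b \<le> s)" using attach_le_iff[OF B(1)] by blast
  moreover have "cls s \<beta> \<inter> B = {} \<longleftrightarrow> (\<forall>b\<in>B. g \<beta> b \<le> s)"
  proof -
    have "B \<subseteq> T" using B(1) leaf_T by blast
    then show ?thesis by (auto simp: cls_def disjoint_iff not_less)
  qed
  ultimately show ?thesis by blast
qed

text \<open>A cluster is born with its first leaf, which is the highest one because among the leaves
  of a cluster that is attached below the cluster the longest path ends at the highest leaf.\<close>

lemma fresh_step:
  assumes B: "B \<subseteq> leaves" "B \<noteq> {}" and \<beta>: "\<beta> \<in> leaves - B" and sr: "s < r"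
    and longest: "\<And>\<gamma>. \<gamma> \<in> leaves - B \<Longrightarrow> l \<gamma> - attach B \<gamma> \<le> l \<beta> - attach B \<beta>"
  shows "card (fresh B s r) = (if attach B \<beta> \<le> s \<and> r < l \<beta> then 1 else 0) + card (fresh (insert \<beta> B) s r)"
proof -
  have \<beta>L: "\<beta> \<in> leaves" using \<beta> by simp
  have fin: "finite (fresh (insert \<beta> B) s r)" unfolding fresh_def using finite_tall[OF sr] by simp
  have own: "C = cls s \<beta>" if "C \<in> tall s r" "\<beta> \<in> C" for C
    using that cls_eq in_T by (fastforce simp: tall_def)
  show ?thesis
  proof (cases "attach B \<beta> \<le> s \<and> r < l \<beta>")
    case True
    have "fresh B s r = insert (cls s \<beta>) (fresh (insert \<beta> B) s r)"
    proof (intro equalityI subsetI)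
      fix C assume "C \<in> fresh B s r"
      then show "C \<in> insert (cls s \<beta>) (fresh (insert \<beta> B) s r)" using own by (auto simp: fresh_def)
    next
      fix C assume "C \<in> insert (cls s \<beta>) (fresh (insert \<beta> B) s r)"
      then show "C \<in> fresh B s r"
        using cls_fresh_iff[OF B \<beta>L] True leaf_S[OF \<beta>L] by (auto simp: fresh_def tall_def)
    qed
    moreover have "cls s \<beta> \<notin> fresh (insert \<beta> B) s r"
      using cls_self[OF leaf_T[OF \<beta>L], of s] True sr by (auto simp: fresh_def)
    ultimately show ?thesis using fin True by simp
  next
    case False
    have "\<beta> \<notin> C" if C: "C \<in> tall s r" "C \<inter> B = {}" for C
    proof
      assume "\<beta> \<in> C"
      then have eq: "C = cls s \<beta>" using own C by simp
      then have att: "attach B \<beta> \<le> s" using cls_fresh_iff[OF B \<beta>L] C by simp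
      \<comment> \<open>A tall cluster contains a leaf higher than r. As the cluster is untouched so
        far, \<gamma> attaches at the same height as \<beta>, so a longer path was
        available.\<close>
      obtain \<gamma> where \<gamma>: "\<gamma> \<in> leaves" "r < l \<gamma>" "C = cls s \<gamma>" using C(1) tall_leaves[OF sr] by blast
      have att': "attach B \<gamma> \<le> s" using cls_fresh_iff[OF B \<gamma>(1)] C \<gamma>(3) by simp
      have \<gamma>C: "\<gamma> \<in> C" using cls_self[OF leaf_T[OF \<gamma>(1)], of s] \<gamma> sr by auto
      then have "\<gamma> \<notin> B" using C(2) by auto
      have "s \<le> g \<beta> \<gamma>" using \<gamma>C eq by (simp add: cls_def)
      then have "attach B \<beta> = attach B \<gamma>" by (rule attach_eq[OF B(1) \<beta>L \<gamma>(1) att att'])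
      then have "l \<gamma> \<le> l \<beta>" using longest[of \<gamma>] \<gamma>(1) \<open>\<gamma> \<notin> B\<close> by simp
      then show False using False att \<gamma>(2) by simp
    qed
    then have "fresh B s r = fresh (insert \<beta> B) s r" by (auto simp: fresh_def)
    then show ?thesis using False by simp
  qed
qed

text \<open>Invariant of the loop: the fresh clusters count the long bars still to come.
  \<open>B\<close> is nonempty because the first path, whose bar never dies, is treated
  separately.\<close>

lemma alg_run_bars:
  assumes "alg_run S d l F ps" "F = forest B" "B \<subseteq> leaves" "B \<noteq> {}"
  shows "(\<forall>(\<alpha>, \<beta>)\<in>set ps. l \<alpha> < l \<beta> \<and> \<beta> \<in> S) \<and>
    (\<forall>s r. s < r \<longrightarrow> length (filter (\<lambda>(\<alpha>, \<beta>). l \<alpha> \<le> s \<and> r < l \<beta>) ps) = card (fresh B s r))"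
  using assms
proof (induction arbitrary: B rule: alg_run.induct)
  case stop
  then have "leaves - B = {}" using forest_nonempty by blast
  then have "leaves = B" using stop by blast
  have "fresh B s r = {}" if sr: "s < r" for s r
  proof -
    have "C \<inter> B \<noteq> {}" if "C \<in> tall s r" for C
    proof -
      obtain \<gamma> where \<gamma>: "\<gamma> \<in> leaves" "r < l \<gamma>" "C = cls s \<gamma>" using \<open>C \<in> tall s r\<close> tall_leaves[OF sr] by blast
      then have "\<gamma> \<in> C" using cls_self[OF leaf_T[OF \<gamma>(1)], of s] sr by auto
      then show ?thesis using \<gamma>(1) \<open>leaves = B\<close> by blast
    qed
    then show ?thesis by (auto simp: fresh_def)
  qed
  then show ?case by simp
next
  case (step F \<alpha> \<beta> ps)
  note B = step.prems(2,3)
  have lo: "\<beta> \<in> leaves - B" "\<alpha> = attach_point B \<beta>" "\<And>\<gamma>. \<gamma> \<in> leaves - B \<Longrightarrow> l \<gamma> - attach B \<gamma> \<le> l \<beta> - attach B \<beta>"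
    using step.hyps(1) unfolding step.prems(1) longest_iff[OF B(1)] by auto
  have \<beta>L: "\<beta> \<in> leaves" using lo by simp
  have IH: "(\<forall>(\<alpha>, \<beta>)\<in>set ps. l \<alpha> < l \<beta> \<and> \<beta> \<in> S) \<and>
    (\<forall>s r. s < r \<longrightarrow> length (filter (\<lambda>(\<alpha>, \<beta>). l \<alpha> \<le> s \<and> r < l \<beta>) ps) = card (fresh (insert \<beta> B) s r))"
    by (rule step.IH) (use forest_step[OF B(1) lo(1)] step.prems(1) lo(2) B(1) \<beta>L in auto)
  have "l \<alpha> = attach B \<beta>" using attach_point(3)[OF B(1) \<beta>L] lo(2) by simp
  moreover have "attach B \<beta> < l \<beta>" by (rule attach_less[OF B(1) lo(1) B(2)])
  ultimately show ?case
    using IH fresh_step[OF B lo(1) _ lo(3)] leaf_S[OF \<beta>L] by auto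
qed

theorem alg_finite_bars:
  assumes "alg_finite S d l bs"
  shows "i < length bs \<Longrightarrow> fst (bs ! i) < ereal (snd (bs ! i))"
    and "i < length bs \<Longrightarrow> snd (bs ! i) \<in> l ` S"
    and "s < r \<Longrightarrow> card (long_bars {..<length bs} (\<lambda>i. bs ! i) s r) = card (tall s r)"
proof -
  obtain ps where ps: "alg_run S d l S ps" "bs = bars_of_run l ps" using assms by (auto simp: alg_finite_def)
  have e: "{} \<subseteq> leaves" by simp
  obtain \<alpha> \<beta> qs where q: "ps = (\<alpha>, \<beta>) # qs" "longest_root_to_leaf S d l S \<alpha> \<beta>"
    "alg_run S d l (MS.mtopology closure_of (S - geodesic S d \<alpha> \<beta>)) qs"
    using ps(1) root_S by (cases rule: alg_run.cases) auto
  \<comment> \<open>With no leaf enumerated all branches start at the root, so the longest path ends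
    at a highest leaf.\<close>
  have lo: "\<beta> \<in> leaves" "\<alpha> = attach_point {} \<beta>" "\<And>\<gamma>. \<gamma> \<in> leaves \<Longrightarrow> l \<gamma> \<le> l \<beta>"
    using q(2) unfolding longest_iff[OF e, unfolded forest_empty] by (auto simp: attach_def)
  have b: "bs = (-\<infinity>, l \<beta>) # map (\<lambda>(\<alpha>, \<beta>). (ereal (l \<alpha>), l \<beta>)) qs"
    by (simp add: ps(2) q(1) bars_of_run_def)
  have "MS.mtopology closure_of (S - geodesic S d \<alpha> \<beta>) = forest {\<beta>}"
    using forest_step[OF e, of \<beta>] lo by (simp add: forest_empty)
  from alg_run_bars[OF q(3) this]
  have qs: "\<And>\<alpha>' \<beta>'. (\<alpha>', \<beta>') \<in> set qs \<Longrightarrow> l \<alpha>' < l \<beta>' \<and> \<beta>' \<in> S"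
    "\<And>s r. s < r \<Longrightarrow> length (filter (\<lambda>(\<alpha>, \<beta>). l \<alpha> \<le> s \<and> r < l \<beta>) qs) = card (fresh {\<beta>} s r)"
    using lo(1) by auto
  have all: "\<forall>x\<in>set bs. fst x < ereal (snd x) \<and> snd x \<in> l ` S"
    unfolding b using qs(1) leaf_S[OF lo(1)] by auto
  show "i < length bs \<Longrightarrow> fst (bs ! i) < ereal (snd (bs ! i))" "i < length bs \<Longrightarrow> snd (bs ! i) \<in> l ` S"
    using all by auto
  assume sr: "s < r"
  have fin: "finite (fresh {\<beta>} s r)" unfolding fresh_def using finite_tall[OF sr] by simp
  have "card (long_bars {..<length bs} (\<lambda>i. bs ! i) s r) = length (filter (\<lambda>x. fst x \<le> ereal s \<and> r < snd x) bs)"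
    unfolding long_bars_def length_filter_conv_card by (rule arg_cong[of _ _ card]) auto
  \<comment> \<open>The first bar dies at -\<infinity>, so it is long for every s as soon as r < l
    \<beta>.\<close>
  also have "\<dots> = (if r < l \<beta> then 1 else 0) + card (fresh {\<beta>} s r)"
    unfolding b using qs(2)[OF sr] by (simp add: filter_map comp_def case_prod_unfold)
  also have "\<dots> = card (tall s r)"
  proof (cases "r < l \<beta>")
    case True
    have "tall s r = insert (cls s \<beta>) (fresh {\<beta>} s r)"
    proof (intro equalityI subsetI)
      fix C assume C: "C \<in> tall s r"
      then obtain x where x: "x \<in> T" "C = cls s x" using in_T by (auto simp: tall_def)
      then show "C \<in> insert (cls s \<beta>) (fresh {\<beta>} s r)" using C cls_eq[OF x(1), of \<beta> s] by (auto simp: fresh_def)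
    next
      fix C assume "C \<in> insert (cls s \<beta>) (fresh {\<beta>} s r)"
      then show "C \<in> tall s r" using True leaf_S[OF lo(1)] by (auto simp: fresh_def tall_def)
    qed
    moreover have "cls s \<beta> \<notin> fresh {\<beta>} s r" using cls_self[OF leaf_T[OF lo(1)], of s] True sr by (auto simp: fresh_def)
    ultimately show ?thesis using True fin by simp
  next
    case False
    then have "tall s r = {}" unfolding tall_leaves[OF sr] using lo(3) by force
    then show ?thesis using False by (simp add: fresh_def)
  qed
  finally show "card (long_bars {..<length bs} (\<lambda>i. bs ! i) s r) = card (tall s r)" .
qed

lemma alg_finite_exists: "\<exists>bs. alg_finite S d l bs"
  using alg_run_exists[of "{}"] by (auto simp: alg_finite_def forest_empty)

end

text \<open>Trimming by more than the height of the tree leaves nothing; such stages contribute no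
  bars.\<close>

lemma alg_finite_empty: "alg_finite {} d l bs \<longleftrightarrow> bs = []"
proof
  assume "alg_finite {} d l bs"
  then obtain ps where ps: "alg_run {} d l {} ps" "bs = bars_of_run l ps" by (auto simp: alg_finite_def)
  from ps(1) have "ps = []"
  proof cases
    case (step \<alpha> \<beta> ps)
    then show ?thesis
      by (auto simp: longest_root_to_leaf_def root_to_leaf_def connected_components_of_def)
  qed simp
  then show "bs = []" using ps by (simp add: bars_of_run_def)
next
  assume "bs = []"
  then show "alg_finite {} d l bs"
    unfolding alg_finite_def by (intro exI[of _ "[]"]) (simp add: alg_run.stop bars_of_run_def)
qed


section \<open>Compact trees\<close>

text \<open>Compactness in the two forms used later: finite nets for the pseudo-distance, and a
  highest point in every closed cluster.\<close>

locale compact_merge_space = merge_space S l g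
  for S :: "'b set" and l :: "'b \<Rightarrow> real" and g +
  assumes totally_bounded: "0 < \<delta> \<Longrightarrow> \<exists>N. finite N \<and> N \<subseteq> S \<and> (\<forall>y\<in>S. \<exists>x\<in>N. l x + l y - 2 * g x y < \<delta>)"
    and closed_max: "x \<in> S \<Longrightarrow> h \<le> l x \<Longrightarrow> \<exists>y\<in>S. h \<le> g x y \<and> (\<forall>z\<in>S. h \<le> g x z \<longrightarrow> l z \<le> l y)"
begin

text \<open>A point higher than r and within r - s of a net point merges with it above s, so the net
  represents all tall clusters.\<close>

lemma finite_tall_clusters:
  assumes "s < r"
  shows "finite (tall_clusters s r)"
proof -
  obtain N where N: "finite N" "N \<subseteq> S" "\<And>y. y \<in> S \<Longrightarrow> \<exists>x\<in>N. l x + l y - 2 * g x y < r - s"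
    using totally_bounded[of "r - s"] assms by auto
  have "tall_clusters s r \<subseteq> cls s ` N"
  proof
    fix C assume "C \<in> tall_clusters s r"
    then obtain y where y: "y \<in> S" "r < l y" "C = cls s y" by (auto simp: tall_clusters_def)
    obtain x where x: "x \<in> N" "l x + l y - 2 * g x y < r - s" using N(3)[OF y(1)] by blast
    have xS: "x \<in> S" using x N by auto
    have "s < g x y" using x(2) y(2) g_le[OF xS y(1)] by simp
    then have "y \<in> cls s x" using y by (simp add: cls_def)
    then have "C = cls s x" using cls_eq[OF xS] y by simp
    then show "C \<in> cls s ` N" using x by blast
  qed
  then show ?thesis using N(1) finite_surj by blast
qed

text \<open>\<open>closed_max\<close> speaks of closed clusters, whereas this one is open. Its
  points above r lie in finitely many clusters at an intermediate level h, each bounded by the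
  maximum of a closed cluster inside \<open>cls s x\<close>.\<close>

lemma open_max:
  assumes x: "x \<in> S" "s < l x"
  shows "\<exists>y\<in>cls s x. \<forall>z\<in>cls s x. l z \<le> l y"
proof -
  obtain r where r: "s < r" "r < l x" using dense[OF x(2)] by auto
  obtain h where h: "s < h" "h < r" using dense[OF r(1)] by auto
  define A where "A = cls h ` {z \<in> cls s x. r < l z}"
  have xs: "x \<in> cls s x" by (rule cls_self[OF x])
  have "A \<subseteq> tall_clusters h r" unfolding A_def tall_clusters_def using cls_less[OF x(1)] by blast
  then have fin: "finite A" using finite_tall_clusters[OF h(2)] finite_subset by blast
  have ne: "A \<noteq> {}" using xs r by (auto simp: A_def)
  have "\<forall>D\<in>A. \<exists>y. y \<in> cls s x \<and> (\<forall>w\<in>D. l w \<le> l y)"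
  proof
    fix D assume "D \<in> A"
    then obtain z where z: "z \<in> cls s x" "r < l z" "D = cls h z" by (auto simp: A_def)
    have zS: "z \<in> S" using cls_less[OF x(1) z(1)] by simp
    obtain y where y: "y \<in> S" "h \<le> g z y" "\<And>w. w \<in> S \<Longrightarrow> h \<le> g z w \<Longrightarrow> l w \<le> l y"
      using closed_max[OF zS, of h] z h by auto
    have "y \<in> cls s z" using y h by (simp add: cls_def)
    then have "y \<in> cls s x" using cls_eq[OF x(1) z(1)] by simp
    moreover have "\<forall>w\<in>D. l w \<le> l y" using y(3) z(3) by (auto simp: cls_def)
    ultimately show "\<exists>y. y \<in> cls s x \<and> (\<forall>w\<in>D. l w \<le> l y)" by blast
  qed
  then obtain f where f: "\<And>D. D \<in> A \<Longrightarrow> f D \<in> cls s x" "\<And>D w. D \<in> A \<Longrightarrow> w \<in> D \<Longrightarrow> l w \<le> l (f D)"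
    by metis
  have "Max ((\<lambda>D. l (f D)) ` A) \<in> (\<lambda>D. l (f D)) ` A" by (rule Max_in) (use fin ne in auto)
  then obtain E where E: "E \<in> A" "Max ((\<lambda>D. l (f D)) ` A) = l (f E)" by (rule imageE)
  have mx: "l (f D) \<le> l (f E)" if "D \<in> A" for D
    unfolding E(2)[symmetric] by (rule Max_ge) (use that fin in auto)
  have big: "l w \<le> l (f E)" if w: "w \<in> cls s x" "r < l w" for w
  proof -
    have "cls h w \<in> A" using w by (auto simp: A_def)
    moreover have "w \<in> cls h w" using cls_self[of w h] cls_less[OF x(1) w(1)] w h by simp
    ultimately show ?thesis using f(2)[of "cls h w" w] mx[of "cls h w"] by simp
  qed
  \<comment> \<open>A point that is not above r is lower than x, to which the bound already
    applies.\<close>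
  have "l w \<le> l (f E)" if w: "w \<in> cls s x" for w
    using big[OF w] big[OF xs r(2)] r(2) by (cases "r < l w") auto
  then show ?thesis using f(1)[OF E(1)] by blast
qed

sublocale finite_merge_space S l g
  by unfold_locales (rule finite_tall_clusters, assumption, rule open_max)

theorem same_barcode_parts_module:
  assumes e: "\<And>i. i \<in> I \<Longrightarrow> has_ends (J i) (e i)" "\<And>i. i \<in> I \<Longrightarrow> fst (e i) < ereal (snd (e i))"
    and N: "\<And>s r. s < r \<Longrightarrow> finite (long_bars I e s r) \<and> card (long_bars I e s r) = card (tall_clusters s r)"
  shows "same_barcode (interval_module I J :: ('k::field, _) persmod) (parts.parts_module :: ('k, _) persmod)"
proof (rule same_barcode_trans)
  show "same_barcode (interval_module I J :: ('k, _) persmod) (interval_module elders lifetime)"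
    by (rule interval_module_same_barcode[of I e elders elder_bar])
       (use e N long_elder_bars elder_bar_nondegenerate elder_bar_has_ends in auto)
  show "same_barcode (interval_module elders lifetime :: ('k, _) persmod) parts.parts_module"
    by (rule same_barcode_sym[OF parts_module_same_barcode])
  show "persistence_module (interval_module I J :: ('k, _) persmod)" by (rule persistence_module_interval[OF e(1)])
  show "persistence_module (interval_module elders lifetime :: ('k, _) persmod)"
    by (rule persistence_module_interval[OF elder_bar_has_ends])
qed (rule parts.persistence_module_parts)

text \<open>Each of the finitely many clusters has a witness strictly above r, so a small upward
  shift of r loses none of them. The 1 in the minimum covers the case without clusters.\<close>

lemma tall_clusters_stable:
  assumes "s < r"
  shows "\<exists>e>0. \<forall>\<epsilon>. 0 < \<epsilon> \<and> \<epsilon> < e \<longrightarrow> tall_clusters s (r + \<epsilon>) = tall_clusters s r"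
proof -
  have "\<forall>C\<in>tall_clusters s r. \<exists>x. x \<in> S \<and> r < l x \<and> C = cls s x" by (auto simp: tall_clusters_def)
  then obtain f where f: "\<And>C. C \<in> tall_clusters s r \<Longrightarrow> f C \<in> S \<and> r < l (f C) \<and> C = cls s (f C)" by metis
  define e where "e = Min (insert 1 ((\<lambda>C. l (f C) - r) ` tall_clusters s r))"
  have fin: "finite (insert 1 ((\<lambda>C. l (f C) - r) ` tall_clusters s r))" using finite_tall_clusters[OF assms] by simp
  have "0 < e" unfolding e_def using fin f by (subst Min_gr_iff) auto
  moreover have "tall_clusters s (r + \<epsilon>) = tall_clusters s r" if \<epsilon>: "0 < \<epsilon>" "\<epsilon> < e" for \<epsilon>
  proof (intro equalityI subsetI)
    fix C assume "C \<in> tall_clusters s (r + \<epsilon>)"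
    then show "C \<in> tall_clusters s r" using \<epsilon> by (auto simp: tall_clusters_def intro!: imageI)
  next
    fix C assume C: "C \<in> tall_clusters s r"
    have "e \<le> l (f C) - r" unfolding e_def by (rule Min_le[OF fin]) (use C in simp)
    then have "f C \<in> {x \<in> S. r + \<epsilon> < l x}" using f[OF C] \<epsilon> by simp
    then show "C \<in> tall_clusters s (r + \<epsilon>)" unfolding tall_clusters_def using f[OF C] by blast
  qed
  ultimately show ?thesis by blast
qed

end

section \<open>Trimmed trees and their runs\<close>

locale compact_merge_tree = merge_tree T l g d root + compact_merge_space T l g
  for T :: "'b set" and l :: "'b \<Rightarrow> real" and g d root
begin

lemma whole_lower_subtree: "lower_subtree T l g d root T"
  by unfold_locales (auto simp: root)

text \<open>Every x has a leaf above it: a highest point among its descendants, which exists by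
  compactness.\<close>

lemma finite_tree_subtree:
  assumes "finite_tree T d root"
  shows "finite_subtree T l g d root T"
proof -
  interpret W: lower_subtree T l g d root T by (rule whole_lower_subtree)
  show ?thesis
  proof unfold_locales
    show "finite W.leaves" using assms unfolding finite_tree_def W.leaf_iff by simp
    fix x assume x: "x \<in> T"
    obtain y where y: "y \<in> T" "l x \<le> g x y" "\<And>z. z \<in> T \<Longrightarrow> l x \<le> g x z \<Longrightarrow> l z \<le> l y"
      using closed_max[OF x order_refl] by blast
    have "\<eta> = y" if \<eta>: "\<eta> \<in> T" "below y \<eta>" for \<eta>
    proof -
      have "below x \<eta>" by (rule below_trans[OF x y(1) \<eta>(1) _ \<eta>(2)]) (use y in \<open>simp add: below_def\<close>)
      then have "l \<eta> \<le> l y" using y(3)[OF \<eta>(1)] by (simp add: below_def)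
      then show ?thesis using below_antisym[OF y(1) \<eta>] by simp
    qed
    then show "\<exists>\<beta>\<in>W.leaves. below x \<beta>" using y by (auto simp: W.leaves_def below_def)
  qed
qed

text \<open>Descendants of x are joined to x by branches at or above its height. Any other point
  \<eta> of this height range is cut off by a level s with g x \<eta> < s < l x, at which the
  cluster of x is clopen.\<close>

lemma connected_component_above:
  assumes x: "x \<in> T"
  shows "connected_component_of_set (subtopology (Metric_space.mtopology T d) {\<eta> \<in> T. d root x \<le> d root \<eta>}) x
    = {\<eta> \<in> T. below x \<eta>}"
proof -
  interpret W: lower_subtree T l g d root T by (rule whole_lower_subtree)
  have dr: "d root y = l y - l root" if "y \<in> T" for y by (rule below_d[OF root that root_below[OF that]])
  define A where "A = {\<eta> \<in> T. d root x \<le> d root \<eta>}"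
  have A: "A = {\<eta> \<in> T. l x \<le> l \<eta>}" unfolding A_def using dr x by auto
  let ?Y = "subtopology W.MS.mtopology A"
  show ?thesis
    unfolding A_def[symmetric]
  proof (rule equalityI)
    have "connectedin ?Y (\<Union>\<eta>\<in>{\<eta> \<in> T. below x \<eta>}. W.branch \<eta> (l x))"
    proof (rule connectedin_Union)
      fix K assume "K \<in> (\<lambda>\<eta>. W.branch \<eta> (l x)) ` {\<eta> \<in> T. below x \<eta>}"
      then obtain \<eta> where \<eta>: "\<eta> \<in> T" "below x \<eta>" "K = W.branch \<eta> (l x)" by auto
      have "connectedin W.MS.mtopology K"
        unfolding \<eta>(3) by (rule W.branch_connected[OF \<eta>(1) root_le[OF x] below_l[OF x \<eta>(1,2)]])
      moreover have "K \<subseteq> A" unfolding \<eta>(3) A by (auto simp: W.branch_def)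
      ultimately show "connectedin ?Y K" by (simp add: connectedin_subtopology)
    next
      have "x \<in> W.branch \<eta> (l x)" if "below x \<eta>" for \<eta> using that x by (simp add: W.branch_def)
      then show "\<Inter> ((\<lambda>\<eta>. W.branch \<eta> (l x)) ` {\<eta> \<in> T. below x \<eta>}) \<noteq> {}" by blast
    qed
    moreover have "x \<in> (\<Union>\<eta>\<in>{\<eta> \<in> T. below x \<eta>}. W.branch \<eta> (l x))"
      using x below_refl[OF x] by (auto simp: W.branch_def)
    ultimately have "(\<Union>\<eta>\<in>{\<eta> \<in> T. below x \<eta>}. W.branch \<eta> (l x)) \<subseteq> connected_component_of_set ?Y x"
      by (rule connected_component_of_maximal)
    moreover have "\<eta> \<in> W.branch \<eta> (l x)" if "\<eta> \<in> T" "below x \<eta>" for \<eta>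
      using that below_refl[OF that(1)] below_l[OF x that] by (simp add: W.branch_def)
    ultimately show "{\<eta> \<in> T. below x \<eta>} \<subseteq> connected_component_of_set ?Y x" by blast
  next
    show "connected_component_of_set ?Y x \<subseteq> {\<eta> \<in> T. below x \<eta>}"
    proof
      fix \<eta> assume \<eta>: "\<eta> \<in> connected_component_of_set ?Y x"
      have topA: "topspace ?Y = A" using A by auto
      have \<eta>A: "\<eta> \<in> A" using \<eta> connected_component_of_subset_topspace[of ?Y x] topA by blast
      then have \<eta>T: "\<eta> \<in> T" by (simp add: A)
      have "below x \<eta>"
      proof (rule ccontr)
        assume "\<not> below x \<eta>"
        then obtain s where s: "g x \<eta> < s" "s < l x" using dense[of "g x \<eta>" "l x"] by (auto simp: below_def)
        \<comment> \<open>At heights \<ge> l x, points closer than l x - s merge above s; this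
          uniform radius makes both the cluster and its complement open.\<close>
        have near: "s < g \<zeta> \<xi>" if "\<zeta> \<in> A" "\<xi> \<in> T" "d \<zeta> \<xi> < l x - s" for \<zeta> \<xi>
          using that g_le2[of \<zeta> \<xi>] by (simp add: A d_eq)
        define W' where "W' = {\<zeta> \<in> A. s < g x \<zeta>}"
        have op: "openin W.MS.mtopology {\<zeta>' \<in> T. \<exists>\<zeta>\<in>K. d \<zeta> \<zeta>' < l x - s}" if "K \<subseteq> T" for K
        proof -
          have "{\<zeta>' \<in> T. \<exists>\<zeta>\<in>K. d \<zeta> \<zeta>' < l x - s} = (\<Union>\<zeta>\<in>K. W.MS.mball \<zeta> (l x - s))"
            using subsetD[OF that] by (auto simp: Bex_def)
          then show ?thesis by auto
        qed
        have AT: "A \<subseteq> T" by (auto simp: A)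
        have self: "d \<zeta> \<zeta> < l x - s" if "\<zeta> \<in> T" for \<zeta> using that s by (simp add: d_eq g_self)
        have eqW: "W' = {\<zeta>' \<in> T. \<exists>\<zeta>\<in>W'. d \<zeta> \<zeta>' < l x - s} \<inter> A"
        proof (intro equalityI subsetI)
          fix \<zeta> assume \<zeta>: "\<zeta> \<in> W'"
          then have "\<zeta> \<in> A" "\<zeta> \<in> T" using AT by (auto simp: W'_def)
          then show "\<zeta> \<in> {\<zeta>' \<in> T. \<exists>\<zeta>\<in>W'. d \<zeta> \<zeta>' < l x - s} \<inter> A" using self \<zeta> by blast
        next
          fix \<xi> assume "\<xi> \<in> {\<zeta>' \<in> T. \<exists>\<zeta>\<in>W'. d \<zeta> \<zeta>' < l x - s} \<inter> A"
          then obtain \<zeta> where \<zeta>: "\<zeta> \<in> A" "s < g x \<zeta>" "d \<zeta> \<xi> < l x - s" and \<xi>: "\<xi> \<in> T" "\<xi> \<in> A" by (auto simp: W'_def)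
          have "s < g x \<xi>" by (rule g_trans_less[OF x _ \<xi>(1) \<zeta>(2) near[OF \<zeta>(1) \<xi>(1) \<zeta>(3)]]) (use \<zeta> AT in auto)
          then show "\<xi> \<in> W'" using \<xi> by (simp add: W'_def)
        qed
        have "W' \<subseteq> T" "A - W' \<subseteq> T" using AT by (auto simp: W'_def)
        note opW = op[OF this(1)] and opA = op[OF this(2)]
        have openW: "openin ?Y W'" unfolding openin_subtopology by (rule exI, rule conjI[OF opW eqW])
        have eqA: "A - W' = {\<zeta>' \<in> T. \<exists>\<zeta>\<in>A - W'. d \<zeta> \<zeta>' < l x - s} \<inter> A"
        proof (intro equalityI subsetI)
          fix \<zeta> assume \<zeta>: "\<zeta> \<in> A - W'"
          then have "\<zeta> \<in> A" "\<zeta> \<in> T" using AT by auto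
          then show "\<zeta> \<in> {\<zeta>' \<in> T. \<exists>\<zeta>\<in>A - W'. d \<zeta> \<zeta>' < l x - s} \<inter> A" using self \<zeta> by blast
        next
          fix \<xi> assume "\<xi> \<in> {\<zeta>' \<in> T. \<exists>\<zeta>\<in>A - W'. d \<zeta> \<zeta>' < l x - s} \<inter> A"
          then obtain \<zeta> where \<zeta>: "\<zeta> \<in> A" "\<not> s < g x \<zeta>" "d \<zeta> \<xi> < l x - s" and \<xi>: "\<xi> \<in> T" "\<xi> \<in> A" by (auto simp: W'_def)
          have \<zeta>T: "\<zeta> \<in> T" using \<zeta> AT by auto
          have "s < g \<xi> \<zeta>" using near[OF \<zeta>(1) \<xi>(1) \<zeta>(3)] g_sym[OF \<xi>(1) \<zeta>T] by simp
          then have "\<not> s < g x \<xi>" using g_trans_less[OF x \<xi>(1) \<zeta>T] \<zeta>(2) by blast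
          then show "\<xi> \<in> A - W'" using \<xi> by (simp add: W'_def)
        qed
        have "openin ?Y (A - W')" unfolding openin_subtopology by (rule exI, rule conjI[OF opA eqA])
        then have closedW: "closedin ?Y W'" unfolding closedin_def topA by (auto simp: W'_def)
        have "connectedin ?Y (connected_component_of_set ?Y x)" by (rule connectedin_connected_component_of)
        then have "connected_component_of_set ?Y x \<subseteq> W' \<or> disjnt (connected_component_of_set ?Y x) W'"
          by (rule connectedin_clopen_cases[OF _ closedW openW])
        moreover have "x \<in> W'" using x s by (simp add: W'_def A g_self)
        moreover have "x \<in> connected_component_of_set ?Y x"
          using x by (simp add: connected_component_of_refl topA A)
        ultimately have "\<eta> \<in> W'" using \<eta> by (auto simp: disjnt_iff)
        then show False using s by (simp add: W'_def)
      qed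
      then show "\<eta> \<in> {\<eta> \<in> T. below x \<eta>}" using \<eta>T by simp
    qed
  qed
qed

text \<open>By \<open>connected_component_above\<close> the supremum in \<open>height_above\<close>
  runs over the descendants, and it is attained. Trimming thereby becomes a matter of order and
  heights alone.\<close>

lemma trimmed_tree_eq:
  "trimmed_tree T d root \<epsilon> = {x \<in> T. \<exists>y\<in>T. below x y \<and> l x + \<epsilon> \<le> l y}"
proof -
  have "\<epsilon> \<le> height_above T d root x \<longleftrightarrow> (\<exists>y\<in>T. below x y \<and> l x + \<epsilon> \<le> l y)" if x: "x \<in> T" for x
  proof -
    have dr: "d root y = l y - l root" if "y \<in> T" for y by (rule below_d[OF root that root_below[OF that]])
    obtain y where y: "y \<in> T" "below x y" "\<And>z. z \<in> T \<Longrightarrow> below x z \<Longrightarrow> l z \<le> l y"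
      using closed_max[OF x order_refl] by (auto simp: below_def)
    have "(SUP \<eta>\<in>{\<eta> \<in> T. below x \<eta>}. d root \<eta>) = l y - l root"
      by (rule cSup_eq_maximum) (use y dr in auto)
    then have "height_above T d root x = l y - l x"
      unfolding height_above_def connected_component_above[OF x] by (simp add: dr x)
    then show ?thesis using y by force
  qed
  then show ?thesis unfolding trimmed_tree_def by auto
qed

text \<open>Over each leaf of the trimmed tree there is a tip of \<open>T\<close> at least
  \<epsilon> higher. Tips over different leaves are more than 2 \<epsilon> apart, so an
  \<epsilon>-net bounds the number of leaves.\<close>

lemma trimmed_finite_subtree:
  assumes \<epsilon>: "0 < \<epsilon>" and ne: "trimmed_tree T d root \<epsilon> \<noteq> {}"
  shows "finite_subtree T l g d root (trimmed_tree T d root \<epsilon>)"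
proof -
  let ?S = "trimmed_tree T d root \<epsilon>"
  have low: "y \<in> ?S" if "x \<in> ?S" "y \<in> T" "below y x" for x y
  proof -
    obtain z where z: "x \<in> T" "z \<in> T" "below x z" "l x + \<epsilon> \<le> l z" using \<open>x \<in> ?S\<close> by (auto simp: trimmed_tree_eq)
    have "below y z" "l y + \<epsilon> \<le> l z"
      using below_trans[OF that(2) z(1,2) that(3) z(3)] below_l[OF that(2) z(1) that(3)] z(4) by auto
    then show ?thesis using z that by (auto simp: trimmed_tree_eq)
  qed
  interpret W: lower_subtree T l g d root ?S
  proof unfold_locales
    show "?S \<subseteq> T" by (auto simp: trimmed_tree_eq)
    obtain x where x: "x \<in> ?S" using ne by auto
    then have "x \<in> T" by (simp add: trimmed_tree_eq)
    then show "root \<in> ?S" by (intro low[OF x root root_below])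
  qed (rule low)
  show ?thesis
  proof unfold_locales
    fix x assume "x \<in> ?S"
    then obtain y0 where x: "x \<in> T" and y0: "y0 \<in> T" "below x y0" "l x + \<epsilon> \<le> l y0" by (auto simp: trimmed_tree_eq)
    obtain y where y: "y \<in> T" "below x y" "\<And>z. z \<in> T \<Longrightarrow> below x z \<Longrightarrow> l z \<le> l y"
      using closed_max[OF x order_refl] by (auto simp: below_def)
    have h: "l x \<le> l y - \<epsilon>" "l y - \<epsilon> \<le> l y" "l root \<le> l y - \<epsilon>"
      using y(3)[OF y0(1,2)] y0(3) \<epsilon> root_le[OF x] by auto
    \<comment> \<open>Descending by \<epsilon> from a highest descendant y of x gives a leaf above
      x.\<close>
    let ?\<beta> = "cut y (l y - \<epsilon>)"
    note c = cut[OF y(1) h(3,2)]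
    have x\<beta>: "below x ?\<beta>" by (rule below_common[OF x c(1) y(1) y(2) c(3)]) (use c h in simp)
    have \<beta>S: "?\<beta> \<in> ?S" using c y by (auto simp: trimmed_tree_eq)
    have "\<eta> = ?\<beta>" if \<eta>: "\<eta> \<in> ?S" "below ?\<beta> \<eta>" for \<eta>
    proof -
      obtain z where z: "\<eta> \<in> T" "z \<in> T" "below \<eta> z" "l \<eta> + \<epsilon> \<le> l z" using \<eta>(1) by (auto simp: trimmed_tree_eq)
      have "below x z" by (rule below_trans[OF x c(1) z(2) x\<beta> below_trans[OF c(1) z(1,2) \<eta>(2) z(3)]])
      then have "l \<eta> \<le> l ?\<beta>" using y(3)[OF z(2)] z(4) c(2) by simp
      then show ?thesis using below_antisym[OF c(1) z(1) \<eta>(2)] by simp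
    qed
    then show "\<exists>\<beta>\<in>W.leaves. below x \<beta>" using x\<beta> \<beta>S by (auto simp: W.leaves_def)
  next
    obtain N where N: "finite N" "N \<subseteq> T" "\<And>y. y \<in> T \<Longrightarrow> \<exists>x\<in>N. l x + l y - 2 * g x y < \<epsilon>"
      using totally_bounded[OF \<epsilon>] by blast
    have "\<forall>\<beta>\<in>W.leaves. \<exists>y. y \<in> T \<and> below \<beta> y \<and> l \<beta> + \<epsilon> \<le> l y"
    proof
      fix \<beta> assume "\<beta> \<in> W.leaves"
      then have "\<beta> \<in> ?S" unfolding W.leaves_def by blast
      then show "\<exists>y. y \<in> T \<and> below \<beta> y \<and> l \<beta> + \<epsilon> \<le> l y" unfolding trimmed_tree_eq by blast
    qed
    then obtain y where y: "\<And>\<beta>. \<beta> \<in> W.leaves \<Longrightarrow> y \<beta> \<in> T \<and> below \<beta> (y \<beta>) \<and> l \<beta> + \<epsilon> \<le> l (y \<beta>)" by metis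
    have "\<forall>\<beta>\<in>W.leaves. \<exists>x. x \<in> N \<and> d x (y \<beta>) < \<epsilon>"
      using N y by (metis d_eq subsetD)
    then obtain n where n: "\<And>\<beta>. \<beta> \<in> W.leaves \<Longrightarrow> n \<beta> \<in> N \<and> d (n \<beta>) (y \<beta>) < \<epsilon>" by metis
    have "inj_on n W.leaves"
    proof (rule inj_onI, rule ccontr)
      fix \<beta> \<gamma> assume \<beta>: "\<beta> \<in> W.leaves" and \<gamma>: "\<gamma> \<in> W.leaves" and eq: "n \<beta> = n \<gamma>" and "\<beta> \<noteq> \<gamma>"
      interpret M: Metric_space T d by (rule Metric_space_tree)
      have yT: "y \<beta> \<in> T" "y \<gamma> \<in> T" "n \<beta> \<in> T" using y[OF \<beta>] y[OF \<gamma>] n[OF \<beta>] N by auto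
      have lT: "\<beta> \<in> T" "\<gamma> \<in> T" using \<beta> \<gamma> W.in_T by (auto simp: W.leaves_def)
      have small: "d (y \<beta>) (y \<gamma>) < 2 * \<epsilon>"
        using M.triangle[OF yT(1,3,2)] n[OF \<beta>] n[OF \<gamma>] eq M.commute[of "y \<beta>" "n \<beta>"] by simp
      have incomp: "\<not> below b c" if "b \<in> W.leaves" "c \<in> W.leaves" "b \<noteq> c" for b c
        using that by (auto simp: W.leaves_def)
      \<comment> \<open>Otherwise b lies below both tips and is therefore comparable with c.\<close>
      have less: "g (y b) (y c) < l b" if b: "b \<in> W.leaves" "c \<in> W.leaves" "b \<noteq> c" for b c
      proof (rule ccontr)
        assume "\<not> g (y b) (y c) < l b"
        then have le: "l b \<le> g (y b) (y c)" by simp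
        have T: "b \<in> T" "c \<in> T" "y b \<in> T" "y c \<in> T" using b y W.in_T by (auto simp: W.leaves_def)
        have "below b (y c)" using g_ultra[OF T(1,3,4)] y[OF b(1)] le by (auto simp: below_def min_def split: if_splits)
        then have "below b c \<or> below c b"
          using below_common[OF T(1,2,4)] below_common[OF T(2,1,4)] y[OF b(2)] by (cases "l b \<le> l c") auto
        then show False using incomp b by metis
      qed
      have "g (y \<beta>) (y \<gamma>) < l \<beta>" "g (y \<beta>) (y \<gamma>) < l \<gamma>"
        using less[OF \<beta> \<gamma> \<open>\<beta> \<noteq> \<gamma>\<close>] less[OF \<gamma> \<beta>] \<open>\<beta> \<noteq> \<gamma>\<close> g_sym[OF yT(1,2)] by auto
      then show False using small y[OF \<beta>] y[OF \<gamma>] by (simp add: d_eq yT)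
    qed
    then show "finite W.leaves"
      by (rule inj_on_finite[OF _ _ N(1)]) (use n in auto)
  qed
qed

text \<open>Trimming lowers the top of each cluster by \<epsilon>: a point higher than r +
  \<epsilon> corresponds to its ancestor \<epsilon> below, which belongs to the same cluster because
  s < r.\<close>

lemma trimmed_clusters:
  assumes \<epsilon>: "0 < \<epsilon>" and ne: "trimmed_tree T d root \<epsilon> \<noteq> {}" and sr: "s < r"
  shows "cls s ` {x \<in> trimmed_tree T d root \<epsilon>. r < l x} = tall_clusters s (r + \<epsilon>)"
proof (intro equalityI subsetI)
  fix C assume "C \<in> cls s ` {x \<in> trimmed_tree T d root \<epsilon>. r < l x}"
  then obtain x y where x: "x \<in> T" "r < l x" "C = cls s x" and y: "y \<in> T" "below x y" "l x + \<epsilon> \<le> l y"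
    by (auto simp: trimmed_tree_eq)
  have "y \<in> cls s x" using x y sr by (simp add: cls_def below_def)
  then have "C = cls s y" using cls_eq[OF x(1)] x by simp
  moreover have "r + \<epsilon> < l y" using x y by simp
  ultimately show "C \<in> tall_clusters s (r + \<epsilon>)" using y by (auto simp: tall_clusters_def)
next
  interpret F: finite_subtree T l g d root "trimmed_tree T d root \<epsilon>" by (rule trimmed_finite_subtree[OF \<epsilon> ne])
  fix C assume "C \<in> tall_clusters s (r + \<epsilon>)"
  then obtain y where y: "y \<in> T" "r + \<epsilon> < l y" "C = cls s y" by (auto simp: tall_clusters_def)
  show "C \<in> cls s ` {x \<in> trimmed_tree T d root \<epsilon>. r < l x}"
  proof (cases "l root \<le> r")
    case True
    let ?x = "cut y (l y - \<epsilon>)"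
    have h: "l root \<le> l y - \<epsilon>" "l y - \<epsilon> \<le> l y" using True y \<epsilon> by auto
    note c = cut[OF y(1) h]
    have "?x \<in> trimmed_tree T d root \<epsilon>" using c y by (auto simp: trimmed_tree_eq)
    moreover have "r < l ?x" using c y by simp
    moreover have "y \<in> cls s ?x" using c y sr by (simp add: cls_def below_def)
    then have "C = cls s ?x" using cls_eq[OF c(1)] y by simp
    ultimately show ?thesis by blast
  next
    case False
    \<comment> \<open>Here the ancestor may fall below the root. Then s is below the root as well,
      all points form one cluster, and the root represents it.\<close>
    have "y \<in> cls s root" using False sr y root_g[OF y(1)] by (simp add: cls_def)
    then have "C = cls s root" using cls_eq[OF root] y by simp
    then show ?thesis using F.root_S False by auto
  qed
qed

lemma tall_card_finite_tree:
  assumes "finite_tree T d root" "alg_finite T d l bs"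
  shows "i < length bs \<Longrightarrow> fst (bs ! i) < ereal (snd (bs ! i))"
    and "s < r \<Longrightarrow> card (long_bars {..<length bs} (\<lambda>i. bs ! i) s r) = card (tall_clusters s r)"
proof -
  interpret F: finite_subtree T l g d root T by (rule finite_tree_subtree[OF assms(1)])
  show "i < length bs \<Longrightarrow> fst (bs ! i) < ereal (snd (bs ! i))" using F.alg_finite_bars(1)[OF assms(2)] .
  show "s < r \<Longrightarrow> card (long_bars {..<length bs} (\<lambda>i. bs ! i) s r) = card (tall_clusters s r)"
    using F.alg_finite_bars(3)[OF assms(2)] by (simp add: F.tall_def tall_clusters_def)
qed

lemma alg_finite_tree_exists:
  assumes "finite_tree T d root"
  shows "\<exists>bs. alg_finite T d l bs"
proof -
  interpret F: finite_subtree T l g d root T by (rule finite_tree_subtree[OF assms])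
  show ?thesis by (rule F.alg_finite_exists)
qed

lemma alg_trimmed_exists:
  assumes \<epsilon>: "0 < \<epsilon>"
  shows "\<exists>bs. alg_finite (trimmed_tree T d root \<epsilon>) d l bs"
proof (cases "trimmed_tree T d root \<epsilon> = {}")
  case False
  interpret F: finite_subtree T l g d root "trimmed_tree T d root \<epsilon>" by (rule trimmed_finite_subtree[OF \<epsilon> False])
  show ?thesis by (rule F.alg_finite_exists)
qed (simp add: alg_finite_empty)

lemma alg_trimmed_bars:
  assumes \<epsilon>: "0 < \<epsilon>" and bs: "alg_finite (trimmed_tree T d root \<epsilon>) d l bs"
  shows "i < length bs \<Longrightarrow> fst (bs ! i) < ereal (snd (bs ! i))"
    and "i < length bs \<Longrightarrow> snd (bs ! i) \<in> l ` T"
    and "trimmed_tree T d root \<epsilon> \<noteq> {} \<Longrightarrow> s < r \<Longrightarrow>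
      card (long_bars {..<length bs} (\<lambda>i. bs ! i) s r) = card (tall_clusters s (r + \<epsilon>))"
    and "trimmed_tree T d root \<epsilon> = {} \<Longrightarrow> bs = []"
proof -
  show e: "trimmed_tree T d root \<epsilon> = {} \<Longrightarrow> bs = []" using bs by (simp add: alg_finite_empty)
  have ne: "trimmed_tree T d root \<epsilon> \<noteq> {}" if "i < length bs" using e that by auto
  have *: "fst (bs ! i) < ereal (snd (bs ! i)) \<and> snd (bs ! i) \<in> l ` T" if i: "i < length bs"
  proof -
    interpret F: finite_subtree T l g d root "trimmed_tree T d root \<epsilon>" by (rule trimmed_finite_subtree[OF \<epsilon> ne[OF i]])
    show ?thesis using F.alg_finite_bars(1,2)[OF bs i] F.sub by blast
  qed
  then show "i < length bs \<Longrightarrow> fst (bs ! i) < ereal (snd (bs ! i))" "i < length bs \<Longrightarrow> snd (bs ! i) \<in> l ` T" by auto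
  assume n: "trimmed_tree T d root \<epsilon> \<noteq> {}" and sr: "s < r"
  interpret F: finite_subtree T l g d root "trimmed_tree T d root \<epsilon>" by (rule trimmed_finite_subtree[OF \<epsilon> n])
  show "card (long_bars {..<length bs} (\<lambda>i. bs ! i) s r) = card (tall_clusters s (r + \<epsilon>))"
    using F.alg_finite_bars(3)[OF bs sr] unfolding F.tall_def trimmed_clusters[OF \<epsilon> n sr] .
qed

lemma trimmed_antimono: "\<epsilon>' \<le> \<epsilon> \<Longrightarrow> trimmed_tree T d root \<epsilon> \<subseteq> trimmed_tree T d root \<epsilon>'"
  by (fastforce simp: trimmed_tree_eq)

text \<open>After the births of the finer list are lowered by \<epsilon> - \<epsilon>', both lists
  have the same counts, hence the same multiplicity for each bar of the coarser list.\<close>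

lemma trimmed_matching:
  assumes \<epsilon>: "0 < \<epsilon>'" "\<epsilon>' \<le> \<epsilon>"
    and bs: "alg_finite (trimmed_tree T d root \<epsilon>) d l bs" "alg_finite (trimmed_tree T d root \<epsilon>') d l bs'"
  shows "\<exists>\<sigma>. bar_matching bs bs' \<sigma>"
proof (cases "trimmed_tree T d root \<epsilon> = {}")
  case True
  then show ?thesis using alg_trimmed_bars(4)[OF _ bs(1)] \<epsilon> by (simp add: bar_matching_def)
next
  case False
  have \<epsilon>0: "0 < \<epsilon>" using \<epsilon> by simp
  have ne': "trimmed_tree T d root \<epsilon>' \<noteq> {}" using trimmed_antimono[OF \<epsilon>(2)] False by blast
  note b = alg_trimmed_bars[OF \<epsilon>0 bs(1)] and b' = alg_trimmed_bars[OF \<epsilon>(1) bs(2)]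
  define \<delta> where "\<delta> = \<epsilon> - \<epsilon>'"
  have \<delta>: "0 \<le> \<delta>" using \<epsilon> by (simp add: \<delta>_def)
  define e where "e = (\<lambda>i. bs ! i)"
  \<comment> \<open>Lowered bars may be degenerate. Only values taken by the coarser list, which are
    nondegenerate, are compared, so the matching is injective but need not be onto.\<close>
  define e' where "e' = (\<lambda>i. (fst (bs' ! i), snd (bs' ! i) - \<delta>))"
  let ?I = "{..<length bs}" and ?I' = "{..<length bs'}"
  have N: "finite (long_bars ?I e s r) \<and> finite (long_bars ?I' e' s r) \<and> card (long_bars ?I e s r) = card (long_bars ?I' e' s r)"
    if sr: "s < r" for s r
  proof -
    have "long_bars ?I' e' s r = long_bars ?I' (\<lambda>i. bs' ! i) s (r + \<delta>)" by (auto simp: long_bars_def e'_def)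
    moreover have "card (long_bars ?I' (\<lambda>i. bs' ! i) s (r + \<delta>)) = card (tall_clusters s (r + \<delta> + \<epsilon>'))"
      using b'(3)[OF ne', of s "r + \<delta>"] sr \<delta> by simp
    moreover have "card (long_bars ?I e s r) = card (tall_clusters s (r + \<epsilon>))"
      unfolding e_def by (rule b(3)[OF False sr])
    ultimately show ?thesis by (simp add: \<delta>_def long_bars_def)
  qed
  have fib: "finite {j \<in> ?I. e j = e i} \<and> finite {j \<in> ?I'. e' j = id (e i)} \<and>
     card {j \<in> ?I. e j = e i} = card {j \<in> ?I'. e' j = id (e i)}" if "i \<in> ?I" for i
    using card_fibre_eq[of ?I e ?I' e' "fst (e i)" "snd (e i)", OF N] b(1)[of i] that by (simp add: e_def)
  obtain \<pi> where \<pi>: "inj_on \<pi> ?I" "\<pi> ` ?I = {j \<in> ?I'. e' j \<in> id ` e ` ?I}" "\<forall>i\<in>?I. e' (\<pi> i) = id (e i)"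
    using inj_of_card_fibres[of ?I e ?I' e' id, OF fib] by auto
  have "\<pi> i < length bs' \<and> fst (bs' ! \<pi> i) = fst (bs ! i) \<and> bar_interval (bs ! i) \<subseteq> bar_interval (bs' ! \<pi> i)"
    if i: "i < length bs" for i
  proof -
    have 1: "\<pi> i < length bs'" using \<pi>(2) i by blast
    have "e' (\<pi> i) = e i" using \<pi>(3) i by simp
    then have 2: "fst (bs' ! \<pi> i) = fst (bs ! i)" "snd (bs' ! \<pi> i) - \<delta> = snd (bs ! i)"
      unfolding e'_def e_def by (metis fst_conv, metis snd_conv)
    then show ?thesis using 1 \<delta> by (auto simp: bar_interval_def)
  qed
  then show ?thesis using \<pi>(1) unfolding bar_matching_def by blast
qed

lemma alg_system_exists:
  assumes "\<And>n. 0 < \<epsilon> n" "decseq \<epsilon>"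
  shows "\<exists>bs \<sigma>. alg_system T d root l \<epsilon> bs \<sigma>"
proof -
  obtain bs where bs: "\<And>n. alg_finite (trimmed_tree T d root (\<epsilon> n)) d l (bs n)"
    using alg_trimmed_exists[OF assms(1)] by metis
  have "\<forall>n. \<exists>\<sigma>. bar_matching (bs n) (bs (Suc n)) \<sigma>"
    using trimmed_matching[OF assms(1) _ bs bs] decseqD[OF assms(2)] by simp
  then obtain \<sigma> where "\<And>n. bar_matching (bs n) (bs (Suc n)) (\<sigma> n)" by metis
  then show ?thesis using bs unfolding alg_system_def by blast
qed

lemma l_bounded: "\<exists>M. \<forall>x\<in>T. l x \<le> M"
  using closed_max[OF root order_refl] root_g by auto

text \<open>For large n the shift by \<epsilon> n is below the margin of
  \<open>tall_clusters_stable\<close>, and a point above the root keeps the trimmed tree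
  nonempty.\<close>

lemma alg_system_bars:
  assumes pos: "\<And>n. 0 < \<epsilon> n" and lim: "\<epsilon> \<longlonglongrightarrow> 0" and sys: "alg_system T d root l \<epsilon> bs \<sigma>"
    and high: "\<exists>x\<in>T. l root < l x"
  shows "\<exists>M. bar_system bs \<sigma> M"
    and "s < r \<Longrightarrow> \<exists>n0. \<forall>n\<ge>n0. card (long_bars {..<length (bs n)} (\<lambda>i. bs n ! i) s r) = card (tall_clusters s r)"
proof -
  have alg: "alg_finite (trimmed_tree T d root (\<epsilon> n)) d l (bs n)" "bar_matching (bs n) (bs (Suc n)) (\<sigma> n)" for n
    using sys by (auto simp: alg_system_def)
  obtain M where M: "\<And>x. x \<in> T \<Longrightarrow> l x \<le> M" using l_bounded by blast
  have "bar_system bs \<sigma> M"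
  proof
    show "bar_matching (bs n) (bs (Suc n)) (\<sigma> n)" for n by (rule alg(2))
    show "snd (bs n ! i) \<le> M" if "i < length (bs n)" for n i
      using alg_trimmed_bars(2)[OF pos alg(1) that] M by auto
    show "fst (bs n ! i) < ereal (snd (bs n ! i))" if "i < length (bs n)" for n i
      by (rule alg_trimmed_bars(1)[OF pos alg(1) that])
  qed
  then show "\<exists>M. bar_system bs \<sigma> M" ..
  assume sr: "s < r"
  obtain e where e: "0 < e" "\<And>\<epsilon>. 0 < \<epsilon> \<Longrightarrow> \<epsilon> < e \<Longrightarrow> tall_clusters s (r + \<epsilon>) = tall_clusters s r"
    using tall_clusters_stable[OF sr] by blast
  obtain x where x: "x \<in> T" "l root < l x" using high by blast
  have "0 < min e (l x - l root)" using e x by simp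
  then obtain n0 where n0: "\<And>n. n0 \<le> n \<Longrightarrow> \<epsilon> n < min e (l x - l root)"
    using order_tendstoD(2)[OF lim] unfolding eventually_sequentially by blast
  have "card (long_bars {..<length (bs n)} (\<lambda>i. bs n ! i) s r) = card (tall_clusters s r)" if n: "n0 \<le> n" for n
  proof -
    have "root \<in> trimmed_tree T d root (\<epsilon> n)"
      using root x root_below[OF x(1)] n0[OF n] by (auto simp: trimmed_tree_eq intro!: bexI[of _ x])
    then have "trimmed_tree T d root (\<epsilon> n) \<noteq> {}" by blast
    then show ?thesis using alg_trimmed_bars(3)[OF pos alg(1) _ sr, of n] e(2)[OF pos, of n] n0[OF n] by simp
  qed
  then show "\<exists>n0. \<forall>n\<ge>n0. card (long_bars {..<length (bs n)} (\<lambda>i. bs n ! i) s r) = card (tall_clusters s r)" by blast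
qed

lemma infinite_tree_high:
  assumes "\<not> finite_tree T d root"
  shows "\<exists>x\<in>T. l root < l x"
proof (rule ccontr)
  assume "\<not> (\<exists>x\<in>T. l root < l x)"
  then have "x = root" if "x \<in> T" for x
    using below_antisym[OF root that root_below[OF that]] that by force
  then have "{\<beta>. is_leaf T d T root \<beta>} \<subseteq> {root}" by (auto simp: is_leaf_def)
  then show False using assms finite_subset unfolding finite_tree_def by blast
qed

end


section \<open>The tree of a function\<close>

locale compact_function =
  fixes X :: "'a topology" and f :: "'a \<Rightarrow> real"
  assumes compact: "compact_space X" and connected: "connected_space X"
    and locally: "locally_path_connected_space X"
    and cont: "continuous_map X euclideanreal f"
begin

abbreviation "A \<equiv> topspace X"

definition merge_height :: "'a \<Rightarrow> 'a \<Rightarrow> real" where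
  "merge_height x y = (SUP \<gamma> \<in> {\<gamma>. pathin X \<gamma> \<and> \<gamma> 0 = x \<and> \<gamma> 1 = y}. INF t\<in>{0..1}. f (\<gamma> t))"

lemma path_exists: "x \<in> A \<Longrightarrow> y \<in> A \<Longrightarrow> \<exists>\<gamma>. pathin X \<gamma> \<and> \<gamma> 0 = x \<and> \<gamma> 1 = y"
  using path_connected_eq_connected_space[OF locally] connected by (auto simp: path_connected_space_def)

lemma path_in: "pathin X \<gamma> \<Longrightarrow> t \<in> {0..1} \<Longrightarrow> \<gamma> t \<in> A"
  by (auto simp: pathin_def continuous_map_def)

lemma path_cont: "pathin X \<gamma> \<Longrightarrow> continuous_on {0..1} (\<lambda>t. f (\<gamma> t))"
  using pathin_compose[OF _ cont, of \<gamma>] by (simp add: pathin_def comp_def)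

lemma path_min:
  assumes "pathin X \<gamma>"
  obtains t where "t \<in> {0..1}" "(INF t\<in>{0..1}. f (\<gamma> t)) = f (\<gamma> t)" "\<And>u. u \<in> {0..1} \<Longrightarrow> f (\<gamma> t) \<le> f (\<gamma> u)"
proof -
  obtain t where t: "t \<in> {0..1}" "\<And>u. u \<in> {0..1} \<Longrightarrow> f (\<gamma> t) \<le> f (\<gamma> u)"
    using continuous_attains_inf[OF compact_Icc _ path_cont[OF assms]] by auto
  have "(INF t\<in>{0..1}. f (\<gamma> t)) = f (\<gamma> t)" by (rule cInf_eq_minimum) (use t in auto)
  then show ?thesis using that t by blast
qed

lemma attains_sup:
  assumes "closedin X C" "C \<noteq> {}"
  shows "\<exists>y\<in>C. \<forall>z\<in>C. f z \<le> f y"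
proof -
  have "compact (f ` C)"
    using image_compactin[OF closedin_compact_space[OF compact assms(1)] cont] by simp
  then show ?thesis using compact_attains_sup[of "f ` C"] assms(2) by auto
qed

lemma attains_inf:
  assumes "A \<noteq> {}"
  shows "\<exists>y\<in>A. \<forall>z\<in>A. f y \<le> f z"
proof -
  have "compact (f ` A)"
    using image_compactin[OF closedin_compact_space[OF compact closedin_topspace] cont] by simp
  then show ?thesis using compact_attains_inf[of "f ` A"] assms by auto
qed

lemma path_inf_le: "pathin X \<gamma> \<Longrightarrow> t \<in> {0..1} \<Longrightarrow> (INF t\<in>{0..1}. f (\<gamma> t)) \<le> f (\<gamma> t)"
  by (erule path_min) auto

lemma paths_bdd: "bdd_above ((\<lambda>\<gamma>. INF t\<in>{0..1}. f (\<gamma> t)) ` {\<gamma>. pathin X \<gamma> \<and> \<gamma> 0 = x \<and> \<gamma> 1 = y})"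
  using path_inf_le[of _ 0] by (auto intro!: bdd_aboveI[of _ "f x"])

text \<open>Paths attain their minimum, so a strict lower bound passes from the supremum to a single
  path and then to all its points. Symmetry and the ultrametric inequality are inherited from path
  components.\<close>

lemma merge_height_gt:
  assumes "x \<in> A" "y \<in> A"
  shows "s < merge_height x y \<longleftrightarrow> path_component_of (subtopology X {x \<in> A. s < f x}) x y"
proof -
  let ?P = "{\<gamma>. pathin X \<gamma> \<and> \<gamma> 0 = x \<and> \<gamma> 1 = y}"
  have "s < merge_height x y \<longleftrightarrow> (\<exists>\<gamma>\<in>?P. s < (INF t\<in>{0..1}. f (\<gamma> t)))"
    unfolding merge_height_def by (rule less_cSUP_iff) (use path_exists[OF assms] paths_bdd in auto)
  also have "\<dots> \<longleftrightarrow> (\<exists>\<gamma>\<in>?P. \<forall>t\<in>{0..1}. s < f (\<gamma> t))"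
  proof (intro bex_cong refl)
    fix \<gamma> assume "\<gamma> \<in> ?P"
    then have p: "pathin X \<gamma>" by simp
    obtain t where t: "t \<in> {0..1}" "(INF t\<in>{0..1}. f (\<gamma> t)) = f (\<gamma> t)" "\<And>u. u \<in> {0..1} \<Longrightarrow> f (\<gamma> t) \<le> f (\<gamma> u)"
      by (rule path_min[OF p]) blast
    show "s < (INF t\<in>{0..1}. f (\<gamma> t)) \<longleftrightarrow> (\<forall>t\<in>{0..1}. s < f (\<gamma> t))"
      unfolding t(2) using t(1,3) by (auto intro: less_le_trans)
  qed
  also have "\<dots> \<longleftrightarrow> path_component_of (subtopology X {x \<in> A. s < f x}) x y"
    unfolding path_component_of_def pathin_subtopology using path_in by auto
  finally show ?thesis .
qed

lemma merge_height_le: "x \<in> A \<Longrightarrow> y \<in> A \<Longrightarrow> merge_height x y \<le> f x"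
  unfolding merge_height_def using path_exists[of x y] path_inf_le[of _ 0]
  by (intro cSUP_least) auto

sublocale merge_space A f merge_height
proof
  fix x assume x: "x \<in> A"
  \<comment> \<open>Equality is tested on all s below f x, where reflexivity of path components
    applies.\<close>
  have "s \<le> merge_height x x" if "s < f x" for s
    using merge_height_gt[OF x x, of s] that x by (simp add: path_component_of_refl)
  then have "f x \<le> merge_height x x" by (rule dense_le)
  then show "merge_height x x = f x" using merge_height_le[OF x x] by simp
next
  fix x y assume xy: "x \<in> A" "y \<in> A"
  have "s < merge_height x y \<longleftrightarrow> s < merge_height y x" for s
    unfolding merge_height_gt[OF xy] merge_height_gt[OF xy(2,1)] by (rule path_component_of_sym_iff)
  then show "merge_height x y = merge_height y x" by (meson less_irrefl not_less_iff_gr_or_eq)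
  show "merge_height x y \<le> f x" by (rule merge_height_le[OF xy])
next
  fix x y z assume xyz: "x \<in> A" "y \<in> A" "z \<in> A"
  have "s \<le> merge_height x z" if "s < min (merge_height x y) (merge_height y z)" for s
  proof -
    have "s < merge_height x y" "s < merge_height y z" using that by auto
    then have "s < merge_height x z"
      unfolding merge_height_gt[OF xyz(1,2)] merge_height_gt[OF xyz(2,3)] merge_height_gt[OF xyz(1,3)]
      by (rule path_component_of_trans)
    then show ?thesis by simp
  qed
  then show "min (merge_height x y) (merge_height y z) \<le> merge_height x z" by (rule dense_le)
qed

lemma cls_path_component:
  assumes "x \<in> A" "s < f x"
  shows "cls s x = path_component_of_set (subtopology X {x \<in> A. s < f x}) x"
proof (intro equalityI subsetI)
  fix y assume "y \<in> cls s x"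
  then have y: "y \<in> A" "s < merge_height x y" by (simp_all add: cls_def)
  show "y \<in> path_component_of_set (subtopology X {x \<in> A. s < f x}) x"
    using y(2) unfolding merge_height_gt[OF assms(1) y(1)] by (rule CollectI)
next
  fix y assume "y \<in> path_component_of_set (subtopology X {x \<in> A. s < f x}) x"
  then have y: "path_component_of (subtopology X {x \<in> A. s < f x}) x y" by (rule CollectD)
  then have yA: "y \<in> A" using path_component_in_topspace[OF y] by simp
  show "y \<in> cls s x" unfolding cls_def using yA y merge_height_gt[OF assms(1) yA, of s] by blast
qed

lemma above_open: "openin X {x \<in> A. s < f x}"
  using openin_continuous_map_preimage[OF cont, of "{s<..}"] by simp

lemma cls_open: 
  assumes "x \<in> A" "s < f x"
  shows "openin X (cls s x)"
proof -
  have "openin (subtopology X {x \<in> A. s < f x}) (cls s x)"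
    unfolding cls_path_component[OF assms]
    by (rule openin_path_component_of_locally_path_connected_space[OF locally_path_connected_space_open_subset[OF locally above_open]])
  then show ?thesis using openin_open_subtopology[OF above_open] by simp
qed

lemma cls_connected:
  assumes "x \<in> A" "s < f x"
  shows "connectedin X (cls s x)"
proof -
  have "path_connectedin (subtopology X {x \<in> A. s < f x}) (cls s x)"
    unfolding cls_path_component[OF assms] by (rule path_connectedin_path_component_of)
  then show ?thesis unfolding path_connectedin_subtopology by (intro path_connectedin_imp_connectedin) simp
qed

sublocale superlevel_parts clusters X f
proof
  fix C s assume "C \<in> clusters s"
  then show "openin X C" "connectedin X C" using cls_open cls_connected by (auto simp: clusters_def)
next
  fix s show "\<Union> (clusters s) = {x \<in> A. s < f x}"
  proof (intro equalityI subsetI)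
    fix y assume "y \<in> \<Union> (clusters s)"
    then obtain x where "x \<in> A" "y \<in> cls s x" by (auto simp: clusters_def)
    then show "y \<in> {x \<in> A. s < f x}" using cls_less by simp
  next
    fix y assume "y \<in> {x \<in> A. s < f x}"
    then show "y \<in> \<Union> (clusters s)" using cls_self[of y s] by (auto simp: clusters_def)
  qed
qed

text \<open>A path connected neighbourhood on which f differs from f x by less than \<delta>/4 keeps
  the distance from x below 3/4 \<delta>. So the pseudo-distance topology is coarser than that of X,
  and compactness of X yields finite nets.\<close>

lemma near:
  assumes x: "x \<in> A" and \<delta>: "0 < \<delta>"
  shows "\<exists>U. openin X U \<and> x \<in> U \<and> (\<forall>y\<in>U. f x + f y - 2 * merge_height x y < \<delta>)"
proof -
  let ?V = "{y \<in> A. f y \<in> ball (f x) (\<delta> / 4)}"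
  have "openin X ?V" by (rule openin_continuous_map_preimage[OF cont]) simp
  then obtain U where U: "openin X U" "path_connectedin X U" "x \<in> U" "U \<subseteq> ?V"
    using locally x \<delta> unfolding locally_path_connected_space by (metis (no_types, lifting) centre_in_ball divide_pos_pos mem_Collect_eq zero_less_numeral)
  have "f x + f y - 2 * merge_height x y < \<delta>" if y: "y \<in> U" for y
  proof -
    have yA: "y \<in> A" and fy: "\<bar>f x - f y\<bar> < \<delta> / 4" using y U(4) by (auto simp: dist_real_def)
    have "path_component_of (subtopology X U) x y"
      using U(2) y U(3) openin_subset[OF U(1)]
      by (auto simp: path_connectedin_def path_connected_space_iff_path_component)
    moreover have "U \<subseteq> {z \<in> A. f x - \<delta> / 4 < f z}"
    proof
      fix z assume "z \<in> U"
      then have "z \<in> A" "\<bar>f x - f z\<bar> < \<delta> / 4" using U(4) by (auto simp: dist_real_def)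
      moreover from this(2) have "f x - \<delta> / 4 < f z" by linarith
      ultimately show "z \<in> {z \<in> A. f x - \<delta> / 4 < f z}" by blast
    qed
    ultimately have "path_component_of (subtopology X {z \<in> A. f x - \<delta> / 4 < f z}) x y"
      by (rule path_component_of_mono)
    then have "f x - \<delta> / 4 < merge_height x y" using merge_height_gt[OF x yA] by simp
    then show ?thesis using fy by linarith
  qed
  then show ?thesis using U by blast
qed

sublocale compact_merge_space A f merge_height
proof
  fix \<delta> :: real assume \<delta>: "0 < \<delta>"
  obtain U where U: "\<And>x. x \<in> A \<Longrightarrow> openin X (U x) \<and> x \<in> U x \<and> (\<forall>y\<in>U x. f x + f y - 2 * merge_height x y < \<delta>)"
    using near[OF _ \<delta>] by metis
  have "\<exists>\<F>. finite \<F> \<and> \<F> \<subseteq> U ` A \<and> A \<subseteq> \<Union>\<F>"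
    by (rule compactinD[of X]) (use U compact in \<open>auto simp: compact_space_def\<close>)
  then obtain \<F> where "finite \<F>" "\<F> \<subseteq> U ` A" "A \<subseteq> \<Union>\<F>" by blast
  then obtain N where N: "N \<subseteq> A" "finite N" "A \<subseteq> \<Union>(U ` N)" by (metis finite_subset_image)
  have "\<exists>x\<in>N. f x + f y - 2 * merge_height x y < \<delta>" if "y \<in> A" for y
    using N that U by blast
  then show "\<exists>N. finite N \<and> N \<subseteq> A \<and> (\<forall>y\<in>A. \<exists>x\<in>N. f x + f y - 2 * merge_height x y < \<delta>)" using N by blast
next
  fix x h assume x: "x \<in> A" and h: "h \<le> f x"
  let ?C = "{y \<in> A. h \<le> merge_height x y}"
  \<comment> \<open>A failure of h \<le> \<open>merge_height x y\<close> persists within distance h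
    - \<open>merge_height x y\<close> of y, by the ultrametric inequality.\<close>
  have "openin X (A - ?C)"
  proof (subst openin_subopen, intro ballI)
    fix y assume y: "y \<in> A - ?C"
    then have yA: "y \<in> A" and lt: "0 < h - merge_height x y" by auto
    obtain U where U: "openin X U" "y \<in> U" "\<And>z. z \<in> U \<Longrightarrow> f y + f z - 2 * merge_height y z < h - merge_height x y"
      using near[OF yA lt] by blast
    have "z \<in> A - ?C" if z: "z \<in> U" for z
    proof -
      have zA: "z \<in> A" using z openin_subset[OF U(1)] by auto
      have "\<not> h \<le> merge_height x z"
      proof
        assume le: "h \<le> merge_height x z"
        have "merge_height x y < merge_height y z"
          using U(3)[OF z] g_le[OF yA zA] g_le2[OF x zA] le by linarith
        then show False
          using g_ultra[OF x zA yA] g_sym[OF yA zA] le lt by linarith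
      qed
      then show ?thesis using zA by simp
    qed
    then show "\<exists>U. openin X U \<and> y \<in> U \<and> U \<subseteq> A - ?C" using U by blast
  qed
  then have "closedin X ?C" by (simp add: closedin_def)
  moreover have "x \<in> ?C" using x h g_self[OF x] by simp
  ultimately obtain y where "y \<in> ?C" "\<forall>z\<in>?C. f z \<le> f y" using attains_sup[of ?C] by blast
  then show "\<exists>y\<in>A. h \<le> merge_height x y \<and> (\<forall>z\<in>A. h \<le> merge_height x z \<longrightarrow> f z \<le> f y)" by blast
qed

text \<open>Travel along a path towards y and stop at the first time when f \<le> h: before that f
  exceeds h, so the stopping point has height h and merges with x at h.\<close>

lemma descend:
  assumes x: "x \<in> A" and y: "y \<in> A" and h: "f y \<le> h" "h \<le> f x"
  shows "\<exists>z\<in>A. f z = h \<and> merge_height x z = h"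
proof -
  obtain \<gamma> where \<gamma>: "pathin X \<gamma>" "\<gamma> 0 = x" "\<gamma> 1 = y" using path_exists[OF x y] by blast
  let ?F = "\<lambda>t. f (\<gamma> t)"
  note c = path_cont[OF \<gamma>(1)]
  let ?L = "{t \<in> {0..1}. ?F t \<le> h}"
  have "closed ?L" using continuous_on_closed_Collect_le[OF c continuous_on_const closed_atLeastAtMost] by simp
  moreover have "bounded ?L" by (rule bounded_subset[of "{0..1}"]) auto
  ultimately have "compact ?L" by (simp add: compact_eq_bounded_closed)
  moreover have "1 \<in> ?L" using \<gamma> h by simp
  ultimately obtain t where t: "t \<in> ?L" "\<And>u. u \<in> ?L \<Longrightarrow> t \<le> u"
    using compact_attains_inf[of ?L] by blast
  have before: "h < ?F u" if "0 \<le> u" "u < t" for u using t(2)[of u] t(1) that by force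
  obtain u where u: "0 \<le> u" "u \<le> t" "?F u = h"
    using IVT2'[of ?F t h 0] t(1) \<gamma>(2) h(2) continuous_on_subset[OF c, of "{0..t}"] by auto
  then have "u = t" using before[of u] by force
  then have Ft: "?F t = h" using u by simp
  have tA: "\<gamma> t \<in> A" using path_in[OF \<gamma>(1)] t by simp
  have "s \<le> merge_height x (\<gamma> t)" if "s < h" for s
  proof -
    \<comment> \<open>Rescaling time by t turns the initial piece of the path into a path on the
      unit interval.\<close>
    have "continuous_map (top_of_set {0..1}) (top_of_set {0..1}) (\<lambda>u. t * u)"
      using t(1) by (auto simp: continuous_map_in_subtopology intro!: continuous_intros mult_le_one)
    then have p: "pathin X (\<lambda>u. \<gamma> (t * u))"
      using continuous_map_compose[of _ _ "\<lambda>u. t * u" X \<gamma>] \<gamma>(1) unfolding pathin_def comp_def by blast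
    have "s < f (\<gamma> (t * u))" if "u \<in> {0..1}" for u
    proof (cases "t * u = t")
      case True show ?thesis unfolding True using Ft \<open>s < h\<close> by simp
    next
      case False
      have le: "t * u \<le> t" and nonneg: "0 \<le> t * u" using t(1) that by (auto simp: mult_left_le)
      have lt: "t * u < t" using le False by linarith
      show ?thesis by (rule less_trans[OF \<open>s < h\<close> before[OF nonneg lt]])
    qed
    then have "path_component_of (subtopology X {x \<in> A. s < f x}) x (\<gamma> t)"
      unfolding path_component_of_def pathin_subtopology
      by (intro exI[of _ "\<lambda>u. \<gamma> (t * u)"]) (use p path_in[OF p] \<gamma>(2) in auto)
    then show ?thesis using merge_height_gt[OF x tA, of s] by simp
  qed
  then have "h \<le> merge_height x (\<gamma> t)" by (rule dense_le)
  then have "merge_height x (\<gamma> t) = h" using g_le2[OF x tA] Ft by simp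
  then show ?thesis using tA Ft by blast
qed

section \<open>The quotient tree\<close>

definition rel :: "('a \<times> 'a) set" where
  "rel = {(x, y). x \<in> A \<and> y \<in> A \<and> path_pseudodist X f x y = 0}"

lemma path_pseudodist_eq: "path_pseudodist X f x y = f x + f y - 2 * merge_height x y"
  by (simp add: path_pseudodist_def merge_height_def)

lemma rel_iff: "(x, y) \<in> rel \<longleftrightarrow> x \<in> A \<and> y \<in> A \<and> f x \<le> merge_height x y \<and> f y \<le> merge_height x y"
  using g_le[of x y] g_le2[of x y] by (auto simp: rel_def path_pseudodist_eq)

lemma rel_equiv: "equiv A rel"
proof (rule equivI)
  show "rel \<subseteq> A \<times> A" by (auto simp: rel_def)
  show "refl_on A rel" by (auto simp: refl_on_def rel_iff g_self)
  show "sym rel" by (auto simp: sym_def rel_iff g_sym)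
  show "trans rel"
  proof (rule transI)
    fix x y z assume "(x, y) \<in> rel" "(y, z) \<in> rel"
    then have h: "x \<in> A" "y \<in> A" "z \<in> A" "f x \<le> merge_height x y" "f y \<le> merge_height x y"
      "f y \<le> merge_height y z" "f z \<le> merge_height y z" by (auto simp: rel_iff)
    then show "(x, z) \<in> rel"
      using g_ultra[OF h(1-3)] g_le[OF h(1,2)] g_le2[OF h(1,2)] g_le[OF h(2,3)] g_le2[OF h(2,3)]
      by (auto simp: rel_iff)
  qed
qed

lemma rel_merge:
  assumes "(x, x') \<in> rel" "y \<in> A"
  shows "merge_height x y = merge_height x' y" "f x = f x'"
proof -
  have h: "x \<in> A" "x' \<in> A" "f x \<le> merge_height x x'" "f x' \<le> merge_height x x'" using assms(1) by (auto simp: rel_iff)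
  show "f x = f x'" using h g_le[OF h(1,2)] g_le2[OF h(1,2)] by simp
  show "merge_height x y = merge_height x' y"
    using g_ultra[OF h(1,2) assms(2)] g_ultra[OF h(2,1) assms(2)] g_sym[OF h(1,2)] h(3,4)
      g_le[OF h(1) assms(2)] g_le[OF h(2) assms(2)] by linarith
qed

abbreviation "T \<equiv> tree_points X f"

lemma T_eq: "T = A // rel"
  by (simp add: tree_points_def rel_def)

text \<open>The same choice as in \<open>tree_dist\<close>, so that distances unfold to those of
  representatives.\<close>

definition rep :: "'a set \<Rightarrow> 'a" where
  "rep \<tau> = (SOME x. x \<in> \<tau>)"

definition proj :: "'a \<Rightarrow> 'a set" where
  "proj x = rel `` {x}"

lemma rep: 
  assumes "\<tau> \<in> T"
  shows "rep \<tau> \<in> \<tau>" "rep \<tau> \<in> A" "proj (rep \<tau>) = \<tau>"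
proof -
  have ne: "\<tau> \<noteq> {}" using assms rel_equiv by (auto simp: T_eq in_quotient_imp_non_empty)
  show r: "rep \<tau> \<in> \<tau>" unfolding rep_def using ne by (simp add: some_in_eq)
  then show "rep \<tau> \<in> A" using assms in_quotient_imp_subset[OF rel_equiv] by (auto simp: T_eq)
  show "proj (rep \<tau>) = \<tau>" unfolding proj_def
    using assms r by (auto simp: T_eq quotient_def dest: equiv_class_eq[OF rel_equiv])
qed

lemma proj: 
  assumes "x \<in> A"
  shows "proj x \<in> T" "(rep (proj x), x) \<in> rel"
proof -
  show p: "proj x \<in> T" unfolding proj_def T_eq using assms by (rule quotientI)
  have "(x, rep (proj x)) \<in> rel" using rep(1)[OF p] by (simp add: proj_def)
  then show "(rep (proj x), x) \<in> rel" using rel_equiv by (auto simp: equiv_def sym_def)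
qed

definition tree_merge :: "'a set \<Rightarrow> 'a set \<Rightarrow> real" where
  "tree_merge \<sigma> \<tau> = merge_height (rep \<sigma>) (rep \<tau>)"

lemma tree_merge_proj: "x \<in> A \<Longrightarrow> y \<in> A \<Longrightarrow> tree_merge (proj x) (proj y) = merge_height x y"
  using rel_merge(1)[OF proj(2)[of x], of "rep (proj y)"] rel_merge(1)[OF proj(2)[of y], of x]
    rep(2)[OF proj(1)[of y]] rep(2)[OF proj(1)[of x]]
  by (simp add: tree_merge_def g_sym)

lemma tree_dist_eq: 
  "tree_dist X f \<sigma> \<tau> = (if \<sigma> \<in> T \<and> \<tau> \<in> T then f (rep \<sigma>) + f (rep \<tau>) - 2 * tree_merge \<sigma> \<tau> else 0)"
  by (simp add: tree_dist_def path_pseudodist_eq rep_def tree_merge_def)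

text \<open>For empty X the description defining \<open>tree_root\<close> has no solution; that case
  is treated apart.\<close>

context
  assumes nonempty: "A \<noteq> {}"
begin

text \<open>Every path stays above the global minimum, so a minimum point merges with any other
  point at its own height.\<close>

lemma bottom: "\<exists>b\<in>A. (INF y\<in>A. f y) = f b \<and> (\<forall>y\<in>A. f b \<le> f y \<and> merge_height b y = f b)"
proof -
  obtain b where b: "b \<in> A" "\<And>y. y \<in> A \<Longrightarrow> f b \<le> f y" using attains_inf[OF nonempty] by blast
  have "(INF y\<in>A. f y) = f b" by (rule cInf_eq_minimum) (use b in auto)
  moreover have "merge_height b y = f b" if y: "y \<in> A" for y
  proof -
    obtain \<gamma> where \<gamma>: "pathin X \<gamma>" "\<gamma> 0 = b" "\<gamma> 1 = y" using path_exists[OF b(1) y] by blast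
    have "s \<le> merge_height b y" if "s < f b" for s
    proof -
      have "path_component_of (subtopology X {x \<in> A. s < f x}) b y"
        unfolding path_component_of_def pathin_subtopology
        by (intro exI[of _ \<gamma>]) (use \<gamma> path_in[OF \<gamma>(1)] b(2) that in \<open>force intro: less_le_trans\<close>)
      then show ?thesis using merge_height_gt[OF b(1) y, of s] by simp
    qed
    then have "f b \<le> merge_height b y" by (rule dense_le)
    then show ?thesis using g_le[OF b(1) y] by simp
  qed
  ultimately show ?thesis using b by blast
qed

lemma tree_root:
  shows "tree_root X f \<in> T" "f (rep (tree_root X f)) = (INF y\<in>A. f y)"
    "\<And>y. y \<in> A \<Longrightarrow> f (rep (tree_root X f)) \<le> f y"
    "\<And>y. y \<in> A \<Longrightarrow> merge_height (rep (tree_root X f)) y = f (rep (tree_root X f))"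
proof -
  obtain b where b: "b \<in> A" "(INF y\<in>A. f y) = f b" "\<And>y. y \<in> A \<Longrightarrow> f b \<le> f y" "\<And>y. y \<in> A \<Longrightarrow> merge_height b y = f b"
    using bottom by blast
  have "tree_root X f = proj b"
    unfolding tree_root_def
  proof (rule the_equality)
    show "proj b \<in> T \<and> (\<forall>x\<in>proj b. f x = (INF y\<in>A. f y))"
      using proj(1)[OF b(1)] rel_merge(2)[of b _ b] b by (auto simp: proj_def)
  next
    fix \<tau> assume \<tau>: "\<tau> \<in> T \<and> (\<forall>x\<in>\<tau>. f x = (INF y\<in>A. f y))"
    then have r: "rep \<tau> \<in> A" "f (rep \<tau>) = f b" "proj (rep \<tau>) = \<tau>" using rep[of \<tau>] b(2) by auto
    \<comment> \<open>All minimum points are at distance 0 from b, so they form one point of the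
      tree.\<close>
    have "(b, rep \<tau>) \<in> rel" using b(1) b(4)[OF r(1)] r by (simp add: rel_iff)
    then show "\<tau> = proj b" using r(3) equiv_class_eq[OF rel_equiv] unfolding proj_def by metis
  qed
  then have t: "tree_root X f = proj b" .
  show "tree_root X f \<in> T" unfolding t by (rule proj(1)[OF b(1)])
  have fr: "f (rep (tree_root X f)) = f b" unfolding t by (rule rel_merge(2)[OF proj(2)[OF b(1)] b(1)])
  then show "f (rep (tree_root X f)) = (INF y\<in>A. f y)" "\<And>y. y \<in> A \<Longrightarrow> f (rep (tree_root X f)) \<le> f y" using b by auto
  show "merge_height (rep (tree_root X f)) y = f (rep (tree_root X f))" if "y \<in> A" for y
    unfolding fr unfolding t using rel_merge(1)[OF proj(2)[OF b(1)] that] b(4)[OF that] by simp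
qed

lemma tree_height_rep: "\<tau> \<in> T \<Longrightarrow> tree_height X f \<tau> = f (rep \<tau>)"
  using tree_root(1,2) tree_root(4)[OF rep(2)[of \<tau>]]
  by (simp add: tree_height_def tree_dist_eq tree_merge_def)

lemma tree_height_proj: "x \<in> A \<Longrightarrow> tree_height X f (proj x) = f x"
  using tree_height_rep[OF proj(1)] rel_merge(2)[OF proj(2)] by simp

lemma compact_merge_tree: "compact_merge_tree T (tree_height X f) tree_merge (tree_dist X f) (tree_root X f)"
proof
  note r = rep(2) and hr = tree_height_rep
  show "tree_merge \<tau> \<tau> = tree_height X f \<tau>" if "\<tau> \<in> T" for \<tau>
    using that g_self[OF r] by (simp add: tree_merge_def hr)
  show "tree_merge \<sigma> \<tau> = tree_merge \<tau> \<sigma>" if "\<sigma> \<in> T" "\<tau> \<in> T" for \<sigma> \<tau>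
    using g_sym[OF r r] that by (simp add: tree_merge_def)
  show "tree_merge \<sigma> \<tau> \<le> tree_height X f \<sigma>" if "\<sigma> \<in> T" "\<tau> \<in> T" for \<sigma> \<tau>
    using g_le[OF r r] that by (simp add: tree_merge_def hr)
  show "min (tree_merge \<sigma> \<tau>) (tree_merge \<tau> \<upsilon>) \<le> tree_merge \<sigma> \<upsilon>" if "\<sigma> \<in> T" "\<tau> \<in> T" "\<upsilon> \<in> T" for \<sigma> \<tau> \<upsilon>
    using g_ultra[OF r r r] that by (simp add: tree_merge_def)
  show "tree_dist X f \<sigma> \<tau> = (if \<sigma> \<in> T \<and> \<tau> \<in> T then tree_height X f \<sigma> + tree_height X f \<tau> - 2 * tree_merge \<sigma> \<tau> else 0)" for \<sigma> \<tau>
    by (simp add: tree_dist_eq hr)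
  show "\<sigma> = \<tau>" if "\<sigma> \<in> T" "\<tau> \<in> T" "tree_height X f \<sigma> + tree_height X f \<tau> - 2 * tree_merge \<sigma> \<tau> = 0" for \<sigma> \<tau>
  proof -
    have "(rep \<sigma>, rep \<tau>) \<in> rel"
      using that r by (simp add: rel_def path_pseudodist_eq hr tree_merge_def)
    then have "proj (rep \<sigma>) = proj (rep \<tau>)" unfolding proj_def by (rule equiv_class_eq[OF rel_equiv])
    then show ?thesis using rep(3) that by simp
  qed
  show "tree_root X f \<in> T" by (rule tree_root(1))
  show "tree_merge (tree_root X f) \<tau> = tree_height X f (tree_root X f)" if "\<tau> \<in> T" for \<tau>
    using tree_root(4)[OF r[OF that]] by (simp add: tree_merge_def hr tree_root(1))
  show "\<exists>\<sigma>\<in>T. tree_height X f \<sigma> = h \<and> tree_merge \<tau> \<sigma> = h"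
    if \<tau>: "\<tau> \<in> T" and h: "tree_height X f (tree_root X f) \<le> h" "h \<le> tree_height X f \<tau>" for \<tau> h
  proof -
    obtain z where z: "z \<in> A" "f z = h" "merge_height (rep \<tau>) z = h"
      using descend[OF r[OF \<tau>] r[OF tree_root(1)], of h] h \<tau> by (auto simp: hr tree_root(1))
    have "tree_merge \<tau> (proj z) = h" using tree_merge_proj[OF r[OF \<tau>] z(1)] rep(3)[OF \<tau>] z(3) by simp
    then show ?thesis using proj(1)[OF z(1)] tree_height_proj[OF z(1)] z(2) by (intro bexI[of _ "proj z"]) auto
  qed
  show "\<exists>N. finite N \<and> N \<subseteq> T \<and> (\<forall>\<tau>\<in>T. \<exists>\<sigma>\<in>N. tree_height X f \<sigma> + tree_height X f \<tau> - 2 * tree_merge \<sigma> \<tau> < \<delta>)"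
    if "0 < \<delta>" for \<delta>
  proof -
    obtain N where N: "finite N" "N \<subseteq> A" "\<And>y. y \<in> A \<Longrightarrow> \<exists>x\<in>N. f x + f y - 2 * merge_height x y < \<delta>"
      using totally_bounded[OF \<open>0 < \<delta>\<close>] by blast
    have "\<exists>\<sigma>\<in>proj ` N. tree_height X f \<sigma> + tree_height X f \<tau> - 2 * tree_merge \<sigma> \<tau> < \<delta>" if \<tau>: "\<tau> \<in> T" for \<tau>
    proof -
      obtain x where x: "x \<in> N" "f x + f (rep \<tau>) - 2 * merge_height x (rep \<tau>) < \<delta>" using N(3)[OF r[OF \<tau>]] by blast
      then have "x \<in> A" using N by blast
      then have "tree_height X f (proj x) + tree_height X f \<tau> - 2 * tree_merge (proj x) \<tau> < \<delta>"
        using x(2) tree_merge_proj[OF _ r[OF \<tau>], of x] rep(3)[OF \<tau>] by (simp add: tree_height_proj hr[OF \<tau>])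
      then show ?thesis using x(1) by blast
    qed
    moreover have "proj ` N \<subseteq> T" using N(2) proj(1) by blast
    ultimately show ?thesis using N(1) by blast
  qed
  show "\<exists>\<sigma>\<in>T. h \<le> tree_merge \<tau> \<sigma> \<and> (\<forall>\<upsilon>\<in>T. h \<le> tree_merge \<tau> \<upsilon> \<longrightarrow> tree_height X f \<upsilon> \<le> tree_height X f \<sigma>)"
    if \<tau>: "\<tau> \<in> T" and h: "h \<le> tree_height X f \<tau>" for \<tau> h
  proof -
    obtain y where y: "y \<in> A" "h \<le> merge_height (rep \<tau>) y" "\<And>z. z \<in> A \<Longrightarrow> h \<le> merge_height (rep \<tau>) z \<Longrightarrow> f z \<le> f y"
      using closed_max[OF r[OF \<tau>], of h] h hr[OF \<tau>] by auto
    have "h \<le> tree_merge \<tau> (proj y)" using tree_merge_proj[OF r[OF \<tau>] y(1)] rep(3)[OF \<tau>] y(2) by simp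
    moreover have "tree_height X f \<upsilon> \<le> tree_height X f (proj y)" if "\<upsilon> \<in> T" "h \<le> tree_merge \<tau> \<upsilon>" for \<upsilon>
      using y(3)[OF r[OF that(1)]] that by (simp add: tree_height_proj[OF y(1)] hr tree_merge_def)
    ultimately show ?thesis using proj(1)[OF y(1)] by blast
  qed
qed

interpretation tree: compact_merge_tree T "tree_height X f" tree_merge "tree_dist X f" "tree_root X f"
  by (rule compact_merge_tree)

text \<open>Merge heights depend on classes only, so the clusters of X are saturated and the
  projection matches them with those of the tree.\<close>

lemma tall_clusters_card: "card (tree.tall_clusters s r) = card (tall_clusters s r)"
proof -
  have img: "proj ` cls s x = tree.cls s (proj x)" if x: "x \<in> A" for x
  proof (intro equalityI subsetI)
    fix \<tau> assume "\<tau> \<in> proj ` cls s x"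
    then show "\<tau> \<in> tree.cls s (proj x)" using x proj(1) by (auto simp: cls_def tree.cls_def tree_merge_proj)
  next
    fix \<tau> assume "\<tau> \<in> tree.cls s (proj x)"
    then have \<tau>: "\<tau> \<in> T" "s < tree_merge (proj x) \<tau>" by (auto simp: tree.cls_def)
    then have "rep \<tau> \<in> cls s x" using tree_merge_proj[OF x rep(2)[OF \<tau>(1)]] rep(2,3)[OF \<tau>(1)] by (simp add: cls_def)
    then show "\<tau> \<in> proj ` cls s x" using rep(3)[OF \<tau>(1)] by (metis imageI)
  qed
  have "bij_betw (image proj) (tall_clusters s r) (tree.tall_clusters s r)"
    unfolding bij_betw_def
  proof
    show "inj_on (image proj) (tall_clusters s r)"
    proof (rule inj_onI)
      fix C D assume "C \<in> tall_clusters s r" "D \<in> tall_clusters s r" and eq: "proj ` C = proj ` D"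
      then obtain x y where x: "x \<in> A" "C = cls s x" and y: "y \<in> A" "D = cls s y" by (auto simp: tall_clusters_def)
      have "z \<in> cls s b" if z: "z \<in> cls s a" "proj ` cls s a = proj ` cls s b" "a \<in> A" "b \<in> A" for a b z
      proof -
        have zA: "z \<in> A" using z by (simp add: cls_def)
        obtain w where w: "w \<in> cls s b" "proj z = proj w" using z by blast
        have wA: "w \<in> A" using w by (simp add: cls_def)
        have "merge_height b z = merge_height b w"
          using tree_merge_proj[OF z(4) zA] tree_merge_proj[OF z(4) wA] w(2) by simp
        then show ?thesis using w zA by (simp add: cls_def)
      qed
      then show "C = D" using x y eq by (intro equalityI subsetI) metis+
    qed
    show "image proj ` tall_clusters s r = tree.tall_clusters s r"
    proof (intro equalityI subsetI)
      fix D assume "D \<in> image proj ` tall_clusters s r"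
      then show "D \<in> tree.tall_clusters s r"
        using img proj(1) tree_height_proj by (fastforce simp: tall_clusters_def tree.tall_clusters_def)
    next
      fix D assume "D \<in> tree.tall_clusters s r"
      then obtain \<tau> where \<tau>: "\<tau> \<in> T" "r < tree_height X f \<tau>" "D = tree.cls s \<tau>" by (auto simp: tree.tall_clusters_def)
      then have "D = proj ` cls s (rep \<tau>)" using img[OF rep(2)[OF \<tau>(1)]] rep(3)[OF \<tau>(1)] by simp
      moreover have "cls s (rep \<tau>) \<in> tall_clusters s r"
        using rep(2)[OF \<tau>(1)] \<tau>(2) tree_height_rep[OF \<tau>(1)] by (auto simp: tall_clusters_def)
      ultimately show "D \<in> image proj ` tall_clusters s r" by blast
    qed
  qed
  then show ?thesis using bij_betw_same_card by fastforce
qed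

end

lemma interval_module_same_barcode_H0:
  assumes "\<And>i. i \<in> I \<Longrightarrow> has_ends (J i) (e i)" "\<And>i. i \<in> I \<Longrightarrow> fst (e i) < ereal (snd (e i))"
    and "\<And>s r. s < r \<Longrightarrow> finite (long_bars I e s r) \<and> card (long_bars I e s r) = card (tall_clusters s r)"
  shows "same_barcode (interval_module I J :: ('k::field, _) persmod) (H0_superlevel X f :: ('k, _) persmod)"
  by (rule same_barcode_trans[OF persistence_module_interval[OF assms(1)] parts.persistence_module_parts
        persistence_module_H0 same_barcode_parts_module[OF assms] parts_module_same_barcode_H0])

lemma bar_interval_has_ends: "has_ends (bar_interval B) B"
  by (auto simp: has_ends_def bar_interval_def)

lemma finite_tree_barcode:
  assumes "finite_tree T (tree_dist X f) (tree_root X f)"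
  shows "\<exists>bs. alg_finite T (tree_dist X f) (tree_height X f) bs"
    and "alg_finite T (tree_dist X f) (tree_height X f) bs \<Longrightarrow>
      same_barcode (bars_module bs :: ('k::field, _) persmod) (H0_superlevel X f :: ('k, _) persmod)"
proof -
  have *: "(\<exists>bs. alg_finite T (tree_dist X f) (tree_height X f) bs) \<and>
    (\<forall>bs. alg_finite T (tree_dist X f) (tree_height X f) bs \<longrightarrow>
      (\<forall>i<length bs. fst (bs ! i) < ereal (snd (bs ! i))) \<and>
      (\<forall>s r. s < r \<longrightarrow> card (long_bars {..<length bs} (\<lambda>i. bs ! i) s r) = card (tall_clusters s r)))"
  proof (cases "A = {}")
    case True
    \<comment> \<open>For the empty space the tree is empty, Alg returns no bars, and there are no
      clusters to count.\<close>
    then have "T = {}" unfolding T_eq quotient_def by blast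
    moreover have "tall_clusters s r = {}" for s r using True unfolding tall_clusters_def by blast
    ultimately show ?thesis by (simp add: alg_finite_empty long_bars_def)
  next
    case False
    interpret tree: compact_merge_tree T "tree_height X f" tree_merge "tree_dist X f" "tree_root X f"
      by (rule compact_merge_tree[OF False])
    show ?thesis
      using tree.alg_finite_tree_exists[OF assms] tree.tall_card_finite_tree[OF assms] tall_clusters_card[OF False]
      by auto
  qed
  then show "\<exists>bs. alg_finite T (tree_dist X f) (tree_height X f) bs" by blast
  assume "alg_finite T (tree_dist X f) (tree_height X f) bs"
  then have b: "\<And>i. i < length bs \<Longrightarrow> fst (bs ! i) < ereal (snd (bs ! i))"
    "\<And>s r. s < r \<Longrightarrow> card (long_bars {..<length bs} (\<lambda>i. bs ! i) s r) = card (tall_clusters s r)" using * by auto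
  show "same_barcode (bars_module bs :: ('k::field, _) persmod) (H0_superlevel X f :: ('k, _) persmod)"
    unfolding bars_module_eq
    by (rule interval_module_same_barcode_H0[where e = "\<lambda>i. bs ! i"])
       (use b bar_interval_has_ends in \<open>auto simp: long_bars_def\<close>)
qed

text \<open>For every choice of runs and matchings, the stages eventually have as many long bars as
  there are tall clusters; the threads inherit this count, and it determines the barcode of the
  limit.\<close>

lemma infinite_tree_barcode:
  assumes inf: "\<not> finite_tree T (tree_dist X f) (tree_root X f)"
    and \<epsilon>: "\<And>n. 0 < \<epsilon> n" "decseq \<epsilon>" "\<epsilon> \<longlonglongrightarrow> 0"
  shows "\<exists>bs \<sigma>. alg_system T (tree_dist X f) (tree_root X f) (tree_height X f) \<epsilon> bs \<sigma>"
    and "alg_system T (tree_dist X f) (tree_root X f) (tree_height X f) \<epsilon> bs \<sigma> \<Longrightarrow>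
      same_barcode (alg_limit bs \<sigma> :: ('k::field, _) persmod) (H0_superlevel X f :: ('k, _) persmod)"
proof -
  have ne: "A \<noteq> {}"
  proof
    assume "A = {}"
    then have "T = {}" unfolding T_eq quotient_def by blast
    then show False using inf by (simp add: finite_tree_def is_leaf_def)
  qed
  interpret tree: compact_merge_tree T "tree_height X f" tree_merge "tree_dist X f" "tree_root X f"
    by (rule compact_merge_tree[OF ne])
  show "\<exists>bs \<sigma>. alg_system T (tree_dist X f) (tree_root X f) (tree_height X f) \<epsilon> bs \<sigma>"
    by (rule tree.alg_system_exists[OF \<epsilon>(1,2)])
  assume sys: "alg_system T (tree_dist X f) (tree_root X f) (tree_height X f) \<epsilon> bs \<sigma>"
  note bars = tree.alg_system_bars[OF \<epsilon>(1,3) sys tree.infinite_tree_high[OF inf]]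
  obtain M where "bar_system bs \<sigma> M" using bars(1) by blast
  then interpret B: bar_system bs \<sigma> M .
  have N: "finite (long_bars B.threads B.thread_bar s r) \<and> card (long_bars B.threads B.thread_bar s r) = card (tall_clusters s r)"
    if sr: "s < r" for s r
  proof -
    obtain n0 where "\<And>n. n0 \<le> n \<Longrightarrow> card (long_bars {..<length (bs n)} (\<lambda>i. bs n ! i) s r) = card (tall_clusters s r)"
      using bars(2)[OF sr] tall_clusters_card[OF ne] by auto
    then show ?thesis by (rule B.long_bars_threads)
  qed
  let ?V = "interval_module B.threads B.thread_interval :: ('k, _) persmod"
  have "same_barcode ?V (H0_superlevel X f :: ('k, _) persmod)"
    by (rule interval_module_same_barcode_H0[OF B.thread_has_ends N])
  moreover have "persistence_module ?V" by (rule persistence_module_interval[OF B.thread_has_ends(1)])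
  ultimately show "same_barcode (alg_limit bs \<sigma> :: ('k, _) persmod) (H0_superlevel X f :: ('k, _) persmod)"
    using same_barcode_trans[OF B.alg_limit_same_barcode(1) _ persistence_module_H0 same_barcode_sym[OF B.alg_limit_same_barcode(2)]]
    by blast
qed

end

theorem theorem2p16:
  fixes X :: "'a topology" and f :: "'a \<Rightarrow> real"
  assumes "compact_space X" and "connected_space X" and "locally_path_connected_space X"
    and "continuous_map X euclideanreal f"
  defines "T \<equiv> tree_points X f" and "d \<equiv> tree_dist X f"
    and "R \<equiv> tree_root X f" and "l \<equiv> tree_height X f"
    and "H \<equiv> (H0_superlevel X f :: ('k::field, 'a set set \<Rightarrow> ('a set \<Rightarrow> 'k) set) persmod)"
  shows "(finite_tree T d R \<longrightarrow>
            (\<exists>bs. alg_finite T d l bs) \<and>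
            (\<forall>bs. alg_finite T d l bs \<longrightarrow> same_barcode (bars_module bs) H)) \<and>
         (\<not> finite_tree T d R \<longrightarrow>
            (\<forall>\<epsilon>. (\<forall>n. 0 < \<epsilon> n) \<and> decseq \<epsilon> \<and> \<epsilon> \<longlonglongrightarrow> 0 \<longrightarrow>
              (\<exists>bs \<sigma>. alg_system T d R l \<epsilon> bs \<sigma>) \<and>
              (\<forall>bs \<sigma>. alg_system T d R l \<epsilon> bs \<sigma> \<longrightarrow> same_barcode (alg_limit bs \<sigma>) H)))"
proof -
  interpret F: compact_function X f by (rule compact_function.intro[OF assms(1-4)])
  show ?thesis
    unfolding T_def d_def R_def l_def H_def
    using F.finite_tree_barcode F.infinite_tree_barcode by blast
qed

end
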